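(* Assume: (1) $(A,B)$ is stabilizable; (2) $(A,C)$ is observable; (3) $S$ has no eigenvalues with negative real parts; (4) $\operatorname{rank}\begin{bmatrix} A-\lambda I_n & B\\ C & \mathbf 0\end{bmatrix}=n+p$ for every eigenvalue $\lambda$ of $S$; (5) the minimal polynomial of $S$ is known (so that the minimal $p$-copy internal model $(G_1,G_2)$ of $S$ is available). Let $L\in\mathbb R^{n\times p}$ be such that $A-LC$ is Hurwitz, and let $$A_\rho=\begin{bmatrix}A_\zeta&\mathbf 0\\ G_2CM&G_1\end{bmatrix},\qquad B_\rho=\begin{bmatrix}B_\zeta\\ \mathbf 0\end{bmatrix}.$$ Then: (i) The pair $(A_\rho,B_\rho)$ is stabilizable. (ii) Let $K_\rho$ be any matrix such that $A_\rho+B_\rho K_\rho$ is Hurwitz. Then the dynamic output-feedback control law $$u=K_\rho\rho,\qquad \dot\zeta=(I_{m+p}\otimes\mathcal A)\zeta+B_\zeta u+E_\zeta y,\qquad \dot z=G_1z+G_2e,\qquad \rho=\begin{bmatrix}\zeta\\ z\end{bmatrix},$$ solves the output regulation problem for the plant $\dot x=Ax+Bu+Ev$, $y=Cx$, $e=Cx+Fv$ with exosystem $\dot v=Sv$; that is, the closed-loop system with state $(x,\zeta,z)$ is exponentially stable when $v$ is set to zero, and $\lim_{t\to\infty}e(t)=0$ for all initial conditions $x(0),\zeta(0),z(0),v(0)$.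
   Context: Plant: $\dot x=Ax+Bu+Ev$, $y=Cx$, $e=Cx+Fv$, with state $x\in\mathbb R^n$, input $u\in\mathbb R^m$, measurement output $y\in\mathbb R^p$, regulated output $e\in\mathbb R^p$, and real constant matrices $A,B,C,E,F$ of compatible sizes. Exosystem: $\dot v=Sv$, $v\in\mathbb R^q$. A matrix is Hurwitz if all its eigenvalues have negative real parts. The problem is posed for unknown plant parameters $A,B,C,E,F$: the controller equations involve only $K_\rho$, the user-specified characteristic polynomial $\Lambda$ below (through $\mathcal A$), $b$, and $G_1,G_2$. Assumption (5) is purely informational and imposes no mathematical restriction on the data. Minimal $p$-copy internal model of $S$: $G_1=\mathrm{blockdiag}(\beta,\dots,\beta)$ and $G_2=\mathrm{blockdiag}(\sigma,\dots,\sigma)$ ($p$ copies each), where $\beta$ is a constant real square matrix whose characteristic polynomial equals the minimal polynomial of $S$ and $\sigma$ is a constant column vector such that $(\beta,\sigma)$ is controllable. $n_z$ is the size of $G_1$, so $z\in\mathbb R^{n_z}$. Objects built from $L$: let $\Lambda(s)=\det(sI_n-A+LC)=s^n+\alpha_{n-1}s^{n-1}+\cdots+\alpha_1s+\alpha_0$ and write $(sI_n-A+LC)^{-1}=\dfrac{D_{n-1}s^{n-1}+\cdots+D_1s+D_0}{\Lambda(s)}$ with $D_i\in\mathbb R^{n\times n}$. $\mathcal A\in\mathbb R^{n\times n}$ is the companion matrix with ones on the superdiagonal, last row $(-\alpha_0,-\alpha_1,\dots,-\alpha_{n-1})$ and all other entries zero; $b=(0,\dots,0,1)^T\in\mathbb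 R^n$. $M=[M_1,\dots,M_{m+p}]\in\mathbb R^{n\times n(m+p)}$ with $M_i=[D_0f_i,\dots,D_{n-1}f_i]$, where $f_i$ is the $i$-th column of $B$ for $1\le i\le m$ and the $(i-m)$-th column of $L$ for $m+1\le i\le m+p$. $B_\zeta=\begin{bmatrix}I_m\otimes b\\ \mathbf 0\end{bmatrix}\in\mathbb R^{n(m+p)\times m}$, $E_\zeta=\begin{bmatrix}\mathbf 0\\ I_p\otimes b\end{bmatrix}\in\mathbb R^{n(m+p)\times p}$, $A_\zeta=(I_{m+p}\otimes\mathcal A)+E_\zeta CM$, and $\zeta\in\mathbb R^{n(m+p)}$. *)

theory Defs
  imports
    Complex_Main
    "Jordan_Normal_Form.Matrix"
    "Jordan_Normal_Form.Char_Poly"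
    "Jordan_Normal_Form.DL_Rank"
begin

abbreviation cmat :: "real mat \<Rightarrow> complex mat" where
  "cmat X \<equiv> map_mat complex_of_real X"

definition mat_rank :: "'a::field mat \<Rightarrow> nat" where
  "mat_rank X = vec_space.rank (dim_row X) X"

definition vec_norm :: "real vec \<Rightarrow> real" where
  "vec_norm w = sqrt (w \<bullet> w)"

text \<open>The derivative is one-sided at time zero, since signals only matter on the half-line.\<close>

definition has_vec_deriv :: "(real \<Rightarrow> real vec) \<Rightarrow> real vec \<Rightarrow> real \<Rightarrow> bool" where
  "has_vec_deriv x x' t \<longleftrightarrow>
     (\<forall>i < dim_vec x'. ((\<lambda>\<tau>. x \<tau> $ i) has_real_derivative x' $ i) (at t within {0..}))"

definition kron :: "'a::semiring_0 mat \<Rightarrow> 'a mat \<Rightarrow> 'a mat" (infixl "\<otimes>\<^sub>k" 70) where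
  "X \<otimes>\<^sub>k Y = mat (dim_row X * dim_row Y) (dim_col X * dim_col Y)
     (\<lambda>(i, j). X $$ (i div dim_row Y, j div dim_col Y) * Y $$ (i mod dim_row Y, j mod dim_col Y))"


section \<open>Linear systems notions\<close>

definition hurwitz :: "real mat \<Rightarrow> bool" where
  "hurwitz X \<longleftrightarrow> (\<forall>\<mu>. eigenvalue (cmat X) \<mu> \<longrightarrow> Re \<mu> < 0)"

definition stabilizable :: "real mat \<Rightarrow> real mat \<Rightarrow> bool" where
  "stabilizable A B \<longleftrightarrow> (\<exists>K \<in> carrier_mat (dim_col B) (dim_row A). hurwitz (A + B * K))"

definition controllable :: "real mat \<Rightarrow> real mat \<Rightarrow> bool" where
  "controllable A B \<longleftrightarrow>
     mat_rank (mat_of_cols (dim_row A) (concat (map (\<lambda>k. cols (A ^\<^sub>m k * B)) [0..<dim_row A])))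
       = dim_row A"

definition observable :: "real mat \<Rightarrow> real mat \<Rightarrow> bool" where
  "observable A C \<longleftrightarrow>
     mat_rank (mat_of_rows (dim_row A) (concat (map (\<lambda>k. rows (C * A ^\<^sub>m k)) [0..<dim_row A])))
       = dim_row A"


section \<open>Internal model\<close>

definition poly_mat :: "real poly \<Rightarrow> real mat \<Rightarrow> real mat" where
  "poly_mat f X = mat (dim_row X) (dim_row X)
     (\<lambda>(i, j). \<Sum>k\<le>degree f. coeff f k * (X ^\<^sub>m k) $$ (i, j))"

definition is_min_poly :: "real mat \<Rightarrow> real poly \<Rightarrow> bool" where
  "is_min_poly X f \<longleftrightarrow>
     lead_coeff f = 1 \<and> poly_mat f X = 0\<^sub>m (dim_row X) (dim_row X) \<and>
     (\<forall>g. g \<noteq> 0 \<longrightarrow> poly_mat g X = 0\<^sub>m (dim_row X) (dim_row X) \<longrightarrow> degree f \<le> degree g)"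

text \<open>The column vector \<open>\<sigma>\<close> is a matrix with one column, so that \<open>G2\<close> has \<open>p\<close> columns.\<close>

definition min_internal_model ::
    "real mat \<Rightarrow> nat \<Rightarrow> real mat \<Rightarrow> real mat \<Rightarrow> bool" where
  "min_internal_model S p G1 G2 \<longleftrightarrow>
     (\<exists>d \<beta> \<sigma>. \<beta> \<in> carrier_mat d d \<and> \<sigma> \<in> carrier_mat d 1 \<and>
        is_min_poly S (char_poly \<beta>) \<and> controllable \<beta> \<sigma> \<and>
        G1 = diag_block_mat (replicate p \<beta>) \<and> G2 = diag_block_mat (replicate p \<sigma>))"


section \<open>Objects built from the observer gain\<close>

text \<open>\<open>D 0, \<dots>, D (n - 1)\<close> are the coefficients in
  \<open>(s I - X)\<^sup>-\<^sup>1 = (D (n - 1) s ^ (n - 1) + \<dots> + D 0) / det (s I - X)\<close>,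
  an identity in the complex variable \<open>s\<close> which determines them uniquely.\<close>

definition resolvent_coeffs :: "real mat \<Rightarrow> (nat \<Rightarrow> real mat) \<Rightarrow> bool" where
  "resolvent_coeffs X D \<longleftrightarrow>
     (let n = dim_row X in
      (\<forall>k<n. D k \<in> carrier_mat n n) \<and>
      (\<forall>s. let R = s \<cdot>\<^sub>m 1\<^sub>m n - cmat X;
               \<Lambda> = poly (char_poly (cmat X)) s;
               Q = mat n n (\<lambda>(i, j). (\<Sum>k<n. s ^ k * cmat (D k) $$ (i, j)) / \<Lambda>)
           in \<Lambda> \<noteq> 0 \<longrightarrow> inverts_mat R Q \<and> inverts_mat Q R))"

definition companion :: "real poly \<Rightarrow> real mat" where
  "companion f = mat (degree f) (degree f)
     (\<lambda>(i, j). if i = degree f - 1 then - coeff f j else if j = i + 1 then 1 else 0)"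

definition b_col :: "nat \<Rightarrow> real mat" where
  "b_col n = mat n 1 (\<lambda>(i, j). if i = n - 1 then 1 else 0)"

definition M_mat :: "(nat \<Rightarrow> real mat) \<Rightarrow> real mat \<Rightarrow> real mat \<Rightarrow> real mat" where
  "M_mat D B L = (let n = dim_row B in
     mat_of_cols n (concat (map (\<lambda>f. map (\<lambda>k. D k *\<^sub>v f) [0..<n]) (cols B @ cols L))))"

definition B_zeta :: "nat \<Rightarrow> nat \<Rightarrow> nat \<Rightarrow> real mat" where
  "B_zeta n m p = (1\<^sub>m m \<otimes>\<^sub>k b_col n) @\<^sub>r 0\<^sub>m (n * p) m"

definition E_zeta :: "nat \<Rightarrow> nat \<Rightarrow> nat \<Rightarrow> real mat" where
  "E_zeta n m p = 0\<^sub>m (n * m) p @\<^sub>r (1\<^sub>m p \<otimes>\<^sub>k b_col n)"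

definition comp_zeta :: "real mat \<Rightarrow> real mat \<Rightarrow> real mat \<Rightarrow> real mat \<Rightarrow> real mat" where
  "comp_zeta A B C L =
     1\<^sub>m (dim_col B + dim_row C) \<otimes>\<^sub>k companion (char_poly (A - L * C))"

definition A_zeta ::
    "(nat \<Rightarrow> real mat) \<Rightarrow> real mat \<Rightarrow> real mat \<Rightarrow> real mat \<Rightarrow> real mat \<Rightarrow> real mat" where
  "A_zeta D A B C L =
     comp_zeta A B C L + E_zeta (dim_row A) (dim_col B) (dim_row C) * C * M_mat D B L"

definition A_rho ::
    "(nat \<Rightarrow> real mat) \<Rightarrow> real mat \<Rightarrow> real mat \<Rightarrow> real mat \<Rightarrow> real mat \<Rightarrow> real mat \<Rightarrow> real mat \<Rightarrow>
     real mat" where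
  "A_rho D A B C L G1 G2 =
     four_block_mat
       (A_zeta D A B C L)      (0\<^sub>m (dim_row A * (dim_col B + dim_row C)) (dim_col G1))
       (G2 * C * M_mat D B L)  G1"

definition B_rho :: "real mat \<Rightarrow> real mat \<Rightarrow> real mat \<Rightarrow> real mat \<Rightarrow> real mat" where
  "B_rho A B C G1 =
     B_zeta (dim_row A) (dim_col B) (dim_row C) @\<^sub>r 0\<^sub>m (dim_row G1) (dim_col B)"


section \<open>Output regulation\<close>

text \<open>\<open>Ac\<close>, \<open>Bc\<close>, \<open>Ec\<close> are the matrices of the controller equation
  \<open>\<zeta>' = Ac \<zeta> + Bc u + Ec y\<close>.\<close>

definition closed_loop_solution ::
    "real mat \<Rightarrow> real mat \<Rightarrow> real mat \<Rightarrow> real mat \<Rightarrow> real mat \<Rightarrow> real mat \<Rightarrow>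
     real mat \<Rightarrow> real mat \<Rightarrow> real mat \<Rightarrow> real mat \<Rightarrow> real mat \<Rightarrow> real mat \<Rightarrow>
     (real \<Rightarrow> real vec) \<Rightarrow> (real \<Rightarrow> real vec) \<Rightarrow> (real \<Rightarrow> real vec) \<Rightarrow> (real \<Rightarrow> real vec) \<Rightarrow> bool" where
  "closed_loop_solution A B C E F S Ac Bc Ec G1 G2 K x \<zeta> z v \<longleftrightarrow>
     (\<forall>t\<ge>0.
        x t \<in> carrier_vec (dim_row A) \<and> \<zeta> t \<in> carrier_vec (dim_row Ac) \<and>
        z t \<in> carrier_vec (dim_row G1) \<and> v t \<in> carrier_vec (dim_row S) \<and>
        (let \<rho> = \<zeta> t @\<^sub>v z t; u = K *\<^sub>v \<rho>; y = C *\<^sub>v x t; e = C *\<^sub>v x t + F *\<^sub>v v t in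
           has_vec_deriv x (A *\<^sub>v x t + B *\<^sub>v u + E *\<^sub>v v t) t \<and>
           has_vec_deriv \<zeta> (Ac *\<^sub>v \<zeta> t + Bc *\<^sub>v u + Ec *\<^sub>v y) t \<and>
           has_vec_deriv z (G1 *\<^sub>v z t + G2 *\<^sub>v e) t \<and>
           has_vec_deriv v (S *\<^sub>v v t) t))"

definition solves_output_regulation ::
    "real mat \<Rightarrow> real mat \<Rightarrow> real mat \<Rightarrow> real mat \<Rightarrow> real mat \<Rightarrow> real mat \<Rightarrow>
     real mat \<Rightarrow> real mat \<Rightarrow> real mat \<Rightarrow> real mat \<Rightarrow> real mat \<Rightarrow> real mat \<Rightarrow> bool" where
  "solves_output_regulation A B C E F S Ac Bc Ec G1 G2 K \<longleftrightarrow>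
     (\<exists>c>0. \<exists>\<gamma>>0. \<forall>x \<zeta> z.
        closed_loop_solution A B C E F S Ac Bc Ec G1 G2 K x \<zeta> z (\<lambda>_. 0\<^sub>v (dim_row S)) \<longrightarrow>
        (\<forall>t\<ge>0. vec_norm (x t @\<^sub>v \<zeta> t @\<^sub>v z t)
                 \<le> c * exp (- \<gamma> * t) * vec_norm (x 0 @\<^sub>v \<zeta> 0 @\<^sub>v z 0))) \<and>
     (\<forall>x \<zeta> z v.
        closed_loop_solution A B C E F S Ac Bc Ec G1 G2 K x \<zeta> z v \<longrightarrow>
        ((\<lambda>t. vec_norm (C *\<^sub>v x t + F *\<^sub>v v t)) \<longlongrightarrow> 0) at_top)"

end

theory Submission
  imports Defs "Jordan_Normal_Form.Schur_Decomposition"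
begin

text \<open>
The matrix \<open>M\<close> identifies the filter in \<open>\<zeta>\<close> with an observer: \<open>M (I \<otimes> \<A>) = (A - L C) M\<close>,
\<open>M B\<^sub>\<zeta> = B\<close> and \<open>M E\<^sub>\<zeta> = L\<close>, where \<open>\<A>\<close> is the companion matrix (\<open>observer_identities\<close>). Hence
\<open>M \<zeta>\<close> is a Luenberger estimate of \<open>x\<close>, whose error \<open>M \<zeta> - x\<close> is governed by \<open>A - L C\<close>. That a matrix is
Hurwitz is shown by carrying an eigenvector through such an identity: its image is either an
eigenvector of a smaller matrix known to be Hurwitz, or it vanishes and a simpler eigenvector
equation is left.

For stabilisability it therefore suffices to stabilise the plant with its internal model,
\<open>x' = A x + B u\<close>, \<open>z' = G1 z + G2 C x\<close>. After a first feedback that makes the plant Hurwitz, a Sylvester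
equation decouples a combination \<open>z + T x\<close> driven by the pair \<open>(G1, T B)\<close>. The rank condition at the
eigenvalues of \<open>S\<close> and the controllability of the internal model make this pair controllable
(\<open>augmented_pbh\<close>), and a Gramian built from powers of a Cayley transform gives a stabilising feedback
(\<open>stabilizing_feedback\<close>). Gains \<open>K1, K2\<close> for \<open>(x, z)\<close> turn into \<open>[K1 M, K2]\<close> for \<open>(\<zeta>, z)\<close>
(\<open>rho_stabilizing_gain\<close>).

For regulation, the observer error and the hypothesis on \<open>K\<close> make the closed loop Hurwitz
(\<open>closed_loop_hurwitz\<close>), so its solutions decay exponentially (\<open>hurwitz_decay\<close>). As \<open>S\<close> has no stable
eigenvalues, a second Sylvester equation provides an invariant graph over the exosystem which attracts
every trajectory. On this graph the regulated output is \<open>Gam v\<close> for a constant matrix \<open>Gam\<close>, and the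
internal model forces \<open>Gam = 0\<close>, because one and the same polynomial annihilates \<open>S\<close> and every copy of
\<open>\<beta>\<close> (\<open>internal_model_regulates\<close>).
\<close>

section \<open>Rank, invertibility and triangular form\<close>

lemma eigenvalue_iff:
  assumes "X \<in> carrier_mat n n"
  shows "eigenvalue X \<mu> \<longleftrightarrow> (\<exists>v \<in> carrier_vec n. v \<noteq> 0\<^sub>v n \<and> X *\<^sub>v v = \<mu> \<cdot>\<^sub>v v)"
  using assms unfolding eigenvalue_def eigenvector_def by auto

lemma eigenvalue_transpose:
  fixes X :: "'a::field mat"
  assumes "X \<in> carrier_mat n n"
  shows "eigenvalue X\<^sup>T \<mu> \<longleftrightarrow> eigenvalue X \<mu>"
  using assms eigenvalue_root_char_poly[of X n] eigenvalue_root_char_poly[of "X\<^sup>T" n]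
  by auto

text \<open>With full row rank some columns form a basis of the whole space; a vector orthogonal to all
columns is then orthogonal to every unit vector.\<close>

lemma full_row_rank_left_kernel:
  fixes X :: "'a::field mat"
  assumes X: "X \<in> carrier_mat r c" and rank: "mat_rank X = r"
    and y: "y \<in> carrier_vec r" and null: "X\<^sup>T *\<^sub>v y = 0\<^sub>v c"
  shows "y = 0\<^sub>v r"
proof -
  interpret vec_space "TYPE('a)" r .
  let ?P = "\<lambda>T. T \<subseteq> set (cols X) \<and> lin_indpt T"
  obtain S where S: "maximal S ?P"
    using maximal_exists_superset[of "set (cols X)" ?P "{}"] by (auto simp: lindep_span)
  have sub: "S \<subseteq> set (cols X)" and indep: "lin_indpt S" using S unfolding maximal_def by auto
  have cols: "set (cols X) \<subseteq> carrier_vec r"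
    using X cols_dim[of X] by auto
  have card: "card S = r"
    using rank X rank_card_indpt[OF X S] unfolding mat_rank_def by auto
  have "basis S"
    using sub cols card indep finite_subset[OF sub] by (intro dim_li_is_basis) (auto simp: dim_is_n)
  then have span: "span S = carrier_vec r" unfolding basis_def by simp
  have "y \<in> orthogonal_complement S"
    unfolding orthogonal_complement_def
  proof (intro CollectI conjI ballI)
    fix c' assume "c' \<in> S"
    then obtain j where j: "j < c" "c' = col X j"
      using sub X by (auto simp: cols_def)
    have "(X\<^sup>T *\<^sub>v y) $ j = 0" using null j by simp
    then show "y \<bullet> c' = 0"
      using j X y by (simp add: comm_scalar_prod[of y r])
  qed (rule y)
  then have "y \<in> orthogonal_complement (carrier_vec r)"
    using in_orthogonal_complement_span[of S] sub cols span by auto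
  then have "y \<bullet> unit_vec r i = 0" if "i < r" for i
    unfolding orthogonal_complement_def by simp
  then show ?thesis using y by (intro eq_vecI) auto
qed

lemma shift_mult_vec:
  fixes U :: "'a::comm_ring_1 mat"
  assumes "U \<in> carrier_mat r r" "v \<in> carrier_vec r"
  shows "(U + c \<cdot>\<^sub>m 1\<^sub>m r) *\<^sub>v v = U *\<^sub>v v + c \<cdot>\<^sub>v v"
    and "(U - c \<cdot>\<^sub>m 1\<^sub>m r) *\<^sub>v v = U *\<^sub>v v - c \<cdot>\<^sub>v v"
    and "(c \<cdot>\<^sub>m 1\<^sub>m r - U) *\<^sub>v v = c \<cdot>\<^sub>v v - U *\<^sub>v v"
proof -
  have "((c \<cdot>\<^sub>m 1\<^sub>m r) *\<^sub>v v) $ i = c * v $ i" if "i < r" for i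
  proof -
    have "row (c \<cdot>\<^sub>m 1\<^sub>m r) i = c \<cdot>\<^sub>v unit_vec r i" using that by auto
    then show ?thesis using assms that by simp
  qed
  then have "(c \<cdot>\<^sub>m 1\<^sub>m r) *\<^sub>v v = c \<cdot>\<^sub>v v" using assms by (intro eq_vecI) auto
  then show "(U + c \<cdot>\<^sub>m 1\<^sub>m r) *\<^sub>v v = U *\<^sub>v v + c \<cdot>\<^sub>v v"
    and "(U - c \<cdot>\<^sub>m 1\<^sub>m r) *\<^sub>v v = U *\<^sub>v v - c \<cdot>\<^sub>v v"
    and "(c \<cdot>\<^sub>m 1\<^sub>m r - U) *\<^sub>v v = c \<cdot>\<^sub>v v - U *\<^sub>v v"
    using assms by (simp_all add: add_mult_distrib_mat_vec[of _ r r] minus_mult_distrib_mat_vec[of _ r r])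
qed

lemma inverse_of_trivial_kernel:
  fixes X :: "'a::field mat"
  assumes X: "X \<in> carrier_mat n n"
    and ker: "\<And>v. v \<in> carrier_vec n \<Longrightarrow> X *\<^sub>v v = 0\<^sub>v n \<Longrightarrow> v = 0\<^sub>v n"
  obtains Y where "Y \<in> carrier_mat n n" "X * Y = 1\<^sub>m n" "Y * X = 1\<^sub>m n"
proof -
  have "det X \<noteq> 0" using det_0_iff_vec_prod_zero_field[OF X] ker by blast
  from det_non_zero_imp_unit[OF X this, of "()"]
  show ?thesis using that unfolding Units_def ring_mat_def by auto
qed

text \<open>Triangular coordinates are what lets the later arguments proceed one coordinate at a time:
Sylvester equations are solved column by column, an unobservable vector is reduced to an eigenvector,
and linear differential equations are integrated from the last component upwards.\<close>

lemma triangularization: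
  fixes X :: "complex mat"
  assumes X: "X \<in> carrier_mat n n"
  obtains J P Q where "J \<in> carrier_mat n n" "P \<in> carrier_mat n n" "Q \<in> carrier_mat n n"
    "P * Q = 1\<^sub>m n" "Q * P = 1\<^sub>m n" "X = P * J * Q" "upper_triangular J"
    "\<And>i. i < n \<Longrightarrow> eigenvalue X (J $$ (i, i))"
proof -
  obtain es where es: "char_poly X = (\<Prod>e\<leftarrow>es. [:- e, 1:])"
    using char_poly_factorized[OF X] by auto
  obtain J P Q where JPQ: "schur_decomposition X es = (J, P, Q)" by (cases "schur_decomposition X es")
  from schur_decomposition[OF X es JPQ]
  have sim: "similar_mat_wit X J P Q" and up: "upper_triangular J" and diag: "diag_mat J = es" by auto
  note w = similar_mat_witD2[OF X sim]
  have "eigenvalue X (J $$ (i, i))" if "i < n" for i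
  proof -
    have "J $$ (i, i) \<in> set es" using that w(5) diag unfolding diag_mat_def by force
    then have "poly (char_poly X) (J $$ (i, i)) = 0"
      unfolding es by (induction es) auto
    then show ?thesis using eigenvalue_root_char_poly[OF X] by simp
  qed
  with w up show ?thesis using that by blast
qed

section \<open>Sylvester equations\<close>

text \<open>For triangular \<open>V\<close> with diagonal entries \<open>J\<^sub>k\<^sub>k\<close>, column \<open>k\<close> of the equation reads
\<open>(J\<^sub>k\<^sub>k - U) t\<^sub>k = b\<close>, where \<open>b\<close> involves only earlier columns. The matrix on the left is
invertible because \<open>J\<^sub>k\<^sub>k\<close> is an eigenvalue of \<open>V\<close> and hence not one of \<open>U\<close>.\<close>

lemma sylvester_complex:
  fixes U V R :: "complex mat"
  assumes U: "U \<in> carrier_mat r r" and V: "V \<in> carrier_mat s s" and R: "R \<in> carrier_mat r s"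
    and disj: "\<And>\<mu>. eigenvalue U \<mu> \<Longrightarrow> eigenvalue V \<mu> \<Longrightarrow> False"
  obtains T where "T \<in> carrier_mat r s" "T * V - U * T = R"
proof -
  obtain J P Q where JPQ: "J \<in> carrier_mat s s" "P \<in> carrier_mat s s" "Q \<in> carrier_mat s s"
    "P * Q = 1\<^sub>m s" "Q * P = 1\<^sub>m s" "V = P * J * Q" "upper_triangular J"
    "\<And>i. i < s \<Longrightarrow> eigenvalue V (J $$ (i, i))"
    using triangularization[OF V] by blast
  define R' where "R' = R * P"
  have R': "R' \<in> carrier_mat r s" using R JPQ unfolding R'_def by auto
  have "\<exists>t :: nat \<Rightarrow> nat \<Rightarrow> complex. \<forall>j<k. \<forall>i<r.
      (\<Sum>l\<le>j. t i l * J $$ (l, j)) - (\<Sum>l<r. U $$ (i, l) * t l j) = R' $$ (i, j)" if "k \<le> s" for k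
    using that
  proof (induction k)
    case (Suc k)
    then obtain t where t: "\<And>j i. j < k \<Longrightarrow> i < r \<Longrightarrow>
      (\<Sum>l\<le>j. t i l * J $$ (l, j)) - (\<Sum>l<r. U $$ (i, l) * t l j) = R' $$ (i, j)" by auto
    define Y where "Y = J $$ (k, k) \<cdot>\<^sub>m 1\<^sub>m r - U"
    have Y: "Y \<in> carrier_mat r r" using U unfolding Y_def by auto
    have "v = 0\<^sub>v r" if v: "v \<in> carrier_vec r" and "Y *\<^sub>v v = 0\<^sub>v r" for v
    proof (rule ccontr)
      assume "v \<noteq> 0\<^sub>v r"
      have "Y *\<^sub>v v = J $$ (k, k) \<cdot>\<^sub>v v - U *\<^sub>v v"
        using U v unfolding Y_def by (simp add: shift_mult_vec)
      then have "U *\<^sub>v v = J $$ (k, k) \<cdot>\<^sub>v v"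
        using that U v by (auto simp: vec_eq_iff)
      then have "eigenvalue U (J $$ (k, k))"
        using \<open>v \<noteq> 0\<^sub>v r\<close> v eigenvalue_iff[OF U] by blast
      then show False using disj JPQ(8)[of k] Suc.prems by auto
    qed
    then obtain Z where Z: "Z \<in> carrier_mat r r" "Y * Z = 1\<^sub>m r"
      using inverse_of_trivial_kernel[OF Y] by blast
    define b where "b = vec r (\<lambda>i. R' $$ (i, k) - (\<Sum>l<k. t i l * J $$ (l, k)))"
    define x where "x = Z *\<^sub>v b"
    have x: "x \<in> carrier_vec r" using Z unfolding x_def b_def by auto
    have "Y *\<^sub>v x = b"
      using Z Y unfolding x_def b_def by (simp add: assoc_mult_mat_vec[symmetric, of _ r r _ r])
    then have "J $$ (k, k) \<cdot>\<^sub>v x - U *\<^sub>v x = b"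
      using U x unfolding Y_def by (simp add: shift_mult_vec)
    then have xi: "J $$ (k, k) * x $ i - (\<Sum>l<r. U $$ (i, l) * x $ l) = b $ i" if "i < r" for i
      using U x that by (auto simp: scalar_prod_def atLeast0LessThan vec_eq_iff)
    define t' where "t' = (\<lambda>i l. if l = k then x $ i else t i l)"
    have "(\<Sum>l\<le>j. t' i l * J $$ (l, j)) - (\<Sum>l<r. U $$ (i, l) * t' l j) = R' $$ (i, j)"
      if "j < Suc k" "i < r" for i j
    proof (cases "j = k")
      case True
      have "(\<Sum>l\<le>k. t' i l * J $$ (l, k)) = x $ i * J $$ (k, k) + (\<Sum>l<k. t i l * J $$ (l, k))"
        unfolding t'_def by (simp add: lessThan_Suc_atMost[symmetric])
      then show ?thesis using xi[OF that(2)] that True unfolding b_def t'_def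
        by (simp add: algebra_simps)
    next
      case False
      then have "t' i l = t i l" if "l \<le> j" for i l using that \<open>j < Suc k\<close> unfolding t'_def by auto
      then show ?thesis using t[of j i] that False by simp
    qed
    then show ?case by blast
  qed auto
  from this[of s] obtain t where t: "\<And>j i. j < s \<Longrightarrow> i < r \<Longrightarrow>
      (\<Sum>l\<le>j. t i l * J $$ (l, j)) - (\<Sum>l<r. U $$ (i, l) * t l j) = R' $$ (i, j)" by auto
  define T' where "T' = mat r s (\<lambda>(i, j). t i j)"
  have T': "T' \<in> carrier_mat r s" unfolding T'_def by auto
  have eq: "T' * J - U * T' = R'"
  proof (rule eq_matI)
    fix i j assume "i < dim_row R'" "j < dim_col R'"
    then have ij: "i < r" "j < s" using R' by auto
    have "(T' * J) $$ (i, j) = (\<Sum>l<s. t i l * J $$ (l, j))"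
      using ij JPQ T' by (simp add: scalar_prod_def atLeast0LessThan) (simp add: T'_def)
    also have "\<dots> = (\<Sum>l\<le>j. t i l * J $$ (l, j))"
      using ij JPQ(1,7) by (intro sum.mono_neutral_right) (auto simp: upper_triangular_def)
    finally have "(T' * J) $$ (i, j) = (\<Sum>l\<le>j. t i l * J $$ (l, j))" .
    moreover have "(U * T') $$ (i, j) = (\<Sum>l<r. U $$ (i, l) * t l j)"
      using ij U T' by (simp add: scalar_prod_def atLeast0LessThan) (simp add: T'_def)
    ultimately show "(T' * J - U * T') $$ (i, j) = R' $$ (i, j)"
      using t ij U T' by simp
  qed (use U T' R' JPQ in auto)
  define T where "T = T' * Q"
  have T: "T \<in> carrier_mat r s" using T' JPQ unfolding T_def by auto
  have "T * V = T' * (Q * P) * J * Q"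
    unfolding T_def JPQ(6) using T' JPQ(1-3) by (simp add: assoc_mult_mat[of _ _ s _ s _ s])
  also have "\<dots> = T' * J * Q" using T' JPQ by simp
  finally have "T * V - U * T = (T' * J - U * T') * Q"
    unfolding T_def using T' JPQ(1-3) U
    by (simp add: minus_mult_distrib_mat[of _ r s _ _ s] assoc_mult_mat[of _ _ r _ s _ s])
  also have "\<dots> = R * (P * Q)" unfolding eq R'_def using R JPQ(1-3) by (simp add: assoc_mult_mat[of _ _ s _ s _ s])
  also have "\<dots> = R" using R JPQ(4) by simp
  finally show ?thesis using that T by blast
qed

text \<open>The data being real, the real part of a complex solution is a solution.\<close>

lemma sylvester_real:
  fixes U V R :: "real mat"
  assumes U: "U \<in> carrier_mat r r" and V: "V \<in> carrier_mat s s" and R: "R \<in> carrier_mat r s"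
    and disj: "\<And>\<mu>. eigenvalue (cmat U) \<mu> \<Longrightarrow> eigenvalue (cmat V) \<mu> \<Longrightarrow> False"
  obtains T where "T \<in> carrier_mat r s" "T * V - U * T = R"
proof -
  obtain T where T: "T \<in> carrier_mat r s" "T * cmat V - cmat U * T = cmat R"
    using sylvester_complex[of "cmat U" r "cmat V" s "cmat R"] U V R disj by auto
  have "map_mat Re T * V - U * map_mat Re T = R"
  proof (rule eq_matI)
    fix i j assume "i < dim_row R" "j < dim_col R"
    then have ij: "i < r" "j < s" using R by auto
    have "Re ((T * cmat V - cmat U * T) $$ (i, j)) = R $$ (i, j)"
      unfolding T(2) using R ij by simp
    then show "(map_mat Re T * V - U * map_mat Re T) $$ (i, j) = R $$ (i, j)"
      using ij T(1) U V by (simp add: scalar_prod_def)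
  qed (use U V R T in auto)
  then show ?thesis using that[of "map_mat Re T"] T by auto
qed

section \<open>Stabilisation of controllable pairs\<close>

text \<open>The passage from Kalman's criterion to the eigenvector criterion of Popov, Belevitch and Hautus.
In triangular coordinates \<open>U - J\<^sub>k\<^sub>k\<close> maps a vector supported on the first \<open>k + 1\<close> coordinates to one
supported on the first \<open>k\<close>, at the price of one of the conditions \<open>H U\<^sup>k w = 0\<close>. There are as many
conditions as coordinates, so the last nonzero vector of this process still lies in the kernel of
\<open>H\<close>; it is an eigenvector because the next step annihilates it.\<close>

lemma unobservable_eigenvector:
  fixes U H :: "complex mat"
  assumes U: "U \<in> carrier_mat d d" and H: "H \<in> carrier_mat m d"
    and w: "w \<in> carrier_vec d" "w \<noteq> 0\<^sub>v d"
    and ker: "\<And>k. k < d \<Longrightarrow> H *\<^sub>v (U ^\<^sub>m k *\<^sub>v w) = 0\<^sub>v m"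
  obtains v \<mu> where "v \<in> carrier_vec d" "v \<noteq> 0\<^sub>v d" "U *\<^sub>v v = \<mu> \<cdot>\<^sub>v v" "H *\<^sub>v v = 0\<^sub>v m"
proof -
  obtain J P Q where JPQ: "J \<in> carrier_mat d d" "P \<in> carrier_mat d d" "Q \<in> carrier_mat d d"
    "P * Q = 1\<^sub>m d" "Q * P = 1\<^sub>m d" "U = P * J * Q" "upper_triangular J"
    using triangularization[OF U] by metis
  have Upow: "U ^\<^sub>m k \<in> carrier_mat d d" for k using U by simp
  have QU: "Q *\<^sub>v (U *\<^sub>v v) = J *\<^sub>v (Q *\<^sub>v v)" if v: "v \<in> carrier_vec d" for v
  proof -
    have "Q * U = (Q * P) * J * Q"
      unfolding JPQ(6) using JPQ(1-3) by (simp add: assoc_mult_mat[of _ d d _ d _ d])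
    then have "Q * U = J * Q" using JPQ(1,3,5) by simp
    then have "(Q * U) *\<^sub>v v = (J * Q) *\<^sub>v v" by simp
    then show ?thesis
      using assoc_mult_mat_vec[OF JPQ(3) U v] assoc_mult_mat_vec[OF JPQ(1,3) v] by simp
  qed
  have "\<exists>v \<mu>. v \<in> carrier_vec d \<and> v \<noteq> 0\<^sub>v d \<and> U *\<^sub>v v = \<mu> \<cdot>\<^sub>v v \<and> H *\<^sub>v v = 0\<^sub>v m"
    if "k \<le> d" "v \<in> carrier_vec d" "v \<noteq> 0\<^sub>v d" "\<And>i. k \<le> i \<Longrightarrow> i < d \<Longrightarrow> (Q *\<^sub>v v) $ i = 0"
      "\<And>j. j < k \<Longrightarrow> H *\<^sub>v (U ^\<^sub>m j *\<^sub>v v) = 0\<^sub>v m" for k v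
    using that
  proof (induction k arbitrary: v)
    case 0
    then have "Q *\<^sub>v v = 0\<^sub>v d" using JPQ(3) by (intro eq_vecI) auto
    then have "P *\<^sub>v (Q *\<^sub>v v) = 0\<^sub>v d" using JPQ(2) by auto
    then have "v = 0\<^sub>v d"
      using assoc_mult_mat_vec[OF JPQ(2,3) 0(2)] JPQ(4) 0(2) by simp
    with 0 show ?case by simp
  next
    case (Suc k)
    define e where "e = J $$ (k, k)"
    define v' where "v' = U *\<^sub>v v - e \<cdot>\<^sub>v v"
    have v': "v' \<in> carrier_vec d" using U Suc.prems(2) unfolding v'_def by auto
    show ?case
    proof (cases "v' = 0\<^sub>v d")
      case True
      have "U *\<^sub>v v = e \<cdot>\<^sub>v v"
        using True U Suc.prems(2) unfolding v'_def by (auto simp: vec_eq_iff)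
      moreover have "H *\<^sub>v v = 0\<^sub>v m" using Suc.prems(5)[of 0] U Suc.prems(2) by simp
      ultimately show ?thesis using Suc.prems(2,3) by blast
    next
      case False
      define y where "y = Q *\<^sub>v v"
      have y: "y \<in> carrier_vec d" using JPQ(3) Suc.prems(2) unfolding y_def by auto
      have y0: "y $ i = 0" if "Suc k \<le> i" "i < d" for i
        using Suc.prems(4) that unfolding y_def by blast
      have Qv': "Q *\<^sub>v v' = J *\<^sub>v y - e \<cdot>\<^sub>v y"
        unfolding v'_def y_def using JPQ(3) U Suc.prems(2) QU[OF Suc.prems(2)]
        by (simp add: mult_minus_distrib_mat_vec[of _ d d] mult_mat_vec[of _ d d])
      have "(Q *\<^sub>v v') $ i = 0" if i: "k \<le> i" "i < d" for i
      proof -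
        have "(J *\<^sub>v y) $ i = (\<Sum>l\<in>{0..<d}. J $$ (i, l) * y $ l)"
          using i JPQ(1) y by (simp add: scalar_prod_def)
        also have "\<dots> = (\<Sum>l\<in>{0..<d}. if l = k then J $$ (i, k) * y $ k else 0)"
        proof (rule sum.cong)
          fix l assume l: "l \<in> {0..<d}"
          show "J $$ (i, l) * y $ l = (if l = k then J $$ (i, k) * y $ k else 0)"
            using y0[of l] JPQ(1,7) i l unfolding upper_triangular_def
            by (cases "l < k"; cases "l = k") auto
        qed simp
        also have "\<dots> = J $$ (i, k) * y $ k" using i by (simp add: sum.delta)
        finally have Ji: "(J *\<^sub>v y) $ i = J $$ (i, k) * y $ k" .
        show ?thesis
        proof (cases "i = k")
          case True
          then show ?thesis unfolding Qv' using Ji i y JPQ(1) by (simp add: e_def)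
        next
          case False
          then have "J $$ (i, k) = 0" using i JPQ(1,7) unfolding upper_triangular_def by auto
          then show ?thesis unfolding Qv' using Ji i y JPQ(1) y0[of i] False by simp
        qed
      qed
      moreover have "H *\<^sub>v (U ^\<^sub>m j *\<^sub>v v') = 0\<^sub>v m" if "j < k" for j
      proof -
        have "U ^\<^sub>m j *\<^sub>v v' = U ^\<^sub>m Suc j *\<^sub>v v - e \<cdot>\<^sub>v (U ^\<^sub>m j *\<^sub>v v)"
          unfolding v'_def using Upow U Suc.prems(2)
          by (simp add: mult_minus_distrib_mat_vec[of _ d d] mult_mat_vec[of _ d d]
              assoc_mult_mat_vec[of _ d d _ d])
        then have "H *\<^sub>v (U ^\<^sub>m j *\<^sub>v v') = H *\<^sub>v (U ^\<^sub>m Suc j *\<^sub>v v) - e \<cdot>\<^sub>v (H *\<^sub>v (U ^\<^sub>m j *\<^sub>v v))"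
          using Upow[of j] Upow[of "Suc j"] H Suc.prems(2)
          by (simp add: mult_minus_distrib_mat_vec[of _ m d] mult_mat_vec[of _ m d] del: pow_mat.simps)
        then show ?thesis using that Suc.prems(5)[of j] Suc.prems(5)[of "Suc j"] by auto
      qed
      ultimately show ?thesis using Suc.IH[OF _ v' False] Suc.prems(1) by auto
    qed
  qed
  from this[of d w] show ?thesis using that w ker by auto
qed

lemma cmat_add: "X \<in> carrier_mat r c \<Longrightarrow> Y \<in> carrier_mat r c \<Longrightarrow> cmat (X + Y) = cmat X + cmat Y"
  by (auto intro!: eq_matI)

lemma cmat_mult_vec:
  assumes "X \<in> carrier_mat r k" "Y \<in> carrier_mat k c" "v \<in> carrier_vec c"
  shows "cmat (X * Y) *\<^sub>v v = cmat X *\<^sub>v (cmat Y *\<^sub>v v)"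
  using assms by (simp add: of_real_hom.mat_hom_mult[of _ r k _ c] assoc_mult_mat_vec[of _ r k _ c])

lemma cmat_add_vec:
  assumes "X \<in> carrier_mat r c" "Y \<in> carrier_mat r c" "v \<in> carrier_vec c"
  shows "cmat (X + Y) *\<^sub>v v = cmat X *\<^sub>v v + cmat Y *\<^sub>v v"
  using assms by (simp add: cmat_add[of _ r c] add_mult_distrib_mat_vec[of _ r c])

lemma cmat_transpose_mult:
  assumes "X \<in> carrier_mat r k" "Y \<in> carrier_mat k c"
  shows "cmat (X * Y)\<^sup>T = cmat Y\<^sup>T * cmat X\<^sup>T"
  unfolding transpose_mult[OF assms]
  using assms by (intro of_real_hom.mat_hom_mult) auto

lemma cscalar_adjoint:
  assumes "X \<in> carrier_mat r c" "x \<in> carrier_vec c" "y \<in> carrier_vec r"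
  shows "(cmat X *\<^sub>v x) \<bullet>c y = x \<bullet>c (cmat X\<^sup>T *\<^sub>v y)"
proof -
  have "conjugate (cmat X\<^sup>T *\<^sub>v y) = (cmat X)\<^sup>T *\<^sub>v conjugate y"
    using assms by (intro eq_vecI) (auto simp: scalar_prod_def conjugate_vec_def)
  moreover have "((cmat X)\<^sup>T *\<^sub>v conjugate y) \<bullet> x = conjugate y \<bullet> (cmat X *\<^sub>v x)"
    using assms by (intro transpose_vec_mult_scalar) auto
  ultimately show ?thesis
    using assms comm_scalar_prod[of x c "(cmat X)\<^sup>T *\<^sub>v conjugate y"]
      comm_scalar_prod[of "cmat X *\<^sub>v x" r "conjugate y"] by auto
qed

lemma hurwitzI:
  assumes "X \<in> carrier_mat n n"
    and "\<And>v \<mu>. v \<in> carrier_vec n \<Longrightarrow> v \<noteq> 0\<^sub>v n \<Longrightarrow> cmat X *\<^sub>v v = \<mu> \<cdot>\<^sub>v v \<Longrightarrow> Re \<mu> < 0"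
  shows "hurwitz X"
  using assms eigenvalue_iff[of "cmat X" n] unfolding hurwitz_def by auto

lemma hurwitzD:
  assumes "hurwitz X" "X \<in> carrier_mat n n"
    "v \<in> carrier_vec n" "v \<noteq> 0\<^sub>v n" "cmat X *\<^sub>v v = \<mu> \<cdot>\<^sub>v v"
  shows "Re \<mu> < 0"
  using assms eigenvalue_iff[of "cmat X" n] unfolding hurwitz_def by auto

lemma hurwitzI_left:
  assumes X: "X \<in> carrier_mat n n"
    and "\<And>v \<mu>. v \<in> carrier_vec n \<Longrightarrow> v \<noteq> 0\<^sub>v n \<Longrightarrow> cmat X\<^sup>T *\<^sub>v v = \<mu> \<cdot>\<^sub>v v \<Longrightarrow> Re \<mu> < 0"
  shows "hurwitz X"
proof -
  have "(cmat X)\<^sup>T = cmat X\<^sup>T" by auto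
  then have "eigenvalue (cmat X) \<mu> \<longleftrightarrow> (\<exists>v \<in> carrier_vec n. v \<noteq> 0\<^sub>v n \<and> cmat X\<^sup>T *\<^sub>v v = \<mu> \<cdot>\<^sub>v v)" for \<mu>
    using X eigenvalue_iff[of "cmat X\<^sup>T" n \<mu>] eigenvalue_transpose[of "cmat X" n \<mu>] by simp
  then show ?thesis using assms(2) unfolding hurwitz_def by blast
qed

abbreviation csq_norm :: "complex vec \<Rightarrow> real" where "csq_norm v \<equiv> Re (v \<bullet>c v)"

lemma csq_norm_sum: "csq_norm v = (\<Sum>i<dim_vec v. (cmod (v $ i))\<^sup>2)"
  by (auto simp: scalar_prod_def conjugate_vec_def complex_norm_square[symmetric] atLeast0LessThan
      simp flip: of_real_power)

lemma csq_norm_Im: "Im (v \<bullet>c v) = 0"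
  by (simp add: scalar_prod_def conjugate_vec_def)

text \<open>This identity makes the sum over the Gramian in the stabilisation argument telescope.\<close>

lemma csq_norm_polarization:
  assumes p: "p \<in> carrier_vec m" and q: "q \<in> carrier_vec m"
  shows "4 * a * Re (q \<bullet>c p) = csq_norm (p + of_real a \<cdot>\<^sub>v q) - csq_norm (p - of_real a \<cdot>\<^sub>v q)"
proof -
  have id: "4 * a * Re (y * cnj x) = (cmod (x + a * y))\<^sup>2 - (cmod (x - a * y))\<^sup>2" for x y :: complex
    unfolding cmod_power2 by (simp add: power2_eq_square algebra_simps)
  have "4 * a * Re (q \<bullet>c p) = (\<Sum>i<m. 4 * a * Re (q $ i * cnj (p $ i)))"
    using p q by (simp add: scalar_prod_def atLeast0LessThan sum_distrib_left distrib_left sum.distrib)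
  also have "\<dots> = csq_norm (p + of_real a \<cdot>\<^sub>v q) - csq_norm (p - of_real a \<cdot>\<^sub>v q)"
    unfolding id csq_norm_sum sum_subtractf[symmetric] using p q by (simp add: sum_subtractf)
  finally show ?thesis .
qed

lemma csq_norm_nonneg: "0 \<le> csq_norm v"
  unfolding csq_norm_sum by (intro sum_nonneg) auto

lemma csq_norm_eq_0: "csq_norm v = 0 \<Longrightarrow> v = 0\<^sub>v (dim_vec v)"
  unfolding csq_norm_sum by (subst (asm) sum_nonneg_eq_0_iff) (auto intro!: eq_vecI)

text \<open>For \<open>K = - H\<^sup>T W\<^sup>-\<^sup>1 / (2 a)\<close> a left eigenvector \<open>w\<close> of \<open>G + H K\<close> with eigenvalue \<open>\<mu>\<close> satisfies
\<open>4 a Re \<mu> \<langle>W w, w\<rangle> = - (\<parallel>H\<^sup>T w\<parallel>\<^sup>2 + r w)\<close>. The right-hand side is negative unless \<open>H\<^sup>T w = 0\<close>, but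
then \<open>w\<close> is a left eigenvector of \<open>G\<close> itself that the input does not see.\<close>

lemma gramian_feedback:
  fixes G H W :: "real mat" and r :: "complex vec \<Rightarrow> real"
  assumes G: "G \<in> carrier_mat d d" and H: "H \<in> carrier_mat d m" and W: "W \<in> carrier_mat d d"
    and a: "0 < a"
    and pos: "\<And>w. w \<in> carrier_vec d \<Longrightarrow> w \<noteq> 0\<^sub>v d \<Longrightarrow> 0 < Re ((cmat W *\<^sub>v w) \<bullet>c w)"
    and real: "\<And>w. w \<in> carrier_vec d \<Longrightarrow> Im ((cmat W *\<^sub>v w) \<bullet>c w) = 0"
    and lyap: "\<And>w. w \<in> carrier_vec d \<Longrightarrow>
      4 * a * Re ((cmat W *\<^sub>v w) \<bullet>c (cmat G\<^sup>T *\<^sub>v w)) = csq_norm (cmat H\<^sup>T *\<^sub>v w) - r w"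
    and r: "\<And>w. 0 \<le> r w"
    and pbh: "\<And>w \<mu>. w \<in> carrier_vec d \<Longrightarrow> cmat G\<^sup>T *\<^sub>v w = \<mu> \<cdot>\<^sub>v w \<Longrightarrow> cmat H\<^sup>T *\<^sub>v w = 0\<^sub>v m
      \<Longrightarrow> w = 0\<^sub>v d"
  obtains K where "K \<in> carrier_mat m d" "hurwitz (G + H * K)"
proof -
  have "x = 0\<^sub>v d" if x: "x \<in> carrier_vec d" and "W *\<^sub>v x = 0\<^sub>v d" for x
  proof (rule ccontr)
    assume "x \<noteq> 0\<^sub>v d"
    let ?x = "map_vec complex_of_real x"
    have "cmat (W) *\<^sub>v ?x = map_vec of_real (W *\<^sub>v x)"
      using W x by (intro of_real_hom.mult_mat_vec_hom[symmetric]) auto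
    then have "cmat (W) *\<^sub>v ?x = 0\<^sub>v d" using that by (simp add: of_real_hom.vec_hom_zero)
    moreover have "?x \<noteq> 0\<^sub>v d" using \<open>x \<noteq> 0\<^sub>v d\<close> by simp
    ultimately show False using pos[of ?x] x by auto
  qed
  then obtain Y where Y: "Y \<in> carrier_mat d d" "Y * W = 1\<^sub>m d"
    using inverse_of_trivial_kernel[OF W] by blast
  define \<kappa> where "\<kappa> = - (1 / (2 * a))"
  define K where "K = \<kappa> \<cdot>\<^sub>m (H\<^sup>T * Y)"
  have K: "K \<in> carrier_mat m d" using H Y unfolding K_def by auto
  have KW: "cmat K *\<^sub>v (cmat (W) *\<^sub>v w) = of_real \<kappa> \<cdot>\<^sub>v (cmat H\<^sup>T *\<^sub>v w)"
    if w: "w \<in> carrier_vec d" for w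
  proof -
    have HT: "H\<^sup>T \<in> carrier_mat m d" using H by simp
    have "K * W = \<kappa> \<cdot>\<^sub>m (H\<^sup>T * Y * W)"
      unfolding K_def by (rule mult_smult_assoc_mat[OF mult_carrier_mat[OF HT Y(1)] W])
    also have "H\<^sup>T * Y * W = H\<^sup>T"
      using assoc_mult_mat[OF HT Y(1) W] Y(2) right_mult_one_mat[OF HT] by simp
    finally have KW: "K * W = \<kappa> \<cdot>\<^sub>m H\<^sup>T" .
    have "cmat K *\<^sub>v (cmat (W) *\<^sub>v w) = cmat (K * W) *\<^sub>v w"
      by (rule cmat_mult_vec[OF K W w, symmetric])
    also have "cmat (K * W) = of_real \<kappa> \<cdot>\<^sub>m cmat H\<^sup>T" unfolding KW by (auto intro!: eq_matI)
    finally show ?thesis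
      using H w by (auto intro!: eq_vecI simp: scalar_prod_def sum_distrib_left ac_simps)
  qed
  have "hurwitz (G + H * K)"
  proof (rule hurwitzI_left)
    show "G + H * K \<in> carrier_mat d d" using G H K by auto
    fix w \<mu> assume w: "w \<in> carrier_vec d" "w \<noteq> 0\<^sub>v d" and ev: "cmat (G + H * K)\<^sup>T *\<^sub>v w = \<mu> \<cdot>\<^sub>v w"
    let ?Hw = "cmat H\<^sup>T *\<^sub>v w" and ?Gw = "cmat G\<^sup>T *\<^sub>v w" and ?Ww = "cmat (W) *\<^sub>v w"
    have vecs: "?Hw \<in> carrier_vec m" "?Gw \<in> carrier_vec d" "?Ww \<in> carrier_vec d"
      using H G W w by auto
    have "(G + H * K)\<^sup>T = G\<^sup>T + K\<^sup>T * H\<^sup>T"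
      unfolding transpose_mult[OF H K, symmetric] by (rule transpose_add[OF G mult_carrier_mat[OF H K]])
    then have "?Gw + cmat K\<^sup>T *\<^sub>v ?Hw = \<mu> \<cdot>\<^sub>v w"
      using ev G H K w(1)
      by (simp only: cmat_add_vec[of _ d d] cmat_mult_vec[of _ d m _ d] mult_carrier_mat transpose_carrier_mat)
    then have Gw: "?Gw = \<mu> \<cdot>\<^sub>v w - cmat K\<^sup>T *\<^sub>v ?Hw"
      using vecs K w G by (auto simp: vec_eq_iff algebra_simps)
    have "?Ww \<bullet>c ?Gw = cnj \<mu> * (?Ww \<bullet>c w) - (cmat K *\<^sub>v ?Ww) \<bullet>c ?Hw"
    proof -
      have "conjugate ?Gw = cnj \<mu> \<cdot>\<^sub>v conjugate w - conjugate (cmat K\<^sup>T *\<^sub>v ?Hw)"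
        unfolding Gw using K w(1) vecs(1) by (intro eq_vecI) auto
      then have "?Ww \<bullet>c ?Gw = cnj \<mu> * (?Ww \<bullet>c w) - ?Ww \<bullet>c (cmat K\<^sup>T *\<^sub>v ?Hw)"
        using vecs K w(1) by (simp add: scalar_prod_minus_distrib[of _ d])
      then show ?thesis using cscalar_adjoint[OF K vecs(3,1)] by simp
    qed
    then have lhs: "Re (?Ww \<bullet>c ?Gw) = Re (cnj \<mu> * (?Ww \<bullet>c w)) + csq_norm ?Hw / (2 * a)"
      unfolding KW[OF w(1)] \<kappa>_def using vecs by simp
    have key: "Re \<mu> * Re (?Ww \<bullet>c w) = - (csq_norm ?Hw + r w) / (4 * a)"
      using lhs lyap[OF w(1)] real[OF w(1)] a by (simp add: field_simps)
    have "?Hw \<noteq> 0\<^sub>v m"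
    proof
      assume "?Hw = 0\<^sub>v m"
      moreover from this have "?Gw = \<mu> \<cdot>\<^sub>v w" using Gw K w by auto
      ultimately show False using pbh w by blast
    qed
    then have "0 < csq_norm ?Hw"
      using csq_norm_eq_0[of ?Hw] csq_norm_nonneg[of ?Hw] vecs by (metis carrier_vecD order_le_less)
    then have "Re \<mu> * Re (?Ww \<bullet>c w) < 0"
      unfolding key using r[of w] a by (simp add: divide_neg_pos)
    then show "Re \<mu> < 0" using pos[OF w] by (simp add: mult_less_0_iff)
  qed
  then show ?thesis using that K by blast
qed

text \<open>A discrete counterpart of stabilisation by a finite-horizon Gramian, with the Cayley transform
\<open>\<Psi> = (G + a)\<^sup>-\<^sup>1 (G - a)\<close> in place of a matrix exponential. Put \<open>H\<^sub>k = \<Psi>\<^sup>k (G + a)\<^sup>-\<^sup>1 H\<close>,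
\<open>R\<^sub>k = (G + a) H\<^sub>k\<close> and \<open>W = \<Sum>\<^sub>k H\<^sub>k H\<^sub>k\<^sup>T\<close>, the sum extending over \<open>k < d\<close>. Since \<open>(G - a) H\<^sub>k = R\<^sub>k\<^sub>+\<^sub>1\<close>,
polarisation gives \<open>4 a Re \<langle>W w, G\<^sup>T w\<rangle> = \<parallel>R\<^sub>0\<^sup>T w\<parallel>\<^sup>2 - \<parallel>R\<^sub>d\<^sup>T w\<parallel>\<^sup>2\<close> with \<open>R\<^sub>0 = H\<close>, which is the Lyapunov
identity required above. A null vector of \<open>W\<close> would be unobservable for \<open>(\<Psi>\<^sup>T, H\<^sub>0\<^sup>T)\<close>; the resulting
eigenvector of \<open>\<Psi>\<^sup>T\<close> yields a left eigenvector of \<open>G\<close> annihilated by \<open>H\<^sup>T\<close>, so \<open>W\<close> is positive definite.\<close>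

lemma stabilizing_feedback:
  fixes G H :: "real mat"
  assumes G: "G \<in> carrier_mat d d" and H: "H \<in> carrier_mat d m"
    and pbh: "\<And>w \<mu>. w \<in> carrier_vec d \<Longrightarrow> cmat G\<^sup>T *\<^sub>v w = \<mu> \<cdot>\<^sub>v w \<Longrightarrow> cmat H\<^sup>T *\<^sub>v w = 0\<^sub>v m
      \<Longrightarrow> w = 0\<^sub>v d"
  obtains K where "K \<in> carrier_mat m d" "hurwitz (G + H * K)"
proof -
  have "finite {a. poly (char_poly G) a = 0}"
    using degree_monic_char_poly[OF G] by (intro poly_roots_finite) auto
  then have "finite (uminus ` {a. poly (char_poly G) a = 0})" by simp
  then obtain a where a: "a > 0" "a \<notin> uminus ` {a. poly (char_poly G) a = 0}"
    using infinite_Ioi[of 0] by (metis finite_subset greaterThan_iff subsetI)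
  have "a = - (- a)" by simp
  with a(2) have "poly (char_poly G) (- a) \<noteq> 0" by blast
  then have no_ev: "\<not> eigenvalue G (- a)" using eigenvalue_root_char_poly[OF G] by simp
  \<comment> \<open>\<open>- a\<close> lies outside the spectrum of \<open>G\<close>, so \<open>Gp\<close> is invertible.\<close>
  define Gp where "Gp = G + a \<cdot>\<^sub>m 1\<^sub>m d"
  define Gm where "Gm = G - a \<cdot>\<^sub>m 1\<^sub>m d"
  have Gp: "Gp \<in> carrier_mat d d" and Gm: "Gm \<in> carrier_mat d d"
    using G unfolding Gp_def Gm_def by auto
  have "v = 0\<^sub>v d" if v: "v \<in> carrier_vec d" and "Gp *\<^sub>v v = 0\<^sub>v d" for v
  proof -
    have "G *\<^sub>v v + a \<cdot>\<^sub>v v = 0\<^sub>v d" using that G unfolding Gp_def by (simp add: shift_mult_vec)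
    then have "G *\<^sub>v v = - a \<cdot>\<^sub>v v" using G v by (auto simp: vec_eq_iff eq_neg_iff_add_eq_0)
    then show ?thesis using no_ev v eigenvalue_iff[OF G] by auto
  qed
  then obtain V where V: "V \<in> carrier_mat d d" "Gp * V = 1\<^sub>m d" "V * Gp = 1\<^sub>m d"
    using inverse_of_trivial_kernel[OF Gp] by blast
  define R where "R = rec_nat H (\<lambda>_ X. Gm * (V * X))"
  define Hs where "Hs k = V * R k" for k
  have R0: "R 0 = H" and RS: "R (Suc k) = Gm * Hs k" for k
    unfolding R_def Hs_def by simp_all
  have R: "R k \<in> carrier_mat d m" for k
    by (induction k) (use R0 RS H V Gm in \<open>auto simp: Hs_def\<close>)
  have Hs: "Hs k \<in> carrier_mat d m" for k using R V unfolding Hs_def by auto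
  have RH: "R k = Gp * Hs k" for k
    unfolding Hs_def using assoc_mult_mat[OF Gp V(1) R[of k]] V(2) left_mult_one_mat[OF R[of k]] by simp
  define W where "W = rec_nat (0\<^sub>m d d) (\<lambda>k X. X + Hs k * (Hs k)\<^sup>T)"
  have W0: "W 0 = 0\<^sub>m d d" and WS: "W (Suc k) = W k + Hs k * (Hs k)\<^sup>T" for k
    unfolding W_def by simp_all
  have W: "W k \<in> carrier_mat d d" for k
  proof (induction k)
    case (Suc k)
    have "Hs k * (Hs k)\<^sup>T \<in> carrier_mat d d" using Hs[of k] by (intro mult_carrier_mat[of _ d m]) auto
    then show ?case using Suc WS by simp
  qed (simp add: W0)
  let ?h = "\<lambda>k x. cmat (Hs k)\<^sup>T *\<^sub>v x"
  have form: "(cmat (W k) *\<^sub>v x) \<bullet>c y = (\<Sum>i<k. ?h i x \<bullet>c ?h i y)"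
    if x: "x \<in> carrier_vec d" and y: "y \<in> carrier_vec d" for x y k
  proof (induction k)
    case 0
    have "cmat (0\<^sub>m d d) *\<^sub>v x = 0\<^sub>v d" using x by (intro eq_vecI) (auto simp: scalar_prod_def)
    then show ?case unfolding W0 using y by simp
  next
    case (Suc k)
    have "cmat (W (Suc k)) *\<^sub>v x = cmat (W k) *\<^sub>v x + cmat (Hs k) *\<^sub>v ?h k x"
      unfolding WS using W[of k] Hs[of k] x
      by (simp only: cmat_add_vec[of _ d d] cmat_mult_vec[of _ d m _ d] mult_carrier_mat transpose_carrier_mat)
    then show ?case
      using Suc x y Hs[of k] cscalar_adjoint[OF Hs, of "?h k x" y k]
        add_scalar_prod_distrib[of "cmat (W k) *\<^sub>v x" d "cmat (Hs k) *\<^sub>v ?h k x" "conjugate y"] W[of k]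
      by (simp add: mult_mat_vec_carrier[of _ d m])
  qed
  have pos: "0 < Re ((cmat (W d) *\<^sub>v w) \<bullet>c w)"
    if w: "w \<in> carrier_vec d" "w \<noteq> 0\<^sub>v d" for w
  proof (rule ccontr)
    assume neg: "\<not> ?thesis"
    have "(\<Sum>i<d. csq_norm (?h i w)) = 0"
      using neg form[OF w(1) w(1), of d] csq_norm_nonneg
      by (intro antisym sum_nonneg) auto
    then have "csq_norm (?h i w) = 0" if "i < d" for i
      using that csq_norm_nonneg by (subst (asm) sum_nonneg_eq_0_iff) auto
    then have h0: "?h i w = 0\<^sub>v m" if "i < d" for i
      using csq_norm_eq_0[of "?h i w"] that Hs[of i] by auto
    let ?U = "cmat (V * Gm)\<^sup>T" and ?N = "cmat (Hs 0)\<^sup>T"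
    have U: "?U \<in> carrier_mat d d" and N: "?N \<in> carrier_mat m d" using V Gm Hs by auto
    have pow: "cmat (Hs k)\<^sup>T = ?N * ?U ^\<^sub>m k" for k
    proof (induction k)
      case 0
      then show ?case using U Gm right_mult_one_mat[OF N] by simp
    next
      case (Suc k)
      have "Hs (Suc k) = (V * Gm) * Hs k"
        unfolding Hs_def[of "Suc k"] RS using V Gm Hs by (simp add: assoc_mult_mat[of _ d d _ d _ m])
      then have "cmat (Hs (Suc k))\<^sup>T = cmat (Hs k)\<^sup>T * ?U"
        using cmat_transpose_mult[OF mult_carrier_mat[OF V(1) Gm] Hs] by simp
      then show ?case using Suc U N by (simp add: assoc_mult_mat[of _ m d _ d _ d])
    qed
    obtain v \<mu> where v: "v \<in> carrier_vec d" "v \<noteq> 0\<^sub>v d" "?U *\<^sub>v v = \<mu> \<cdot>\<^sub>v v" "?N *\<^sub>v v = 0\<^sub>v m"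
    proof (rule unobservable_eigenvector[OF U N w])
      fix k assume "k < d"
      then show "?N *\<^sub>v (?U ^\<^sub>m k *\<^sub>v w) = 0\<^sub>v m"
        using h0[of k] pow[of k] U N w by (simp add: assoc_mult_mat_vec[of _ m d _ d])
    qed
    define u where "u = cmat V\<^sup>T *\<^sub>v v"
    have u: "u \<in> carrier_vec d" using V v unfolding u_def by auto
    have GpV: "cmat Gp\<^sup>T * cmat V\<^sup>T = 1\<^sub>m d"
      using cmat_transpose_mult[OF V(1) Gp] unfolding V(3) by (simp add: of_real_hom.mat_hom_one)
    have vu: "cmat Gp\<^sup>T *\<^sub>v u = v"
      unfolding u_def using GpV V Gp v
        assoc_mult_mat_vec[of "cmat Gp\<^sup>T" d d "cmat V\<^sup>T" d v] by simp
    have Gmu: "cmat Gm\<^sup>T *\<^sub>v u = \<mu> \<cdot>\<^sub>v v"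
    proof -
      have "?U = cmat Gm\<^sup>T * cmat V\<^sup>T"
        by (rule cmat_transpose_mult[OF V(1) Gm])
      then show ?thesis unfolding u_def v(3)[symmetric] using Gm V v by (simp add: assoc_mult_mat_vec[of _ d d _ d])
    qed
    have GpT: "cmat Gp\<^sup>T = cmat G\<^sup>T + of_real a \<cdot>\<^sub>m 1\<^sub>m d" and GmT: "cmat Gm\<^sup>T = cmat G\<^sup>T - of_real a \<cdot>\<^sub>m 1\<^sub>m d"
      using G unfolding Gp_def Gm_def by (auto intro!: eq_matI)
    have e1: "cmat G\<^sup>T *\<^sub>v u + of_real a \<cdot>\<^sub>v u = v"
      using vu G u unfolding GpT by (simp add: shift_mult_vec)
    have e2: "cmat G\<^sup>T *\<^sub>v u - of_real a \<cdot>\<^sub>v u = \<mu> \<cdot>\<^sub>v v"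
      using Gmu G u unfolding GmT by (simp add: shift_mult_vec)
    define g where "g = cmat G\<^sup>T *\<^sub>v u"
    have g: "g \<in> carrier_vec d" using G u unfolding g_def by auto
    have c1: "g $ i + a * u $ i = v $ i" and c2: "g $ i - a * u $ i = \<mu> * v $ i" if "i < d" for i
      using arg_cong[OF e1, of "\<lambda>v. v $ i"] arg_cong[OF e2, of "\<lambda>v. v $ i"] that g u v(1)
      unfolding g_def[symmetric] by auto
    have "u \<noteq> 0\<^sub>v d" using vu v Gp by auto
    have "cmat H\<^sup>T *\<^sub>v u = 0\<^sub>v m"
    proof -
      have "Hs 0 = V * H" unfolding Hs_def R0 by simp
      then have "?N = cmat H\<^sup>T * cmat V\<^sup>T"
        using cmat_transpose_mult[OF V(1) H] by simp
      then show ?thesis using v(4) H V v(1) unfolding u_def by (simp add: assoc_mult_mat_vec[of _ m d _ d])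
    qed
    moreover have "\<mu> \<noteq> 1"
    proof
      assume "\<mu> = 1"
      then have "u $ i = 0" if "i < d" for i
        using c1[OF that] c2[OF that] a(1) by (simp add: algebra_simps)
      then show False using \<open>u \<noteq> 0\<^sub>v d\<close> u by auto
    qed
    \<comment> \<open>The inverse Cayley transform sends the eigenvalue \<open>\<mu>\<close> of \<open>\<Psi>\<close> to \<open>a (1 + \<mu>) / (1 - \<mu>)\<close>.\<close>
    then have "g = (a * (1 + \<mu>) / (1 - \<mu>)) \<cdot>\<^sub>v u"
    proof (intro eq_vecI)
      fix i assume "i < dim_vec ((a * (1 + \<mu>) / (1 - \<mu>)) \<cdot>\<^sub>v u)"
      then have i: "i < d" using u by simp
      have "g $ i * (1 - \<mu>) = a * (1 + \<mu>) * u $ i"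
      proof -
        have "g $ i - a * u $ i = \<mu> * (g $ i + a * u $ i)" using c1[OF i] c2[OF i] by simp
        then show ?thesis by (simp add: algebra_simps)
      qed
      then show "g $ i = ((a * (1 + \<mu>) / (1 - \<mu>)) \<cdot>\<^sub>v u) $ i"
        using i u \<open>\<mu> \<noteq> 1\<close> by (simp add: field_simps)
    qed (use g u in auto)
    ultimately show False using pbh[OF u] \<open>u \<noteq> 0\<^sub>v d\<close> unfolding g_def by blast
  qed
  have real: "Im ((cmat (W d) *\<^sub>v w) \<bullet>c w) = 0" if w: "w \<in> carrier_vec d" for w
    unfolding form[OF w w] Im_sum by (intro sum.neutral ballI csq_norm_Im)
  have lyap: "4 * a * Re ((cmat (W d) *\<^sub>v w) \<bullet>c (cmat G\<^sup>T *\<^sub>v w)) = csq_norm (cmat H\<^sup>T *\<^sub>v w) - csq_norm (cmat (R d)\<^sup>T *\<^sub>v w)"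
    if w: "w \<in> carrier_vec d" for w
  proof -
    let ?Hw = "cmat H\<^sup>T *\<^sub>v w" and ?Gw = "cmat G\<^sup>T *\<^sub>v w" and ?Ww = "cmat (W d) *\<^sub>v w"
    let ?R = "\<lambda>k. cmat (R k)\<^sup>T *\<^sub>v w"
    have vecs: "?Gw \<in> carrier_vec d" using G w by auto
    have "4 * a * Re (?h k w \<bullet>c ?h k ?Gw) = csq_norm (?R k) - csq_norm (?R (Suc k))" for k
    proof -
      let ?p = "?h k ?Gw" and ?q = "?h k w"
      have pq: "?p \<in> carrier_vec m" "?q \<in> carrier_vec m" using Hs[of k] G w by auto
      have "Gp\<^sup>T = G\<^sup>T + a \<cdot>\<^sub>m 1\<^sub>m d" "Gm\<^sup>T = G\<^sup>T - a \<cdot>\<^sub>m 1\<^sub>m d"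
        using G unfolding Gp_def Gm_def by (auto intro!: eq_matI)
      then have GT: "cmat Gp\<^sup>T = cmat G\<^sup>T + of_real a \<cdot>\<^sub>m 1\<^sub>m d" "cmat Gm\<^sup>T = cmat G\<^sup>T - of_real a \<cdot>\<^sub>m 1\<^sub>m d"
        using G by (auto intro!: eq_matI)
      have "(R k)\<^sup>T = (Hs k)\<^sup>T * Gp\<^sup>T" "(R (Suc k))\<^sup>T = (Hs k)\<^sup>T * Gm\<^sup>T"
        unfolding RS RH[of k] by (rule transpose_mult[OF Gp Hs] transpose_mult[OF Gm Hs])+
      then have "?R k = ?h k (cmat Gp\<^sup>T *\<^sub>v w)" "?R (Suc k) = ?h k (cmat Gm\<^sup>T *\<^sub>v w)"
        using cmat_mult_vec[of "(Hs k)\<^sup>T" m d "Gp\<^sup>T" d w] cmat_mult_vec[of "(Hs k)\<^sup>T" m d "Gm\<^sup>T" d w]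
          Hs[of k] Gp Gm w by auto
      moreover have "cmat Gp\<^sup>T *\<^sub>v w = ?Gw + of_real a \<cdot>\<^sub>v w" "cmat Gm\<^sup>T *\<^sub>v w = ?Gw - of_real a \<cdot>\<^sub>v w"
        unfolding GT using G w by (simp_all add: shift_mult_vec)
      ultimately have Rpq: "?R k = ?p + of_real a \<cdot>\<^sub>v ?q" "?R (Suc k) = ?p - of_real a \<cdot>\<^sub>v ?q"
        using Hs[of k] w vecs
        by (simp_all add: mult_add_distrib_mat_vec[of _ m d] mult_minus_distrib_mat_vec[of _ m d] mult_mat_vec[of _ m d])
      show ?thesis unfolding Rpq by (rule csq_norm_polarization[OF pq])
    qed
    then have "4 * a * Re (?Ww \<bullet>c ?Gw) = (\<Sum>k<d. csq_norm (?R k) - csq_norm (?R (Suc k)))"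
      unfolding form[OF w vecs] by (simp add: sum_distrib_left)
    also have "\<dots> = csq_norm ?Hw - csq_norm (?R d)"
      by (subst sum_lessThan_telescope') (simp add: R0)
    finally show ?thesis .
  qed
  show ?thesis
    by (rule gramian_feedback[OF G H W a(1), where r = "\<lambda>w. csq_norm (cmat (R d)\<^sup>T *\<^sub>v w)"])
      (fact pos real lyap csq_norm_nonneg pbh that)+
qed

section \<open>Exponential decay of solutions\<close>

lemma has_deriv_Re:
  assumes "(f has_vector_derivative d) F"
  shows "((\<lambda>t. Re (f t)) has_vector_derivative Re d) F"
  by (rule bounded_linear.has_vector_derivative[OF bounded_linear_Re assms])

lemma cnj_sgn_mult: "cnj (sgn z) * z = of_real (cmod z)"
proof (cases "z = 0")
  case False
  have "cnj (sgn z) * z = (z * cnj z) / of_real (cmod z)" by (simp add: sgn_eq)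
  also have "\<dots> = of_real (cmod z)"
    using False by (simp add: complex_norm_square[symmetric] power2_eq_square)
  finally show ?thesis .
qed simp

text \<open>The function \<open>h t = exp (- l t) y t\<close> has derivative \<open>exp (- l t) g t\<close>, of modulus at most
\<open>c exp (\<delta> t)\<close> with \<open>\<delta> = - Re l - \<gamma> > 0\<close>. Comparing the component of \<open>h\<close> along \<open>h T - h 0\<close> with the
primitive \<open>c exp (\<delta> t) / \<delta>\<close> bounds \<open>h T - h 0\<close>, and multiplying by \<open>exp (l T)\<close> gives the claim.\<close>

lemma scalar_decay:
  fixes y g :: "real \<Rightarrow> complex"
  assumes deriv: "\<And>t. 0 \<le> t \<Longrightarrow> (y has_vector_derivative (l * y t + g t)) (at t within {0..})"
    and g: "\<And>t. 0 \<le> t \<Longrightarrow> cmod (g t) \<le> c * exp (- \<gamma> * t)"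
    and rate: "\<gamma> < - Re l" and T: "0 \<le> T"
  shows "cmod (y T) \<le> (cmod (y 0) + c / (- Re l - \<gamma>)) * exp (- \<gamma> * T)"
proof -
  define \<delta> where "\<delta> = - Re l - \<gamma>"
  have \<delta>: "\<delta> > 0" using rate unfolding \<delta>_def by simp
  have c: "0 \<le> c" using order_trans[OF norm_ge_zero g[of 0]] by simp
  define h where "h t = exp (- (l * of_real t)) * y t" for t
  have h': "(h has_vector_derivative (exp (- (l * of_real t)) * g t)) (at t within {0..})" if "0 \<le> t" for t
  proof -
    have "((\<lambda>t. exp (- (l * of_real t))) has_vector_derivative (- l * exp (- (l * of_real t)))) (at t within {0..})"
      by (rule has_vector_derivative_real_field) (auto intro!: derivative_eq_intros)
    from has_vector_derivative_mult[OF this deriv[OF that]]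
    show ?thesis unfolding h_def by (simp add: algebra_simps)
  qed
  define th where "th = cnj (sgn (h T - h 0))"
  have th: "cmod th \<le> 1" unfolding th_def by (simp add: norm_sgn)
  define \<phi> where "\<phi> t = c / \<delta> * exp (\<delta> * t) - Re (th * h t)" for t
  define \<phi>' where "\<phi>' t = c * exp (\<delta> * t) - Re (th * (exp (- (l * of_real t)) * g t))" for t
  have \<phi>': "(\<phi> has_real_derivative \<phi>' t) (at t within {0..})" if "0 \<le> t" for t
  proof -
    have "((\<lambda>t. Re (th * h t)) has_real_derivative Re (th * (exp (- (l * of_real t)) * g t))) (at t within {0..})"
      unfolding has_real_derivative_iff_has_vector_derivative
      by (intro has_deriv_Re bounded_linear.has_vector_derivative[OF bounded_linear_mult_right] h' that)
    moreover have "((\<lambda>t. c / \<delta> * exp (\<delta> * t)) has_real_derivative c * exp (\<delta> * t)) (at t within {0..})"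
      using \<delta> by (auto intro!: derivative_eq_intros)
    ultimately show ?thesis unfolding \<phi>_def \<phi>'_def by (intro DERIV_diff)
  qed
  have "\<phi> 0 \<le> \<phi> T"
  proof (rule DERIV_nonneg_imp_increasing_open[OF T])
    show "\<exists>d. (\<phi> has_real_derivative d) (at t) \<and> 0 \<le> d" if "0 < t" "t < T" for t
    proof (intro exI conjI)
      show "(\<phi> has_real_derivative \<phi>' t) (at t)"
        using DERIV_subset[OF \<phi>'[of t], of "{0<..}"] that at_within_open[of t "{0<..}"] by (simp add: subset_eq)
      have "Re (th * (exp (- (l * of_real t)) * g t)) \<le> cmod th * (cmod (exp (- (l * of_real t))) * cmod (g t))"
        using complex_Re_le_cmod[of "th * (exp (- (l * of_real t)) * g t)"] by (simp add: norm_mult)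
      also have "\<dots> \<le> 1 * (cmod (exp (- (l * of_real t))) * cmod (g t))"
        by (intro mult_right_mono th) auto
      also have "\<dots> \<le> exp (- Re l * t) * (c * exp (- \<gamma> * t))"
        using g[of t] that by (simp add: norm_exp_eq_Re)
      also have "\<dots> = c * exp (\<delta> * t)" unfolding \<delta>_def by (simp add: exp_add[symmetric] algebra_simps)
      finally show "0 \<le> \<phi>' t" unfolding \<phi>'_def by simp
    qed
    show "continuous_on {0..T} \<phi>"
    proof (rule continuous_on_subset)
      show "continuous_on {0..} \<phi>"
        by (rule DERIV_continuous_on[of _ _ \<phi>']) (use \<phi>' in auto)
    qed auto
  qed
  have "Re (th * h T) - Re (th * h 0) = cmod (h T - h 0)"
  proof -
    have "th * (h T - h 0) = of_real (cmod (h T - h 0))"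
      unfolding th_def by (rule cnj_sgn_mult)
    then show ?thesis by (metis Re_complex_of_real minus_complex.simps(1) right_diff_distrib)
  qed
  have "cmod (h T - h 0) \<le> c / \<delta> * exp (\<delta> * T)"
  proof -
    have "\<phi> 0 = c / \<delta> - Re (th * h 0)" unfolding \<phi>_def by simp
    moreover have "0 \<le> c / \<delta>" using c \<delta> by simp
    moreover note \<open>\<phi> 0 \<le> \<phi> T\<close> \<open>Re (th * h T) - Re (th * h 0) = cmod (h T - h 0)\<close>
    ultimately show ?thesis unfolding \<phi>_def[of T] by linarith
  qed
  then have hT: "cmod (h T) \<le> cmod (y 0) + c / \<delta> * exp (\<delta> * T)"
    using norm_triangle_sub[of "h T" "h 0"] unfolding h_def[of 0] by simp
  have "cmod (y T) = exp (Re l * T) * cmod (h T)"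
  proof -
    have "exp (Re l * T) * cmod (exp (- (l * of_real T))) = 1"
      by (simp add: norm_exp_eq_Re exp_add[symmetric])
    then have "exp (Re l * T) * (cmod (exp (- (l * of_real T))) * cmod (y T)) = cmod (y T)"
      by (simp add: mult.assoc[symmetric])
    then show ?thesis unfolding h_def norm_mult by simp
  qed
  also have "\<dots> \<le> exp (Re l * T) * (cmod (y 0) + c / \<delta> * exp (\<delta> * T))"
    using hT by (intro mult_left_mono) auto
  also have "\<dots> = exp (Re l * T) * cmod (y 0) + c / \<delta> * exp (- \<gamma> * T)"
  proof -
    have "exp (Re l * T) * exp (\<delta> * T) = exp (- \<gamma> * T)"
      unfolding \<delta>_def exp_add[symmetric] by (simp add: algebra_simps)
    then show ?thesis by (metis distrib_left mult.left_commute)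
  qed
  also have "\<dots> \<le> exp (- \<gamma> * T) * cmod (y 0) + c / \<delta> * exp (- \<gamma> * T)"
    using mult_right_mono[of "Re l" "- \<gamma>" T] rate T by (intro add_right_mono mult_right_mono) auto
  finally show ?thesis unfolding \<delta>_def by (simp add: algebra_simps)
qed

lemma vec_norm_le_sum: "vec_norm v \<le> (\<Sum>i<dim_vec v. \<bar>v $ i\<bar>)"
proof -
  have sq: "(\<Sum>i<k. \<bar>v $ i\<bar>\<^sup>2) \<le> (\<Sum>i<k. \<bar>v $ i\<bar>)\<^sup>2" for k
  proof (induction k)
    case (Suc k)
    have "0 \<le> (\<Sum>i<k. \<bar>v $ i\<bar>) * \<bar>v $ k\<bar>" by (intro mult_nonneg_nonneg sum_nonneg) auto
    then show ?case using Suc unfolding sum.lessThan_Suc power2_sum by linarith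
  qed simp
  have "v \<bullet> v = (\<Sum>i<dim_vec v. \<bar>v $ i\<bar>\<^sup>2)"
    by (simp add: scalar_prod_def atLeast0LessThan power2_eq_square)
  also note sq
  finally show ?thesis unfolding vec_norm_def by (intro real_le_lsqrt sum_nonneg) auto
qed

lemma component_le_vec_norm: "i < dim_vec v \<Longrightarrow> \<bar>v $ i\<bar> \<le> vec_norm v"
proof -
  assume i: "i < dim_vec v"
  have "(v $ i)\<^sup>2 \<le> (\<Sum>i<dim_vec v. (v $ i)\<^sup>2)"
    using i by (intro member_le_sum) auto
  then have "(v $ i)\<^sup>2 \<le> v \<bullet> v"
    by (simp add: scalar_prod_def atLeast0LessThan power2_eq_square)
  then show ?thesis unfolding vec_norm_def by (metis real_sqrt_abs real_sqrt_le_mono)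
qed

lemma vec_norm_nonneg: "0 \<le> vec_norm v"
  unfolding vec_norm_def by (simp add: scalar_prod_def sum_nonneg)

text \<open>In triangular coordinates each component solves a scalar equation forced by the later components,
so the bounds follow from the last component upwards. Choosing \<open>\<gamma>\<close> strictly below every decay rate
\<open>- Re J\<^sub>i\<^sub>i\<close> absorbs the polynomial factors that repeated eigenvalues would produce.\<close>

lemma hurwitz_decay:
  assumes X: "X \<in> carrier_mat N N" and hur: "hurwitz X"
  shows "\<exists>c>0. \<exists>\<gamma>>0. \<forall>w. (\<forall>t\<ge>0. w t \<in> carrier_vec N \<and> has_vec_deriv w (X *\<^sub>v w t) t) \<longrightarrow>
    (\<forall>t\<ge>0. vec_norm (w t) \<le> c * exp (- \<gamma> * t) * vec_norm (w 0))"
proof -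
  have cX: "cmat X \<in> carrier_mat N N" using X by simp
  obtain J P Q where JPQ: "J \<in> carrier_mat N N" "P \<in> carrier_mat N N" "Q \<in> carrier_mat N N"
    "P * Q = 1\<^sub>m N" "Q * P = 1\<^sub>m N" "cmat X = P * J * Q" "upper_triangular J"
    "\<And>i. i < N \<Longrightarrow> eigenvalue (cmat X) (J $$ (i, i))"
    using triangularization[OF cX] by metis
  have neg: "Re (J $$ (i, i)) < 0" if "i < N" for i
    using JPQ(8)[OF that] hur unfolding hurwitz_def by blast
  obtain \<gamma> where \<gamma>: "0 < \<gamma>" "\<And>i. i < N \<Longrightarrow> \<gamma> < - Re (J $$ (i, i))"
  proof
    let ?m = "Min (insert 1 ((\<lambda>i. - Re (J $$ (i, i))) ` {..<N}))"
    have "0 < ?m" using neg by auto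
    then show "0 < ?m / 2" by simp
    show "?m / 2 < - Re (J $$ (i, i))" if "i < N" for i
    proof -
      have "?m \<le> - Re (J $$ (i, i))" using that by (intro Min_le) auto
      then show ?thesis using \<open>0 < ?m\<close> by linarith
    qed
  qed
  define sol where "sol w \<longleftrightarrow> (\<forall>t\<ge>0. w t \<in> carrier_vec N \<and> has_vec_deriv w (X *\<^sub>v w t) t)" for w :: "real \<Rightarrow> real vec"
  define y where "y w i t = (\<Sum>j<N. Q $$ (i, j) * complex_of_real (w t $ j))" for w :: "real \<Rightarrow> real vec" and i t
  have y_vec: "Q *\<^sub>v map_vec of_real (w t) = vec N (\<lambda>i. y w i t)" if "sol w" "0 \<le> t" for w t
    using that JPQ(3) unfolding sol_def y_def
    by (intro eq_vecI) (auto simp: scalar_prod_def atLeast0LessThan intro!: sum.cong)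
  have dy: "(y w i has_vector_derivative (\<Sum>l<N. J $$ (i, l) * y w l t)) (at t within {0..})"
    if w: "sol w" and t: "0 \<le> t" and i: "i < N" for w i t
  proof -
    let ?w = "map_vec complex_of_real (w t)"
    have wt: "w t \<in> carrier_vec N" using w t unfolding sol_def by auto
    have "((\<lambda>t. w t $ j) has_real_derivative (X *\<^sub>v w t) $ j) (at t within {0..})" if "j < N" for j
      using w t that X unfolding sol_def has_vec_deriv_def by auto
    then have "(y w i has_vector_derivative (\<Sum>j<N. Q $$ (i, j) * of_real ((X *\<^sub>v w t) $ j))) (at t within {0..})"
      unfolding y_def
      by (intro has_vector_derivative_sum bounded_linear.has_vector_derivative[OF bounded_linear_mult_right]
          bounded_linear.has_vector_derivative[OF bounded_linear_of_real])
        (auto simp: has_real_derivative_iff_has_vector_derivative)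
    moreover have "(\<Sum>j<N. Q $$ (i, j) * of_real ((X *\<^sub>v w t) $ j)) = (Q *\<^sub>v (cmat X *\<^sub>v ?w)) $ i"
    proof -
      have "cmat X *\<^sub>v ?w = map_vec of_real (X *\<^sub>v w t)"
        using X wt by (intro of_real_hom.mult_mat_vec_hom[symmetric]) auto
      then show ?thesis using i X JPQ(3) wt
        by (auto simp: scalar_prod_def atLeast0LessThan intro!: sum.cong)
    qed
    moreover have "Q *\<^sub>v (cmat X *\<^sub>v ?w) = J *\<^sub>v (Q *\<^sub>v ?w)"
    proof -
      have "Q * cmat X = (Q * P) * J * Q"
        unfolding JPQ(6) using JPQ(1-3) by (simp add: assoc_mult_mat[of _ N N _ N _ N])
      then have "Q * cmat X = J * Q" using JPQ(1,3,5) by simp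
      then have "(Q * cmat X) *\<^sub>v ?w = (J * Q) *\<^sub>v ?w" by simp
      then show ?thesis
        using assoc_mult_mat_vec[OF JPQ(3) cX, of ?w] assoc_mult_mat_vec[OF JPQ(1,3), of ?w] wt by simp
    qed
    moreover have "(J *\<^sub>v (Q *\<^sub>v ?w)) $ i = (\<Sum>l<N. J $$ (i, l) * y w l t)"
      unfolding y_vec[OF w t] using i JPQ(1) by (auto simp: scalar_prod_def atLeast0LessThan intro!: sum.cong)
    ultimately show ?thesis by simp
  qed
  have "\<exists>C\<ge>0. \<forall>w t. sol w \<longrightarrow> 0 \<le> t \<longrightarrow> cmod (y w i t) \<le> C * exp (- \<gamma> * t) * vec_norm (w 0)" if "i < N" for i
    using that
  proof (induction "N - i" arbitrary: i rule: less_induct)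
    case less
    have "\<forall>l\<in>{i<..<N}. \<exists>C\<ge>0. \<forall>w t. sol w \<longrightarrow> 0 \<le> t \<longrightarrow> cmod (y w l t) \<le> C * exp (- \<gamma> * t) * vec_norm (w 0)"
      using less by auto
    then obtain C where C: "\<And>l. l \<in> {i<..<N} \<Longrightarrow> 0 \<le> C l"
      "\<And>l w t. l \<in> {i<..<N} \<Longrightarrow> sol w \<Longrightarrow> 0 \<le> t \<Longrightarrow> cmod (y w l t) \<le> C l * exp (- \<gamma> * t) * vec_norm (w 0)"
      by metis
    let ?S = "\<Sum>l\<in>{i<..<N}. cmod (J $$ (i, l)) * C l" and ?Q = "\<Sum>j<N. cmod (Q $$ (i, j))"
    let ?\<delta> = "- Re (J $$ (i, i)) - \<gamma>"
    have \<delta>: "0 < ?\<delta>" using \<gamma>(2)[OF less.prems] by simp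
    have "cmod (y w i t) \<le> (?Q + ?S / ?\<delta>) * exp (- \<gamma> * t) * vec_norm (w 0)"
      if w: "sol w" and t: "0 \<le> t" for w t
    proof -
      let ?g = "\<lambda>t. \<Sum>l\<in>{i<..<N}. J $$ (i, l) * y w l t"
      have split: "(\<Sum>l<N. J $$ (i, l) * y w l t) = J $$ (i, i) * y w i t + ?g t" for t
      proof -
        have "(\<Sum>l<N. J $$ (i, l) * y w l t) = (\<Sum>l\<in>insert i {i<..<N}. J $$ (i, l) * y w l t)"
          using less.prems JPQ(1,7) unfolding upper_triangular_def by (intro sum.mono_neutral_right) auto
        then show ?thesis by simp
      qed
      have "cmod (y w i t) \<le> (cmod (y w i 0) + ?S * vec_norm (w 0) / ?\<delta>) * exp (- \<gamma> * t)"
      proof (rule scalar_decay[where g = ?g and c = "?S * vec_norm (w 0)"])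
        fix t :: real assume t: "0 \<le> t"
        show "(y w i has_vector_derivative J $$ (i, i) * y w i t + ?g t) (at t within {0..})"
          using dy[OF w t less.prems] split by simp
        have "cmod (?g t) \<le> (\<Sum>l\<in>{i<..<N}. cmod (J $$ (i, l)) * (C l * exp (- \<gamma> * t) * vec_norm (w 0)))"
          using C(2)[OF _ w t] by (intro sum_norm_le) (auto simp: norm_mult intro!: mult_left_mono)
        then show "cmod (?g t) \<le> ?S * vec_norm (w 0) * exp (- \<gamma> * t)"
          by (simp add: sum_distrib_left sum_distrib_right ac_simps)
      qed (use \<gamma>(2)[OF less.prems] t in auto)
      moreover have "cmod (y w i 0) \<le> ?Q * vec_norm (w 0)"
      proof -
        have "w 0 \<in> carrier_vec N" using w unfolding sol_def by auto
        then have "cmod (y w i 0) \<le> (\<Sum>j<N. cmod (Q $$ (i, j)) * vec_norm (w 0))"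
          unfolding y_def
          by (intro sum_norm_le) (auto simp: norm_mult intro!: mult_left_mono component_le_vec_norm)
        then show ?thesis by (simp add: sum_distrib_right)
      qed
      ultimately have "cmod (y w i t) \<le> (?Q * vec_norm (w 0) + ?S * vec_norm (w 0) / ?\<delta>) * exp (- \<gamma> * t)"
        by (smt (verit) exp_gt_zero mult_right_mono)
      then show ?thesis by (simp add: algebra_simps)
    qed
    moreover have "0 \<le> ?Q + ?S / ?\<delta>"
      using C(1) \<delta> by (intro add_nonneg_nonneg divide_nonneg_pos sum_nonneg) auto
    ultimately show ?case by blast
  qed
  then obtain C where C: "\<And>i. i < N \<Longrightarrow> 0 \<le> C i"
      "\<And>i w t. i < N \<Longrightarrow> sol w \<Longrightarrow> 0 \<le> t \<Longrightarrow> cmod (y w i t) \<le> C i * exp (- \<gamma> * t) * vec_norm (w 0)"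
    by metis
  define c where "c = (\<Sum>i<N. \<Sum>j<N. cmod (P $$ (i, j)) * C j)"
  have c: "0 \<le> c" unfolding c_def using C(1) by (intro sum_nonneg) auto
  have bound: "vec_norm (w t) \<le> c * exp (- \<gamma> * t) * vec_norm (w 0)" if w: "sol w" and t: "0 \<le> t" for w t
  proof -
    let ?w = "map_vec complex_of_real (w t)"
    have wt: "w t \<in> carrier_vec N" using w t unfolding sol_def by auto
    have "?w = P *\<^sub>v (Q *\<^sub>v ?w)"
      using assoc_mult_mat_vec[OF JPQ(2,3), of ?w] JPQ(4) wt by simp
    then have Pw: "?w = P *\<^sub>v vec N (\<lambda>i. y w i t)" unfolding y_vec[OF w t] .
    have comp: "\<bar>w t $ i\<bar> \<le> (\<Sum>j<N. cmod (P $$ (i, j)) * C j) * exp (- \<gamma> * t) * vec_norm (w 0)" if i: "i < N" for i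
    proof -
      have "\<bar>w t $ i\<bar> = cmod (?w $ i)" using i wt by simp
      also have "\<dots> = cmod (\<Sum>j<N. P $$ (i, j) * y w j t)"
        unfolding Pw using i JPQ(2) by (auto simp: scalar_prod_def atLeast0LessThan intro!: sum.cong arg_cong[of _ _ cmod])
      also have "\<dots> \<le> (\<Sum>j<N. cmod (P $$ (i, j)) * (C j * exp (- \<gamma> * t) * vec_norm (w 0)))"
        using C(2)[OF _ w t] by (intro sum_norm_le) (auto simp: norm_mult intro!: mult_left_mono)
      finally show ?thesis by (simp add: sum_distrib_left sum_distrib_right ac_simps)
    qed
    have "(\<Sum>i<dim_vec (w t). \<bar>w t $ i\<bar>) \<le> (\<Sum>i<N. (\<Sum>j<N. cmod (P $$ (i, j)) * C j) * exp (- \<gamma> * t) * vec_norm (w 0))"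
      unfolding carrier_vecD[OF wt] by (intro sum_mono comp) simp
    also have "\<dots> = c * exp (- \<gamma> * t) * vec_norm (w 0)" unfolding c_def by (simp add: sum_distrib_right)
    finally show ?thesis using vec_norm_le_sum[of "w t"] by linarith
  qed
  have "(\<forall>t\<ge>0. w t \<in> carrier_vec N \<and> has_vec_deriv w (X *\<^sub>v w t) t) \<longrightarrow>
    (\<forall>t\<ge>0. vec_norm (w t) \<le> (c + 1) * exp (- \<gamma> * t) * vec_norm (w 0))" for w
  proof (intro allI impI)
    fix t :: real
    assume "\<forall>t\<ge>0. w t \<in> carrier_vec N \<and> has_vec_deriv w (X *\<^sub>v w t) t" and t: "0 \<le> t"
    then have "vec_norm (w t) \<le> c * exp (- \<gamma> * t) * vec_norm (w 0)" using bound unfolding sol_def by blast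
    also have "\<dots> \<le> (c + 1) * exp (- \<gamma> * t) * vec_norm (w 0)"
      by (intro mult_right_mono) (auto simp: vec_norm_nonneg)
    finally show "vec_norm (w t) \<le> (c + 1) * exp (- \<gamma> * t) * vec_norm (w 0)" .
  qed
  moreover have "0 < c + 1" using c by simp
  ultimately show ?thesis using \<gamma>(1) by blast
qed

section \<open>Cayley-Hamilton and single-input controllability\<close>

lemma index_mult_sum:
  "i < dim_row X \<Longrightarrow> j < dim_col Y \<Longrightarrow> dim_col X = k \<Longrightarrow> dim_row Y = k \<Longrightarrow>
    (X * Y) $$ (i, j) = (\<Sum>l<k. X $$ (i, l) * Y $$ (l, j))"
  by (simp add: scalar_prod_def atLeast0LessThan)

lemma index_mult_vec_sum:
  "i < dim_row X \<Longrightarrow> dim_col X = k \<Longrightarrow> dim_vec v = k \<Longrightarrow>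
    (X *\<^sub>v v) $ i = (\<Sum>l<k. X $$ (i, l) * v $ l)"
  by (simp add: scalar_prod_def atLeast0LessThan)

lemma pow_mat_Suc_left:
  assumes "X \<in> carrier_mat n n"
  shows "X ^\<^sub>m Suc k = X * X ^\<^sub>m k"
proof (induction k)
  case (Suc k)
  have "X ^\<^sub>m Suc (Suc k) = X * X ^\<^sub>m k * X" using Suc by simp
  also have "\<dots> = X * X ^\<^sub>m Suc k" using assms by (simp add: assoc_mult_mat[of _ n n _ n _ n])
  finally show ?case .
qed (use assms in simp)

lemma char_poly_matrix_index:
  assumes "X \<in> carrier_mat d d" "i < d" "l < d"
  shows "char_poly_matrix X $$ (i, l) = (if i = l then [:0, 1:] else 0) + [:- (X $$ (i, l)):]"
  using assms unfolding char_poly_matrix_def by auto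

lemma coeff_char_poly_matrix_mult:
  fixes X :: "'a::comm_ring_1 mat"
  assumes X: "X \<in> carrier_mat d d" and P: "P \<in> carrier_mat d d" and ij: "i < d" "j < d"
  shows "coeff ((char_poly_matrix X * P) $$ (i, j)) k =
    (if k = 0 then 0 else coeff (P $$ (i, j)) (k - 1)) - (\<Sum>l<d. X $$ (i, l) * coeff (P $$ (l, j)) k)"
proof -
  have "(char_poly_matrix X * P) $$ (i, j) = (\<Sum>l<d. char_poly_matrix X $$ (i, l) * P $$ (l, j))"
    using P ij carrier_matD[OF char_poly_matrix_closed[OF X]] by (intro index_mult_sum) auto
  also have "\<dots> = (\<Sum>l<d. (if i = l then [:0, 1:] * P $$ (l, j) else 0) + [:- (X $$ (i, l)):] * P $$ (l, j))"
    using X ij by (intro sum.cong) (auto simp: char_poly_matrix_index algebra_simps)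
  also have "\<dots> = [:0, 1:] * P $$ (i, j) + (\<Sum>l<d. [:- (X $$ (i, l)):] * P $$ (l, j))"
    using ij by (simp add: sum.distrib sum.delta sum_subtractf sum_negf)
  finally show ?thesis
    by (cases k) (simp_all add: coeff_sum sum_negf)
qed

text \<open>Let \<open>B\<^sub>k\<close> be the coefficient matrices of the adjugate of \<open>s I - X\<close>. Comparing coefficients in
\<open>(s I - X) adj (s I - X) = \<chi>(s) I\<close> gives \<open>\<chi>\<^sub>k I = B\<^sub>k\<^sub>-\<^sub>1 - X B\<^sub>k\<close>, and after multiplication by \<open>X\<^sup>k\<close> the sum
over \<open>k\<close> telescopes to zero.\<close>

lemma cayley_hamilton:
  fixes X :: "'a::comm_ring_1 mat"
  assumes X: "X \<in> carrier_mat d d" and ij: "i < d" "j < d"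
  shows "(\<Sum>k\<le>d. coeff (char_poly X) k * (X ^\<^sub>m k) $$ (i, j)) = 0"
proof -
  let ?f = "char_poly X"
  define P where "P = adj_mat (char_poly_matrix X)"
  have P: "P \<in> carrier_mat d d" and CP: "char_poly_matrix X * P = ?f \<cdot>\<^sub>m 1\<^sub>m d"
    using adj_mat(1,2)[of "char_poly_matrix X" d] X unfolding P_def char_poly_def by auto
  define B where "B k = mat d d (\<lambda>(i, j). coeff (P $$ (i, j)) k)" for k
  \<comment> \<open>The shifted sequence \<open>B\<^sub>k\<^sub>-\<^sub>1\<close>, with \<open>B\<^sub>-\<^sub>1 = 0\<close>.\<close>
  define B' where "B' k = (case k of 0 \<Rightarrow> 0\<^sub>m d d | Suc l \<Rightarrow> B l)" for k
  have B: "B k \<in> carrier_mat d d" "B' k \<in> carrier_mat d d" for k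
    unfolding B_def B'_def by (auto split: nat.split)
  have rec: "coeff ?f k \<cdot>\<^sub>m 1\<^sub>m d = B' k - X * B k" for k
  proof (rule eq_matI)
    fix i j assume "i < dim_row (B' k - X * B k)" "j < dim_col (B' k - X * B k)"
    then have ij: "i < d" "j < d" using X B(1)[of k] by auto
    have "coeff ((char_poly_matrix X * P) $$ (i, j)) k = (if i = j then coeff ?f k else 0)"
      unfolding CP using ij by simp
    moreover have "(X * B k) $$ (i, j) = (\<Sum>l<d. X $$ (i, l) * B k $$ (l, j))"
      using X B(1)[of k] ij by (intro index_mult_sum) auto
    ultimately show "(coeff ?f k \<cdot>\<^sub>m 1\<^sub>m d) $$ (i, j) = (B' k - X * B k) $$ (i, j)"
      using X B(1)[of k] ij unfolding coeff_char_poly_matrix_mult[OF X P ij]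
      by (cases k) (simp_all add: B'_def B_def)
  qed (use X B(1)[of k] in auto)
  have Xk: "X ^\<^sub>m k \<in> carrier_mat d d" for k using X by simp
  have step: "coeff ?f k * (X ^\<^sub>m k) $$ (i, j) = (X ^\<^sub>m k * B' k) $$ (i, j) - (X ^\<^sub>m Suc k * B' (Suc k)) $$ (i, j)" for k
  proof -
    have "X ^\<^sub>m k * (coeff ?f k \<cdot>\<^sub>m 1\<^sub>m d) = X ^\<^sub>m k * B' k - X ^\<^sub>m k * (X * B k)"
      unfolding rec using X Xk B by (simp add: mult_minus_distrib_mat[of _ d d _ d])
    also have "X ^\<^sub>m k * (X * B k) = X ^\<^sub>m Suc k * B' (Suc k)"
      using assoc_mult_mat[OF Xk X B(1)] unfolding B'_def by simp
    finally have eq: "X ^\<^sub>m k * (coeff ?f k \<cdot>\<^sub>m 1\<^sub>m d) = X ^\<^sub>m k * B' k - X ^\<^sub>m Suc k * B' (Suc k)" .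
    have "X ^\<^sub>m k * (coeff ?f k \<cdot>\<^sub>m 1\<^sub>m d) = coeff ?f k \<cdot>\<^sub>m X ^\<^sub>m k"
      using mult_smult_distrib[OF Xk[of k], of "1\<^sub>m d" d "coeff ?f k"] right_mult_one_mat[OF Xk[of k]] by simp
    with eq have "(coeff ?f k \<cdot>\<^sub>m X ^\<^sub>m k) $$ (i, j) = (X ^\<^sub>m k * B' k - X ^\<^sub>m Suc k * B' (Suc k)) $$ (i, j)" by simp
    moreover have "X ^\<^sub>m Suc k * B' (Suc k) \<in> carrier_mat d d" by (rule mult_carrier_mat[OF Xk B(2)])
    ultimately show ?thesis
      using ij carrier_matD[OF Xk[of k]] by (simp del: pow_mat.simps index_mult_mat)
  qed
  \<comment> \<open>Beyond this index all coefficients of the adjugate and of \<open>\<chi>\<close> vanish.\<close>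
  define N where "N = d + (\<Sum>i<d. \<Sum>j<d. degree (P $$ (i, j)))"
  have "degree (P $$ (i, j)) \<le> N" if "i < d" "j < d" for i j
  proof -
    have "degree (P $$ (i, j)) \<le> (\<Sum>j<d. degree (P $$ (i, j)))"
      using that by (intro member_le_sum) auto
    also have "\<dots> \<le> (\<Sum>i<d. \<Sum>j<d. degree (P $$ (i, j)))"
      using that by (intro member_le_sum[of i _ "\<lambda>i. \<Sum>j<d. degree (P $$ (i, j))"]) auto
    finally show ?thesis unfolding N_def by simp
  qed
  then have "coeff (P $$ (i, j)) (Suc N) = 0" if "i < d" "j < d" for i j
    using that by (intro coeff_eq_0) (simp add: le_imp_less_Suc)
  then have B0: "B' (Suc (Suc N)) = 0\<^sub>m d d" unfolding B'_def B_def by (auto intro!: eq_matI)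
  have "(\<Sum>k\<le>d. coeff ?f k * (X ^\<^sub>m k) $$ (i, j)) = (\<Sum>k<Suc (Suc N). coeff ?f k * (X ^\<^sub>m k) $$ (i, j))"
  proof (rule sum.mono_neutral_left)
    show "\<forall>k\<in>{..<Suc (Suc N)} - {..d}. coeff ?f k * (X ^\<^sub>m k) $$ (i, j) = 0"
      using degree_monic_char_poly[OF X] by (auto simp: coeff_eq_0)
  qed (auto simp: N_def)
  also have "\<dots> = (X ^\<^sub>m 0 * B' 0) $$ (i, j) - (X ^\<^sub>m Suc (Suc N) * B' (Suc (Suc N))) $$ (i, j)"
    unfolding step by (rule sum_lessThan_telescope')
  also have "\<dots> = 0"
    unfolding B0 right_mult_zero_mat[OF Xk] using ij X by (simp add: B'_def)
  finally show ?thesis .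
qed

lemma annihilated_bilinear:
  fixes X :: "'a::comm_ring_1 mat"
  assumes X: "X \<in> carrier_mat n n" and u: "u \<in> carrier_vec n" and v: "v \<in> carrier_vec n"
    and ann: "\<And>i j. i < n \<Longrightarrow> j < n \<Longrightarrow> (\<Sum>k\<le>N. c k * (X ^\<^sub>m k) $$ (i, j)) = 0"
  shows "(\<Sum>k\<le>N. c k * (u \<bullet> (X ^\<^sub>m k *\<^sub>v v))) = 0"
proof -
  have "u \<bullet> (X ^\<^sub>m k *\<^sub>v v) = (\<Sum>i<n. \<Sum>j<n. u $ i * v $ j * (X ^\<^sub>m k) $$ (i, j))" for k
  proof -
    have Xk: "X ^\<^sub>m k \<in> carrier_mat n n" using X by simp
    have "u \<bullet> (X ^\<^sub>m k *\<^sub>v v) = (\<Sum>i<n. u $ i * (X ^\<^sub>m k *\<^sub>v v) $ i)"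
      unfolding scalar_prod_def using X Xk u by (simp add: atLeast0LessThan)
    also have "\<dots> = (\<Sum>i<n. u $ i * (\<Sum>j<n. (X ^\<^sub>m k) $$ (i, j) * v $ j))"
      using Xk v by (intro sum.cong refl arg_cong2[of _ _ _ _ "(*)"] index_mult_vec_sum) auto
    finally show ?thesis by (simp add: sum_distrib_left ac_simps)
  qed
  then have "(\<Sum>k\<le>N. c k * (u \<bullet> (X ^\<^sub>m k *\<^sub>v v))) =
      (\<Sum>k\<le>N. \<Sum>i<n. \<Sum>j<n. u $ i * v $ j * (c k * (X ^\<^sub>m k) $$ (i, j)))"
    by (simp add: sum_distrib_left ac_simps)
  also have "\<dots> = (\<Sum>i<n. \<Sum>j<n. u $ i * v $ j * (\<Sum>k\<le>N. c k * (X ^\<^sub>m k) $$ (i, j)))"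
    unfolding sum_distrib_left by (subst sum.swap) (intro sum.cong refl sum.swap)
  also have "\<dots> = 0" using ann by simp
  finally show ?thesis .
qed

text \<open>For a single input the controllability matrix \<open>R\<close> is square, so full rank makes it invertible.\<close>

lemma controllable_inverse:
  assumes b: "b \<in> carrier_mat d d" and s: "s \<in> carrier_mat d 1" and ctrl: "controllable b s"
  defines "R \<equiv> mat d d (\<lambda>(i, k). (b ^\<^sub>m k * s) $$ (i, 0))"
  obtains Y where "Y \<in> carrier_mat d d" "R\<^sup>T * Y = 1\<^sub>m d" "Y * R\<^sup>T = 1\<^sub>m d"
proof -
  have bk: "b ^\<^sub>m k * s \<in> carrier_mat d 1" for k
    by (rule mult_carrier_mat[OF pow_carrier_mat[OF b] s])
  have "concat (map (\<lambda>k. cols (b ^\<^sub>m k * s)) [0..<d]) = map (\<lambda>k. col (b ^\<^sub>m k * s) 0) [0..<d]"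
  proof -
    have "cols (b ^\<^sub>m k * s) = [col (b ^\<^sub>m k * s) 0]" for k
      using bk[of k] s unfolding cols_def by simp
    then show ?thesis by (simp add: concat_map_singleton)
  qed
  moreover have "mat_of_cols d (map (\<lambda>k. col (b ^\<^sub>m k * s) 0) [0..<d]) = R"
    unfolding R_def using b s by (intro eq_matI) (auto simp: mat_of_cols_index)
  ultimately have rank: "mat_rank R = d" using ctrl b unfolding controllable_def by auto
  have R: "R \<in> carrier_mat d d" unfolding R_def by simp
  show ?thesis
  proof (rule inverse_of_trivial_kernel[of "R\<^sup>T" d])
    show "v = 0\<^sub>v d" if "v \<in> carrier_vec d" "R\<^sup>T *\<^sub>v v = 0\<^sub>v d" for v
      by (rule full_row_rank_left_kernel[OF R rank that])
  qed (use R that in auto)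
qed

lemma single_column:
  fixes X :: "real mat"
  assumes X: "X \<in> carrier_mat d 1"
  shows single_column_mult: "g \<in> carrier_vec 1 \<Longrightarrow> X *\<^sub>v g = g $ 0 \<cdot>\<^sub>v col X 0"
    and single_column_scalar: "w \<in> carrier_vec d \<Longrightarrow> w \<bullet> col X 0 = (\<Sum>i<d. w $ i * X $$ (i, 0))"
  using X by (auto intro!: eq_vecI simp: scalar_prod_def atLeast0LessThan mult.commute)

lemma single_column_transpose:
  assumes X: "X \<in> carrier_mat d 1" and w: "w \<in> carrier_vec d"
  shows "(cmat X\<^sup>T *\<^sub>v w) $ 0 = (\<Sum>i<d. of_real (X $$ (i, 0)) * w $ i)"
  using assms by (simp add: scalar_prod_def atLeast0LessThan)

text \<open>If \<open>w\<close> is a left eigenvector of \<open>b\<close> annihilated by \<open>s\<close>, then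
\<open>w\<^sup>T b\<^sup>k s = \<mu>\<^sup>k w\<^sup>T s = 0\<close> for every \<open>k\<close>, and \<open>w\<close> is orthogonal to all columns of the controllability
matrix.\<close>

lemma controllable_pbh:
  assumes b: "b \<in> carrier_mat d d" and s: "s \<in> carrier_mat d 1" and ctrl: "controllable b s"
    and w: "w \<in> carrier_vec d" and ev: "cmat b\<^sup>T *\<^sub>v w = \<mu> \<cdot>\<^sub>v w" and null: "cmat s\<^sup>T *\<^sub>v w = 0\<^sub>v 1"
  shows "w = 0\<^sub>v d"
proof -
  let ?R = "mat d d (\<lambda>(i, k). (b ^\<^sub>m k * s) $$ (i, 0))"
  have bk: "b ^\<^sub>m k \<in> carrier_mat d d" for k using b by simp
  obtain Y where Y: "Y \<in> carrier_mat d d" "Y * ?R\<^sup>T = 1\<^sub>m d"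
    using controllable_inverse[OF b s ctrl] by metis
  have pow: "cmat (b ^\<^sub>m k)\<^sup>T *\<^sub>v w = \<mu> ^ k \<cdot>\<^sub>v w" for k
  proof (induction k)
    case 0
    have "cmat (b ^\<^sub>m 0)\<^sup>T = 1\<^sub>m d" using b by (auto intro!: eq_matI)
    then show ?case using w by simp
  next
    case (Suc k)
    have "cmat (b ^\<^sub>m Suc k)\<^sup>T = cmat b\<^sup>T * cmat (b ^\<^sub>m k)\<^sup>T"
      using cmat_transpose_mult[OF bk[of k] b] by simp
    then have "cmat (b ^\<^sub>m Suc k)\<^sup>T *\<^sub>v w = cmat b\<^sup>T *\<^sub>v (\<mu> ^ k \<cdot>\<^sub>v w)"
      using Suc assoc_mult_mat_vec[of "cmat b\<^sup>T" d d "cmat (b ^\<^sub>m k)\<^sup>T" d w] b bk w by simp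
    also have "\<dots> = \<mu> ^ Suc k \<cdot>\<^sub>v w"
      using b w ev by (simp add: mult_mat_vec[of _ d d] smult_smult_assoc mult.commute)
    finally show ?case .
  qed
  have "cmat ?R\<^sup>T *\<^sub>v w = 0\<^sub>v d"
  proof (rule eq_vecI)
    fix k assume "k < dim_vec (0\<^sub>v d :: complex vec)"
    then have k: "k < d" by simp
    have bks: "b ^\<^sub>m k * s \<in> carrier_mat d 1"
      by (rule mult_carrier_mat[OF pow_carrier_mat[OF b] s])
    have "(cmat ?R\<^sup>T *\<^sub>v w) $ k = (cmat (b ^\<^sub>m k * s)\<^sup>T *\<^sub>v w) $ 0"
      unfolding single_column_transpose[OF bks w]
      using k w by (simp add: scalar_prod_def atLeast0LessThan del: index_mult_mat(1))
    also have "cmat (b ^\<^sub>m k * s)\<^sup>T *\<^sub>v w = cmat s\<^sup>T *\<^sub>v (cmat (b ^\<^sub>m k)\<^sup>T *\<^sub>v w)"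
      using cmat_transpose_mult[OF bk s] assoc_mult_mat_vec[of "cmat s\<^sup>T" 1 d "cmat (b ^\<^sub>m k)\<^sup>T" d w] s bk w by simp
    also have "\<dots> = 0\<^sub>v 1" unfolding pow using s w null by (auto simp: mult_mat_vec[of _ 1 d])
    finally show "(cmat ?R\<^sup>T *\<^sub>v w) $ k = 0\<^sub>v d $ k" using k by simp
  qed simp
  then have "cmat (Y * ?R\<^sup>T) *\<^sub>v w = 0\<^sub>v d"
    using cmat_mult_vec[of Y d d "?R\<^sup>T" d w] Y w by auto
  then show ?thesis unfolding Y(2) using w by (simp add: of_real_hom.mat_hom_one)
qed

text \<open>Choose a row \<open>w\<close> with \<open>w\<^sup>T b\<^sup>k s = 0\<close> for \<open>k < d - 1\<close> and \<open>w\<^sup>T b\<^sup>d\<^sup>-\<^sup>1 s = 1\<close>, and put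
\<open>r\<^sub>k v = w\<^sup>T b\<^sup>k Z v\<close>. The Sylvester identity gives \<open>r\<^sub>k v = r\<^sub>0 (S\<^sup>k v)\<close> for \<open>k < d\<close>, whereas
\<open>r\<^sub>0 (S\<^sup>d v) = r\<^sub>d v + Gam v\<close>. Weight these equations with the coefficients of \<open>f = char_poly b\<close> and add:
the left-hand sides cancel because \<open>f(S) = 0\<close>, the terms \<open>r\<^sub>k v\<close> cancel because \<open>f(b) = 0\<close>, and as \<open>f\<close> is
monic exactly \<open>Gam v\<close> remains.\<close>

lemma single_copy_regulates:
  fixes S :: "real mat"
  assumes b: "b \<in> carrier_mat d d" and s: "s \<in> carrier_mat d 1" and ctrl: "controllable b s"
    and S: "S \<in> carrier_mat q q" and q: "0 < q"
    and ann: "poly_mat (char_poly b) S = 0\<^sub>m q q"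
    and Z: "Z \<in> carrier_mat d q" and Gam: "Gam \<in> carrier_mat 1 q"
    and syl: "Z * S = b * Z + s * Gam"
  shows "Gam = 0\<^sub>m 1 q"
proof -
  let ?f = "char_poly b"
  have deg: "degree ?f = d" "coeff ?f d = 1" using degree_monic_char_poly[OF b] by auto
  have annS: "(\<Sum>k\<le>d. coeff ?f k * (S ^\<^sub>m k) $$ (i, j)) = 0" if "i < q" "j < q" for i j
    using arg_cong[OF ann, of "\<lambda>X. X $$ (i, j)"] that S unfolding poly_mat_def deg by simp
  have d: "0 < d"
  proof (rule ccontr)
    assume "\<not> 0 < d"
    then show False using annS[of 0 0] q S deg by simp
  qed
  let ?R = "mat d d (\<lambda>(i, k). (b ^\<^sub>m k * s) $$ (i, 0))"
  obtain Y where Y: "Y \<in> carrier_mat d d" "?R\<^sup>T * Y = 1\<^sub>m d"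
    using controllable_inverse[OF b s ctrl] by metis
  define w where "w = Y *\<^sub>v unit_vec d (d - 1)"
  have w: "w \<in> carrier_vec d" using Y unfolding w_def by simp
  have Rw: "?R\<^sup>T *\<^sub>v w = unit_vec d (d - 1)"
    unfolding w_def using assoc_mult_mat_vec[of "?R\<^sup>T" d d Y d "unit_vec d (d - 1)"] Y by simp
  have bk: "b ^\<^sub>m k \<in> carrier_mat d d" for k using b by simp
  have Sk: "S ^\<^sub>m k \<in> carrier_mat q q" for k using S by simp
  have wbs: "w \<bullet> (b ^\<^sub>m k *\<^sub>v (s *\<^sub>v g)) = (if k = d - 1 then g $ 0 else 0)"
    if k: "k < d" and g: "g \<in> carrier_vec 1" for k g
  proof -
    have bks: "b ^\<^sub>m k * s \<in> carrier_mat d 1"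
      by (rule mult_carrier_mat[OF pow_carrier_mat[OF b] s])
    have "b ^\<^sub>m k *\<^sub>v (s *\<^sub>v g) = (b ^\<^sub>m k * s) *\<^sub>v g"
      using assoc_mult_mat_vec[OF bk s g] by simp
    also have "\<dots> = g $ 0 \<cdot>\<^sub>v col (b ^\<^sub>m k * s) 0"
      by (rule single_column_mult[OF bks g])
    finally have "w \<bullet> (b ^\<^sub>m k *\<^sub>v (s *\<^sub>v g)) = g $ 0 * (w \<bullet> col (b ^\<^sub>m k * s) 0)"
      using scalar_prod_smult_distrib[OF w col_dim[of "b ^\<^sub>m k * s" 0, unfolded carrier_matD[OF bks]]] by simp
    moreover have "w \<bullet> col (b ^\<^sub>m k * s) 0 = (?R\<^sup>T *\<^sub>v w) $ k"
      unfolding single_column_scalar[OF bks w]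
      using k w by (simp add: scalar_prod_def atLeast0LessThan mult.commute del: index_mult_mat(1))
    ultimately show ?thesis unfolding Rw using k by simp
  qed
  define r where "r k v = w \<bullet> (b ^\<^sub>m k *\<^sub>v (Z *\<^sub>v v))" for k v
  have rS: "r k (S *\<^sub>v v) = r (Suc k) v + (if k = d - 1 then (Gam *\<^sub>v v) $ 0 else 0)"
    if k: "k < d" and v: "v \<in> carrier_vec q" for k v
  proof -
    have "Z *\<^sub>v (S *\<^sub>v v) = (b * Z + s * Gam) *\<^sub>v v"
      using assoc_mult_mat_vec[OF Z S v] syl by simp
    also have "\<dots> = b *\<^sub>v (Z *\<^sub>v v) + s *\<^sub>v (Gam *\<^sub>v v)"
      using add_mult_distrib_mat_vec[of "b * Z" d q "s * Gam" v] assoc_mult_mat_vec[OF b Z v]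
        assoc_mult_mat_vec[OF s Gam v] b Z s Gam v by simp
    finally have "b ^\<^sub>m k *\<^sub>v (Z *\<^sub>v (S *\<^sub>v v)) = b ^\<^sub>m Suc k *\<^sub>v (Z *\<^sub>v v) + b ^\<^sub>m k *\<^sub>v (s *\<^sub>v (Gam *\<^sub>v v))"
      using mult_add_distrib_mat_vec[OF bk[of k], of "b *\<^sub>v (Z *\<^sub>v v)" "s *\<^sub>v (Gam *\<^sub>v v)"]
        assoc_mult_mat_vec[OF bk[of k] b, of "Z *\<^sub>v v"] b Z s Gam v by simp
    moreover have "b ^\<^sub>m Suc k *\<^sub>v (Z *\<^sub>v v) \<in> carrier_vec d" "b ^\<^sub>m k *\<^sub>v (s *\<^sub>v (Gam *\<^sub>v v)) \<in> carrier_vec d"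
      by (rule mult_mat_vec_carrier[OF bk]; use Z s Gam v in simp)+
    ultimately have "r k (S *\<^sub>v v) = r (Suc k) v + w \<bullet> (b ^\<^sub>m k *\<^sub>v (s *\<^sub>v (Gam *\<^sub>v v)))"
      unfolding r_def using w by (simp add: scalar_prod_add_distrib[of w d] del: pow_mat.simps)
    then show ?thesis using wbs[OF k, of "Gam *\<^sub>v v"] Gam v by simp
  qed
  have rpow: "r k v = r 0 (S ^\<^sub>m k *\<^sub>v v)" if "k < d" "v \<in> carrier_vec q" for k v
    using that
  proof (induction k arbitrary: v)
    case 0
    then show ?case using S by simp
  next
    case (Suc k)
    have "r (Suc k) v = r k (S *\<^sub>v v)" using rS[of k v] Suc.prems by auto
    also have "\<dots> = r 0 (S ^\<^sub>m k *\<^sub>v (S *\<^sub>v v))" using Suc S by simp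
    also have "S ^\<^sub>m k *\<^sub>v (S *\<^sub>v v) = S ^\<^sub>m Suc k *\<^sub>v v"
      using assoc_mult_mat_vec[OF Sk[of k] S Suc.prems(2)] by simp
    finally show ?case .
  qed
  have "(Gam *\<^sub>v v) $ 0 = 0" if v: "v \<in> carrier_vec q" for v
  proof -
    have "r 0 (S ^\<^sub>m d *\<^sub>v v) = r (d - 1) (S *\<^sub>v v)"
    proof -
      have "S ^\<^sub>m d *\<^sub>v v = S ^\<^sub>m (d - 1) *\<^sub>v (S *\<^sub>v v)"
        using assoc_mult_mat_vec[OF Sk[of "d - 1"] S v] d by (cases d) simp_all
      then show ?thesis using rpow[of "d - 1" "S *\<^sub>v v"] d S v by simp
    qed
    also have "\<dots> = r d v + (Gam *\<^sub>v v) $ 0" using rS[of "d - 1" v] d v by simp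
    finally have rd: "r 0 (S ^\<^sub>m d *\<^sub>v v) = r d v + (Gam *\<^sub>v v) $ 0" .
    have split: "(\<Sum>k\<le>d. h k) = (\<Sum>k<d. h k) + h d" for h :: "nat \<Rightarrow> real"
      by (simp add: lessThan_Suc_atMost[symmetric])
    have "(\<Sum>k\<le>d. coeff ?f k * r 0 (S ^\<^sub>m k *\<^sub>v v)) = (\<Sum>k\<le>d. coeff ?f k * r k v) + (Gam *\<^sub>v v) $ 0"
      unfolding split using rd rpow[OF _ v] deg by simp
    moreover have "(\<Sum>k\<le>d. coeff ?f k * r k v) = 0"
      unfolding r_def by (rule annihilated_bilinear[OF b w _ cayley_hamilton[OF b]]) (use Z v in simp_all)
    moreover have "(\<Sum>k\<le>d. coeff ?f k * r 0 (S ^\<^sub>m k *\<^sub>v v)) = 0"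
    proof -
      have "r 0 x = (Z\<^sup>T *\<^sub>v w) \<bullet> x" if x: "x \<in> carrier_vec q" for x
        unfolding r_def using transpose_vec_mult_scalar[OF Z x w] b Z x by simp
      then have "r 0 (S ^\<^sub>m k *\<^sub>v v) = (Z\<^sup>T *\<^sub>v w) \<bullet> (S ^\<^sub>m k *\<^sub>v v)" for k
        using mult_mat_vec_carrier[OF Sk v] by blast
      then show ?thesis using annihilated_bilinear[OF S _ v annS, of "Z\<^sup>T *\<^sub>v w"] Z w by simp
    qed
    ultimately show ?thesis by simp
  qed
  then have "Gam $$ (0, j) = 0" if "j < q" for j
    using that Gam unit_vec_carrier[of q j] by (metis carrier_matD index_mult_mat_vec index_row(1)
        less_one row_carrier_vec scalar_prod_right_unit)
  then show ?thesis using Gam by (intro eq_matI) auto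
qed

text \<open>Write \<open>f = (x - \<mu>) g\<close> over the complex numbers. If \<open>\<mu>\<close> were no eigenvalue, \<open>S - \<mu>\<close> would be
injective and \<open>(S - \<mu>) g(S) = 0\<close> would force \<open>g(S) = 0\<close>. As \<open>g\<close> is monic and \<open>S\<close> is real, the real part of
\<open>g\<close> would be a nonzero real polynomial that annihilates \<open>S\<close> and has smaller degree than \<open>f\<close>.\<close>

lemma min_poly_root_eigenvalue:
  assumes S: "S \<in> carrier_mat q q" and mp: "is_min_poly S f" and root: "poly (map_poly complex_of_real f) \<mu> = 0"
  shows "eigenvalue (cmat S) \<mu>"
proof (rule ccontr)
  assume no: "\<not> eigenvalue (cmat S) \<mu>"
  let ?F = "map_poly complex_of_real f" and ?S = "cmat S"
  have cS: "?S \<in> carrier_mat q q" using S by simp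
  obtain g where g: "?F = [:- \<mu>, 1:] * g" using root by (metis dvdE poly_eq_0_iff_dvd)
  have lc: "lead_coeff f = 1" and fS: "poly_mat f S = 0\<^sub>m q q"
    and min: "\<And>h. h \<noteq> 0 \<Longrightarrow> poly_mat h S = 0\<^sub>m q q \<Longrightarrow> degree f \<le> degree h"
    using mp S unfolding is_min_poly_def by auto
  have F0: "?F \<noteq> 0" using lc by auto
  then have g0: "g \<noteq> 0" using g by auto
  have dF: "degree ?F = degree f" by (simp add: degree_map_poly)
  have degg: "degree f = Suc (degree g)"
  proof -
    have "degree ?F = degree [:- \<mu>, 1:] + degree g"
      unfolding g by (rule degree_mult_eq) (use g0 in auto)
    then show ?thesis unfolding dF by simp
  qed
  have lcg: "lead_coeff g = 1"
  proof -
    have "lead_coeff ?F = lead_coeff [:- \<mu>, 1:] * lead_coeff g" unfolding g by (rule lead_coeff_mult)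
    then show ?thesis using lc dF by (simp add: coeff_map_poly)
  qed
  have Sk: "?S ^\<^sub>m k \<in> carrier_mat q q" for k using cS by simp
  let ?d = "degree f"
  define W where "W = mat q q (\<lambda>(i, j). \<Sum>k\<le>?d. coeff g k * (?S ^\<^sub>m k) $$ (i, j))"
  have W: "W \<in> carrier_mat q q" unfolding W_def by simp
  have SW: "(?S * W) $$ (i, j) = \<mu> * W $$ (i, j)" if ij: "i < q" "j < q" for i j
  proof -
    have "(?S * W) $$ (i, j) = (\<Sum>l<q. ?S $$ (i, l) * W $$ (l, j))"
      using cS W ij by (intro index_mult_sum) auto
    also have "\<dots> = (\<Sum>l<q. \<Sum>k\<le>?d. coeff g k * (?S $$ (i, l) * (?S ^\<^sub>m k) $$ (l, j)))"
      using ij unfolding W_def by (simp add: sum_distrib_left ac_simps)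
    also have "\<dots> = (\<Sum>k\<le>?d. coeff g k * (\<Sum>l<q. ?S $$ (i, l) * (?S ^\<^sub>m k) $$ (l, j)))"
      by (subst sum.swap) (simp add: sum_distrib_left)
    also have "\<dots> = (\<Sum>k\<le>?d. coeff g k * (?S ^\<^sub>m Suc k) $$ (i, j))"
    proof (intro sum.cong refl arg_cong2[of _ _ _ _ "(*)"])
      fix k
      show "(\<Sum>l<q. ?S $$ (i, l) * (?S ^\<^sub>m k) $$ (l, j)) = (?S ^\<^sub>m Suc k) $$ (i, j)"
        unfolding pow_mat_Suc_left[OF cS] using cS Sk[of k] ij by (intro index_mult_sum[symmetric]) auto
    qed
    also have "\<dots> = (\<Sum>k\<le>?d. (coeff ?F k + \<mu> * coeff g k) * (?S ^\<^sub>m k) $$ (i, j))"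
    proof -
      have Fk: "coeff ?F k + \<mu> * coeff g k = (case k of 0 \<Rightarrow> 0 | Suc l \<Rightarrow> coeff g l)" for k
        unfolding g by (cases k) simp_all
      have "coeff g ?d = 0" using degg by (intro coeff_eq_0) simp
      then have "(\<Sum>k\<le>?d. coeff g k * (?S ^\<^sub>m Suc k) $$ (i, j)) = (\<Sum>k<?d. coeff g k * (?S ^\<^sub>m Suc k) $$ (i, j))"
        by (simp add: lessThan_Suc_atMost[symmetric])
      also have "\<dots> = (\<Sum>k\<le>?d. (case k of 0 \<Rightarrow> 0 | Suc l \<Rightarrow> coeff g l) * (?S ^\<^sub>m k) $$ (i, j))"
        unfolding lessThan_Suc_atMost[symmetric] sum.lessThan_Suc_shift by simp
      finally show ?thesis unfolding Fk .
    qed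
    also have "\<dots> = (\<Sum>k\<le>?d. coeff ?F k * (?S ^\<^sub>m k) $$ (i, j)) + \<mu> * W $$ (i, j)"
      unfolding W_def using ij by (simp add: algebra_simps sum.distrib sum_distrib_left)
    also have "(\<Sum>k\<le>?d. coeff ?F k * (?S ^\<^sub>m k) $$ (i, j)) = of_real (poly_mat f S $$ (i, j))"
    proof -
      have "(?S ^\<^sub>m k) $$ (i, j) = of_real ((S ^\<^sub>m k) $$ (i, j))" for k
        unfolding of_real_hom.mat_hom_pow[OF S, symmetric] using ij S by simp
      then show ?thesis unfolding poly_mat_def using ij S by (simp add: coeff_map_poly)
    qed
    finally show ?thesis unfolding fS using ij by simp
  qed
  have W0: "W $$ (i, j) = 0" if ij: "i < q" "j < q" for i j
  proof -
    have "?S *\<^sub>v col W j = \<mu> \<cdot>\<^sub>v col W j"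
      using SW[OF _ ij(2)] cS W ij by (intro eq_vecI) auto
    then have "col W j = 0\<^sub>v q" using no eigenvalue_iff[OF cS, of \<mu>] W ij(2) by (metis col_carrier_vec)
    then show ?thesis using W ij by (metis index_col index_zero_vec(1) carrier_matD)
  qed
  define h where "h = map_poly Re g"
  have ch: "coeff h k = Re (coeff g k)" for k unfolding h_def by (simp add: coeff_map_poly)
  have "h \<noteq> 0" using ch[of "degree g"] lcg by auto
  have dh: "degree h \<le> degree g" by (rule degree_le) (simp add: ch coeff_eq_0)
  have "poly_mat h S = 0\<^sub>m q q"
  proof (rule eq_matI)
    fix i j assume "i < dim_row (0\<^sub>m q q :: real mat)" "j < dim_col (0\<^sub>m q q :: real mat)"
    then have ij: "i < q" "j < q" by auto
    have Sr: "(?S ^\<^sub>m k) $$ (i, j) = of_real ((S ^\<^sub>m k) $$ (i, j))" for k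
      unfolding of_real_hom.mat_hom_pow[OF S, symmetric] using ij S by simp
    have "poly_mat h S $$ (i, j) = (\<Sum>k\<le>degree h. coeff h k * (S ^\<^sub>m k) $$ (i, j))"
      unfolding poly_mat_def using ij S by simp
    also have "\<dots> = (\<Sum>k\<le>?d. coeff h k * (S ^\<^sub>m k) $$ (i, j))"
      using dh degg by (intro sum.mono_neutral_left) (auto simp: coeff_eq_0)
    also have "\<dots> = Re (W $$ (i, j))" unfolding W_def using ij Sr by (simp add: ch)
    finally show "poly_mat h S $$ (i, j) = 0\<^sub>m q q $$ (i, j)" using W0 ij by simp
  qed (use S in \<open>auto simp: poly_mat_def\<close>)
  from min[OF \<open>h \<noteq> 0\<close> this] show False using dh degg by simp
qed

section \<open>The internal model\<close>

lemma sum_lessThan_mult: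
  fixes h :: "nat \<Rightarrow> 'a::comm_monoid_add"
  shows "(\<Sum>l<a * n. h l) = (\<Sum>i<a. \<Sum>k<n. h (i * n + k))"
proof (induction a)
  case (Suc a)
  have "(\<Sum>l<b + c. h l) = (\<Sum>l<b. h l) + (\<Sum>k<c. h (b + k))" for b c
    by (induction c) (simp_all add: add.assoc)
  from this[of "a * n" n] show ?case using Suc by (simp add: add.commute)
qed simp

lemma mult_add_less: "i < (a::nat) \<Longrightarrow> k < n \<Longrightarrow> i * n + k < a * n"
  by (metis add.commute div_less_iff_less_mult div_mult_self3 div_less add_0 gr_implies_not0 not_gr_zero)

lemma block_index_cases:
  assumes "l < a * (n::nat)"
  obtains i k where "i < a" "k < n" "l = i * n + k"
proof -
  have "0 < n" using assms by (cases n) auto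
  then show ?thesis using that[of "l div n" "l mod n"] assms by (simp add: less_mult_imp_div_less)
qed

lemma index_kron_id:
  assumes "X \<in> carrier_mat r c" "a < p" "a' < p" "i < r" "j < c"
  shows "(1\<^sub>m p \<otimes>\<^sub>k X) $$ (a * r + i, a' * c + j) = (if a = a' then X $$ (i, j) else (0::'a::semiring_1))"
  using assms mult_add_less[of a p i r] mult_add_less[of a' p j c] unfolding kron_def by auto

lemma kron_id_carrier: "X \<in> carrier_mat r c \<Longrightarrow> 1\<^sub>m p \<otimes>\<^sub>k X \<in> carrier_mat (p * r) (p * c)"
  unfolding kron_def by auto

text \<open>The segment of length \<open>r\<close> of a stacked vector that belongs to copy \<open>a\<close>; the matrix \<open>I \<otimes> X\<close> acts on
each such segment by \<open>X\<close>.\<close>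

definition block :: "nat \<Rightarrow> nat \<Rightarrow> 'a vec \<Rightarrow> 'a vec" where
  "block r a v = vec r (\<lambda>i. v $ (a * r + i))"

lemma block_carrier: "block r a v \<in> carrier_vec r"
  unfolding block_def by simp

lemma block_kron_id:
  fixes X :: "'a::comm_semiring_1 mat"
  assumes X: "X \<in> carrier_mat r c" and v: "v \<in> carrier_vec (p * c)" and a: "a < p"
  shows "block r a ((1\<^sub>m p \<otimes>\<^sub>k X) *\<^sub>v v) = X *\<^sub>v block c a v"
proof (rule eq_vecI)
  fix i assume "i < dim_vec (X *\<^sub>v block c a v)"
  then have i: "i < r" using X by simp
  note K = kron_id_carrier[OF X, of p]
  have "block r a ((1\<^sub>m p \<otimes>\<^sub>k X) *\<^sub>v v) $ i = (\<Sum>l<p * c. (1\<^sub>m p \<otimes>\<^sub>k X) $$ (a * r + i, l) * v $ l)"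
    using i a K v mult_add_less[OF a i] unfolding block_def by (simp add: index_mult_vec_sum[of _ _ "p * c"] del: index_mult_mat_vec)
  also have "\<dots> = (\<Sum>a'<p. \<Sum>j<c. if a = a' then X $$ (i, j) * v $ (a' * c + j) else 0)"
    unfolding sum_lessThan_mult
    by (intro sum.cong refl) (auto simp: index_kron_id[OF X a _ i])
  also have "\<dots> = (\<Sum>a'<p. if a = a' then (\<Sum>j<c. X $$ (i, j) * v $ (a * c + j)) else 0)"
    by (intro sum.cong refl) auto
  also have "\<dots> = (\<Sum>j<c. X $$ (i, j) * v $ (a * c + j))" using a by (simp add: sum.delta)
  also have "\<dots> = (X *\<^sub>v block c a v) $ i"
    using X i by (simp add: index_mult_vec_sum[of _ _ c] block_def del: index_mult_mat_vec)
  finally show "block r a ((1\<^sub>m p \<otimes>\<^sub>k X) *\<^sub>v v) $ i = (X *\<^sub>v block c a v) $ i" .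
qed (use X in \<open>simp add: block_def\<close>)

lemma block_zeroI:
  assumes v: "v \<in> carrier_vec (p * r)" and "\<And>a. a < p \<Longrightarrow> block r a v = 0\<^sub>v r"
  shows "v = 0\<^sub>v (p * r)"
proof (rule eq_vecI)
  fix l assume "l < dim_vec (0\<^sub>v (p * r) :: 'a vec)"
  then obtain a i where l: "a < p" "i < r" "l = a * r + i" and lt: "l < p * r" by (auto elim: block_index_cases)
  have "block r a v $ i = 0" using assms(2) l by simp
  then show "v $ l = 0\<^sub>v (p * r) $ l" using l lt unfolding block_def by simp
qed (use v in simp)

lemma block_smult: "a < p \<Longrightarrow> v \<in> carrier_vec (p * r) \<Longrightarrow> block r a (c \<cdot>\<^sub>v v) = c \<cdot>\<^sub>v block r a v"
  unfolding block_def using mult_add_less[of a p _ r] by (intro eq_vecI) auto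

lemma block_zero: "a < p \<Longrightarrow> block r a (0\<^sub>v (p * r)) = 0\<^sub>v r"
  unfolding block_def using mult_add_less[of a p _ r] by (intro eq_vecI) auto

text \<open>In Kronecker form the internal model can be analysed one copy at a time.\<close>

lemma diag_block_mat_replicate:
  fixes X :: "'a::semiring_1 mat"
  assumes X: "X \<in> carrier_mat r c"
  shows "diag_block_mat (replicate p X) = 1\<^sub>m p \<otimes>\<^sub>k X"
proof (induction p)
  case 0
  show ?case by (rule eq_matI) (auto simp: kron_def)
next
  case (Suc p)
  let ?K = "1\<^sub>m p \<otimes>\<^sub>k X"
  have K: "?K \<in> carrier_mat (p * r) (p * c)" by (rule kron_id_carrier[OF X])
  have K': "1\<^sub>m (Suc p) \<otimes>\<^sub>k X \<in> carrier_mat (Suc p * r) (Suc p * c)" by (rule kron_id_carrier[OF X])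
  have "diag_block_mat (replicate (Suc p) X) = four_block_mat X (0\<^sub>m r (p * c)) (0\<^sub>m (p * r) c) ?K"
    using Suc X K by (simp add: Let_def)
  also have "\<dots> = 1\<^sub>m (Suc p) \<otimes>\<^sub>k X"
  proof (rule eq_matI)
    fix l l' assume "l < dim_row (1\<^sub>m (Suc p) \<otimes>\<^sub>k X)" "l' < dim_col (1\<^sub>m (Suc p) \<otimes>\<^sub>k X)"
    then have "l < Suc p * r" "l' < Suc p * c" using K' by auto
    then obtain a i a' j where l: "a < Suc p" "i < r" "l = a * r + i" "a' < Suc p" "j < c" "l' = a' * c + j"
      by (metis block_index_cases)
    have r: "(1\<^sub>m (Suc p) \<otimes>\<^sub>k X) $$ (l, l') = (if a = a' then X $$ (i, j) else 0)"
      unfolding l(3,6) by (rule index_kron_id[OF X l(1,4,2,5)])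
    have lt: "l < r + p * r" "l' < c + p * c" using \<open>l < Suc p * r\<close> \<open>l' < Suc p * c\<close> by auto
    show "four_block_mat X (0\<^sub>m r (p * c)) (0\<^sub>m (p * r) c) ?K $$ (l, l') = (1\<^sub>m (Suc p) \<otimes>\<^sub>k X) $$ (l, l')"
    proof (cases a)
      case 0
      then show ?thesis unfolding r using lt l X K by (cases a') auto
    next
      case (Suc b)
      then have lr: "\<not> l < r" "l - r = b * r + i" "b < p" using l by auto
      show ?thesis
      proof (cases a')
        case 0
        then show ?thesis unfolding r using lt l lr X K Suc by auto
      next
        case (Suc b')
        then have lc: "\<not> l' < c" "l' - c = b' * c + j" "b' < p" using l by auto
        have "four_block_mat X (0\<^sub>m r (p * c)) (0\<^sub>m (p * r) c) ?K $$ (l, l') = ?K $$ (b * r + i, b' * c + j)"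
          using lt lr lc X K by simp
        then show ?thesis unfolding r index_kron_id[OF X lr(3) lc(3) l(2,5)] using Suc \<open>a = Suc b\<close> by simp
      qed
    qed
  qed (use X K K' in auto)
  finally show ?case .
qed

lemma cmat_kron_id_transpose:
  assumes X: "X \<in> carrier_mat r c"
  shows "cmat (1\<^sub>m p \<otimes>\<^sub>k X)\<^sup>T = 1\<^sub>m p \<otimes>\<^sub>k cmat X\<^sup>T"
    and "cmat (1\<^sub>m p \<otimes>\<^sub>k X) = 1\<^sub>m p \<otimes>\<^sub>k cmat X"
proof -
  have XT: "cmat X\<^sup>T \<in> carrier_mat c r" "cmat X \<in> carrier_mat r c" using X by auto
  note K = kron_id_carrier[OF X, of p] kron_id_carrier[OF XT(1), of p] kron_id_carrier[OF XT(2), of p]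
  show "cmat (1\<^sub>m p \<otimes>\<^sub>k X)\<^sup>T = 1\<^sub>m p \<otimes>\<^sub>k cmat X\<^sup>T"
  proof (rule eq_matI)
    fix l l' assume "l < dim_row (1\<^sub>m p \<otimes>\<^sub>k cmat X\<^sup>T)" "l' < dim_col (1\<^sub>m p \<otimes>\<^sub>k cmat X\<^sup>T)"
    then have lt: "l < p * c" "l' < p * r" using K by auto
    then obtain a i a' j where l: "a < p" "i < c" "l = a * c + i" "a' < p" "j < r" "l' = a' * r + j"
      by (metis block_index_cases)
    have "cmat (1\<^sub>m p \<otimes>\<^sub>k X)\<^sup>T $$ (l, l') = of_real ((1\<^sub>m p \<otimes>\<^sub>k X) $$ (l', l))" using K lt by simp
    then show "cmat (1\<^sub>m p \<otimes>\<^sub>k X)\<^sup>T $$ (l, l') = (1\<^sub>m p \<otimes>\<^sub>k cmat X\<^sup>T) $$ (l, l')"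
      unfolding l(3,6) index_kron_id[OF X l(4,1,5,2)] index_kron_id[OF XT(1) l(1,4,2,5)] using X l by auto
  qed (use K in auto)
  show "cmat (1\<^sub>m p \<otimes>\<^sub>k X) = 1\<^sub>m p \<otimes>\<^sub>k cmat X"
  proof (rule eq_matI)
    fix l l' assume "l < dim_row (1\<^sub>m p \<otimes>\<^sub>k cmat X)" "l' < dim_col (1\<^sub>m p \<otimes>\<^sub>k cmat X)"
    then have lt: "l < p * r" "l' < p * c" using K by auto
    then obtain a i a' j where l: "a < p" "i < r" "l = a * r + i" "a' < p" "j < c" "l' = a' * c + j"
      by (metis block_index_cases)
    have "cmat (1\<^sub>m p \<otimes>\<^sub>k X) $$ (l, l') = of_real ((1\<^sub>m p \<otimes>\<^sub>k X) $$ (l, l'))" using K lt by simp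
    then show "cmat (1\<^sub>m p \<otimes>\<^sub>k X) $$ (l, l') = (1\<^sub>m p \<otimes>\<^sub>k cmat X) $$ (l, l')"
      unfolding l(3,6) index_kron_id[OF X l(1,4,2,5)] index_kron_id[OF XT(2) l(1,4,2,5)] using X l by auto
  qed (use K in auto)
qed

lemma internal_model_dims:
  assumes "min_internal_model S p G1 G2"
  obtains d where "G1 \<in> carrier_mat (p * d) (p * d)" "G2 \<in> carrier_mat (p * d) p"
  using assms unfolding min_internal_model_def
  by (metis diag_block_mat_replicate kron_id_carrier mult.right_neutral)

text \<open>An eigenvector of \<open>G1\<close> has a nonzero segment, which is an eigenvector of a single copy; its
eigenvalue is a root of the minimal polynomial of \<open>S\<close>.\<close>

lemma internal_model_eigenvalue:
  assumes im: "min_internal_model S p G1 G2" and S: "S \<in> carrier_mat q q"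
    and ev: "eigenvalue (cmat G1) \<mu>"
  shows "eigenvalue (cmat S) \<mu>"
proof -
  obtain d b s where b: "b \<in> carrier_mat d d" and mp: "is_min_poly S (char_poly b)"
    and G1: "G1 = 1\<^sub>m p \<otimes>\<^sub>k b"
    using im diag_block_mat_replicate unfolding min_internal_model_def by metis
  have cb: "cmat b \<in> carrier_mat d d" using b by simp
  have cG: "cmat G1 = 1\<^sub>m p \<otimes>\<^sub>k cmat b" unfolding G1 by (rule cmat_kron_id_transpose(2)[OF b])
  have "cmat G1 \<in> carrier_mat (p * d) (p * d)" unfolding cG by (rule kron_id_carrier[OF cb])
  then obtain v where v: "v \<in> carrier_vec (p * d)" "v \<noteq> 0\<^sub>v (p * d)" "cmat G1 *\<^sub>v v = \<mu> \<cdot>\<^sub>v v"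
    using ev eigenvalue_iff by blast
  obtain a where a: "a < p" "block d a v \<noteq> 0\<^sub>v d" using block_zeroI[OF v(1)] v(2) by blast
  have "cmat b *\<^sub>v block d a v = \<mu> \<cdot>\<^sub>v block d a v"
    using block_kron_id[OF cb v(1) a(1)] v(3) block_smult[OF a(1) v(1)] unfolding cG by simp
  then have "eigenvalue (cmat b) \<mu>" using a(2) block_carrier eigenvalue_iff[OF cb] by blast
  then have "poly (map_poly of_real (char_poly b)) \<mu> = 0"
    using eigenvalue_root_char_poly[OF cb] of_real_hom.char_poly_hom[OF b, where 'a = complex] by simp
  then show ?thesis by (rule min_poly_root_eigenvalue[OF S mp])
qed

lemma internal_model_pbh:
  assumes im: "min_internal_model S p G1 G2" and G1c: "G1 \<in> carrier_mat r r"
    and w: "w \<in> carrier_vec r" and ev: "cmat G1\<^sup>T *\<^sub>v w = \<mu> \<cdot>\<^sub>v w" and null: "cmat G2\<^sup>T *\<^sub>v w = 0\<^sub>v p"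
  shows "w = 0\<^sub>v r"
proof -
  obtain d b s where b: "b \<in> carrier_mat d d" and s: "s \<in> carrier_mat d 1" and ctrl: "controllable b s"
    and G1: "G1 = 1\<^sub>m p \<otimes>\<^sub>k b" and G2: "G2 = 1\<^sub>m p \<otimes>\<^sub>k s"
    using im diag_block_mat_replicate unfolding min_internal_model_def by metis
  have r: "r = p * d" using G1c kron_id_carrier[OF b, of p] unfolding G1 by auto
  have bT: "cmat b\<^sup>T \<in> carrier_mat d d" and sT: "cmat s\<^sup>T \<in> carrier_mat 1 d" using b s by auto
  note w' = w[unfolded r]
  have "block d a w = 0\<^sub>v d" if a: "a < p" for a
  proof (rule controllable_pbh[OF b s ctrl block_carrier])
    show "cmat b\<^sup>T *\<^sub>v block d a w = \<mu> \<cdot>\<^sub>v block d a w"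
      using block_kron_id[OF bT w' a] ev block_smult[OF a w'] unfolding G1 cmat_kron_id_transpose(1)[OF b] by simp
    have "cmat s\<^sup>T *\<^sub>v block d a w = block 1 a ((1\<^sub>m p \<otimes>\<^sub>k cmat s\<^sup>T) *\<^sub>v w)"
      by (rule block_kron_id[OF sT w' a, symmetric])
    also have "(1\<^sub>m p \<otimes>\<^sub>k cmat s\<^sup>T) *\<^sub>v w = 0\<^sub>v (p * 1)"
      using null unfolding G2 cmat_kron_id_transpose(1)[OF s] by simp
    also have "block 1 a (0\<^sub>v (p * 1)) = (0\<^sub>v 1 :: complex vec)" by (rule block_zero[OF a])
    finally show "cmat s\<^sup>T *\<^sub>v block d a w = 0\<^sub>v 1" .
  qed
  then show ?thesis unfolding r by (rule block_zeroI[OF w'])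
qed

text \<open>The block of rows belonging to one copy satisfies the Sylvester identity of that copy, driven by one
row of \<open>Gam\<close>.\<close>

lemma internal_model_regulates:
  fixes S :: "real mat"
  assumes im: "min_internal_model S p G1 G2" and S: "S \<in> carrier_mat q q" and q: "0 < q"
    and G1c: "G1 \<in> carrier_mat r r"
    and Z: "Z \<in> carrier_mat r q" and Gam: "Gam \<in> carrier_mat p q"
    and syl: "Z * S = G1 * Z + G2 * Gam"
  shows "Gam = 0\<^sub>m p q"
proof -
  obtain d b s where b: "b \<in> carrier_mat d d" and s: "s \<in> carrier_mat d 1" and ctrl: "controllable b s"
    and mp: "is_min_poly S (char_poly b)" and G1: "G1 = 1\<^sub>m p \<otimes>\<^sub>k b" and G2: "G2 = 1\<^sub>m p \<otimes>\<^sub>k s"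
    using im diag_block_mat_replicate unfolding min_internal_model_def by metis
  have r: "r = p * d" using G1c kron_id_carrier[OF b, of p] unfolding G1 by auto
  have ann: "poly_mat (char_poly b) S = 0\<^sub>m q q" using mp S unfolding is_min_poly_def by simp
  note Z' = Z[unfolded r]
  have G1': "G1 \<in> carrier_mat (p * d) (p * d)" and G2': "G2 \<in> carrier_mat (p * d) p"
    using kron_id_carrier[OF b, of p] kron_id_carrier[OF s, of p] unfolding G1 G2 by auto
  have row: "Gam $$ (a, j) = 0" if a: "a < p" and j: "j < q" for a j
  proof -
    define Za where "Za = mat d q (\<lambda>(i, j). Z $$ (a * d + i, j))"
    define Ga where "Ga = mat 1 q (\<lambda>(i, j). Gam $$ (a, j))"
    have Za: "Za \<in> carrier_mat d q" and Ga: "Ga \<in> carrier_mat 1 q" unfolding Za_def Ga_def by auto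
    have "Za * S = b * Za + s * Ga"
    proof (rule eq_matI)
      fix i j assume "i < dim_row (b * Za + s * Ga)" "j < dim_col (b * Za + s * Ga)"
      then have ij: "i < d" "j < q" using s Ga by auto
      have lt: "a * d + i < p * d" by (rule mult_add_less[OF a ij(1)])
      have cZ: "col Z j \<in> carrier_vec (p * d)" and cG: "col Gam j \<in> carrier_vec (p * 1)" using Z' Gam ij by auto
      have "(Za * S) $$ (i, j) = (Z * S) $$ (a * d + i, j)"
        using Za Z' S ij lt by (simp add: index_mult_sum[of _ _ _ _ q] Za_def del: index_mult_mat(1))
      also have "\<dots> = (G1 * Z) $$ (a * d + i, j) + (G2 * Gam) $$ (a * d + i, j)"
        unfolding syl using G1' G2' Z' Gam ij lt by simp
      also have "(G1 * Z) $$ (a * d + i, j) = block d a (G1 *\<^sub>v col Z j) $ i"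
        using G1' Z' ij lt unfolding block_def by simp
      also have "block d a (G1 *\<^sub>v col Z j) = b *\<^sub>v block d a (col Z j)"
        unfolding G1 by (rule block_kron_id[OF b cZ a])
      also have "block d a (col Z j) = col Za j"
        using Z' Za ij mult_add_less[OF a, of _ d] unfolding block_def Za_def by (intro eq_vecI) auto
      also have "(G2 * Gam) $$ (a * d + i, j) = block d a (G2 *\<^sub>v col Gam j) $ i"
        using G2' Gam ij lt unfolding block_def by simp
      also have "block d a (G2 *\<^sub>v col Gam j) = s *\<^sub>v block 1 a (col Gam j)"
        unfolding G2 by (rule block_kron_id[OF s cG a])
      also have "block 1 a (col Gam j) = col Ga j"
        using Gam Ga ij a unfolding block_def Ga_def by (intro eq_vecI) auto
      finally show "(Za * S) $$ (i, j) = (b * Za + s * Ga) $$ (i, j)"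
        using b s Za Ga ij by simp
    qed (use b s Za Ga S in auto)
    from single_copy_regulates[OF b s ctrl S q ann Za Ga this]
    have "Ga $$ (0, j) = 0" using j by simp
    then show ?thesis unfolding Ga_def using j by simp
  qed
  show ?thesis using row Gam by (intro eq_matI) auto
qed

section \<open>Observer coordinates\<close>

text \<open>The coefficients of \<open>(s I - X) (\<Sum>\<^sub>k D\<^sub>k s\<^sup>k) = \<Lambda>(s) I\<close>. The defining property of \<open>D\<close> yields this identity
only where \<open>\<Lambda>(s) \<noteq> 0\<close>; multiplied by \<open>\<Lambda>\<close> it holds for every \<open>s\<close>, hence as an identity of polynomials, and
\<open>\<Lambda>\<close> can be cancelled. The sequence \<open>e\<close> continues \<open>D\<close> by zero, so that the case \<open>k = n\<close> states
\<open>D\<^sub>n\<^sub>-\<^sub>1 = I\<close>.\<close>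

lemma resolvent_recurrence:
  assumes X: "X \<in> carrier_mat n n" and D: "resolvent_coeffs X D" and ij: "i < n" "j < n"
  defines "e \<equiv> \<lambda>k i j. if k < n then D k $$ (i, j) else 0"
  shows "(if k = 0 then 0 else e (k - 1) i j) - (\<Sum>l<n. X $$ (i, l) * e k l j)
    = (if i = j then coeff (char_poly X) k else 0)"
proof -
  have Dk: "D k \<in> carrier_mat n n" if "k < n" for k
    using D X that unfolding resolvent_coeffs_def Let_def by auto
  let ?L = "char_poly (cmat X)"
  have LX: "?L = map_poly of_real (char_poly X)" using of_real_hom.char_poly_hom[OF X] by simp
  have "cmat X \<in> carrier_mat n n" using X by simp
  then have L0: "?L \<noteq> 0" using degree_monic_char_poly[of "cmat X" n] by auto
  define P where "P i j = (\<Sum>k<n. monom (complex_of_real (D k $$ (i, j))) k)" for i j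
  have cP: "coeff (P i j) k = of_real (e k i j)" for i j k
    unfolding P_def e_def by (simp add: coeff_sum sum.delta)
  have pP: "poly (P i j) s = (\<Sum>k<n. s ^ k * of_real (D k $$ (i, j)))" for i j s
    unfolding P_def by (simp add: poly_sum poly_monom mult.commute)
  define h where "h = [:0, 1:] * P i j - (\<Sum>l<n. [:of_real (X $$ (i, l)):] * P l j) - (if i = j then ?L else 0)"
  have "poly (h * ?L) s = 0" for s
  proof (cases "poly ?L s = 0")
    case False
    define Q where "Q = mat n n (\<lambda>(i, j). (\<Sum>k<n. s ^ k * cmat (D k) $$ (i, j)) / poly ?L s)"
    have Q: "Q \<in> carrier_mat n n" unfolding Q_def by simp
    have inv: "inverts_mat (s \<cdot>\<^sub>m 1\<^sub>m n - cmat X) Q"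
      using D X False unfolding resolvent_coeffs_def Let_def Q_def by auto
    have Qij: "Q $$ (l, j) = poly (P l j) s / poly ?L s" if "l < n" for l
    proof -
      have "cmat (D k) $$ (l, j) = of_real (D k $$ (l, j))" if "k < n" for k
        using Dk[OF that] \<open>l < n\<close> ij by simp
      then show ?thesis unfolding Q_def pP using that ij by simp
    qed
    have "((s \<cdot>\<^sub>m 1\<^sub>m n - cmat X) * Q) $$ (i, j) = 1\<^sub>m n $$ (i, j)"
      using inv X unfolding inverts_mat_def by simp
    then have "(\<Sum>l<n. (s \<cdot>\<^sub>m 1\<^sub>m n - cmat X) $$ (i, l) * Q $$ (l, j)) = (if i = j then 1 else 0)"
      using X Q ij by (simp add: index_mult_sum[of _ _ _ _ n] del: index_mult_mat(1))
    moreover have "(\<Sum>l<n. (s \<cdot>\<^sub>m 1\<^sub>m n - cmat X) $$ (i, l) * Q $$ (l, j)) =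
      (\<Sum>l<n. (if i = l then s * Q $$ (l, j) else 0) - of_real (X $$ (i, l)) * Q $$ (l, j))"
      using X ij by (intro sum.cong) (auto simp: algebra_simps)
    moreover have "\<dots> = s * Q $$ (i, j) - (\<Sum>l<n. of_real (X $$ (i, l)) * Q $$ (l, j))"
      using ij by (simp add: sum_subtractf sum.delta)
    moreover have "(\<Sum>l<n. of_real (X $$ (i, l)) * Q $$ (l, j)) = (\<Sum>l<n. of_real (X $$ (i, l)) * poly (P l j) s) / poly ?L s"
      unfolding sum_divide_distrib by (intro sum.cong) (auto simp: Qij)
    ultimately have "(s * poly (P i j) s - (\<Sum>l<n. of_real (X $$ (i, l)) * poly (P l j) s)) / poly ?L s = (if i = j then 1 else 0)"
      using Qij[OF ij(1)] by (simp add: diff_divide_distrib)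
    then have "s * poly (P i j) s - (\<Sum>l<n. of_real (X $$ (i, l)) * poly (P l j) s) = (if i = j then poly ?L s else 0)"
      using False by (simp add: divide_eq_eq split: if_splits)
    then have "poly h s = 0" unfolding h_def by (simp add: poly_sum)
    then show ?thesis by simp
  qed simp
  then have "h * ?L = 0" using poly_all_0_iff_0 by blast
  then have "h = 0" using L0 by simp
  then have "coeff h k = 0" by simp
  then have "complex_of_real ((if k = 0 then 0 else e (k - 1) i j) - (\<Sum>l<n. X $$ (i, l) * e k l j))
    = complex_of_real (if i = j then coeff (char_poly X) k else 0)"
    unfolding h_def LX by (cases k) (auto simp: cP coeff_sum coeff_map_poly)
  then show ?thesis by (simp only: of_real_eq_iff)
qed

lemma concat_uniform_nth:
  assumes "\<And>x. x \<in> set xs \<Longrightarrow> length (g x) = n" "a < length xs" "k < n"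
  shows "concat (map g xs) ! (a * n + k) = g (xs ! a) ! k"
  using assms
proof (induction xs arbitrary: a)
  case (Cons x xs)
  then show ?case by (cases a) (auto simp: nth_append)
qed simp

lemma length_concat_uniform:
  "(\<And>x. x \<in> set xs \<Longrightarrow> length (g x) = n) \<Longrightarrow> length (concat (map g xs)) = length xs * n"
  by (induction xs) auto

text \<open>The vector \<open>f\<^sub>a\<^sub>+\<^sub>1\<close> in the construction of \<open>M\<close>: the inputs of \<open>B\<close> come first, then those of \<open>L\<close>.\<close>

definition input_col :: "'a mat \<Rightarrow> 'a mat \<Rightarrow> nat \<Rightarrow> 'a vec" where
  "input_col B L a = (cols B @ cols L) ! a"

lemma M_mat_index:
  assumes B: "B \<in> carrier_mat n m" and L: "L \<in> carrier_mat n p"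
  shows M_mat_carrier: "M_mat D B L \<in> carrier_mat n ((m + p) * n)"
    and "r < n \<Longrightarrow> a < m + p \<Longrightarrow> k < n \<Longrightarrow> M_mat D B L $$ (r, a * n + k) = (D k *\<^sub>v input_col B L a) $ r"
proof -
  let ?g = "\<lambda>f. map (\<lambda>k. D k *\<^sub>v f) [0..<n]" and ?fs = "cols B @ cols L"
  have M: "M_mat D B L = mat_of_cols n (concat (map ?g ?fs))"
    using B unfolding M_mat_def Let_def by simp
  have fs: "length ?fs = m + p" using B L by simp
  have len: "length (concat (map ?g ?fs)) = (m + p) * n"
    using length_concat_uniform[of ?fs ?g n] fs by simp
  show "M_mat D B L \<in> carrier_mat n ((m + p) * n)" 
    unfolding M using mat_of_cols_carrier(1)[of n "concat (map ?g ?fs)"] unfolding len .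
  assume rak: "r < n" "a < m + p" "k < n"
  have "a * n + k < (m + p) * n" by (rule mult_add_less[OF rak(2,3)])
  then have "M_mat D B L $$ (r, a * n + k) = concat (map ?g ?fs) ! (a * n + k) $ r"
    unfolding M using rak len by (simp add: mat_of_cols_index del: map_append concat_append)
  also have "concat (map ?g ?fs) ! (a * n + k) = ?g (?fs ! a) ! k"
    using rak fs by (intro concat_uniform_nth) auto
  finally show "M_mat D B L $$ (r, a * n + k) = (D k *\<^sub>v input_col B L a) $ r"
    using rak unfolding input_col_def by simp
qed

lemma input_col_carrier:
  assumes "B \<in> carrier_mat n m" "L \<in> carrier_mat n p" "a < m + p"
  shows "input_col B L a \<in> carrier_vec n"
  using assms unfolding input_col_def by (auto simp: nth_append)

text \<open>These identities turn \<open>M \<zeta>\<close> into the state of a Luenberger observer. Column \<open>k\<close> of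
\<open>M\<^sub>i\<close> times the companion matrix is \<open>D\<^sub>k\<^sub>-\<^sub>1 f\<^sub>i - \<alpha>\<^sub>k D\<^sub>n\<^sub>-\<^sub>1 f\<^sub>i\<close>, which equals \<open>X D\<^sub>k f\<^sub>i\<close> by the recurrence; and
\<open>M\<^sub>i b = D\<^sub>n\<^sub>-\<^sub>1 f\<^sub>i = f\<^sub>i\<close>.\<close>

lemma observer_identities:
  fixes X B L :: "real mat"
  assumes n: "0 < n" and X: "X \<in> carrier_mat n n" and D: "resolvent_coeffs X D"
    and B: "B \<in> carrier_mat n m" and L: "L \<in> carrier_mat n p"
  shows "M_mat D B L * (1\<^sub>m (m + p) \<otimes>\<^sub>k companion (char_poly X)) = X * M_mat D B L"
    and "M_mat D B L * B_zeta n m p = B"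
    and "M_mat D B L * E_zeta n m p = L"
    and "B_zeta n m p \<in> carrier_mat ((m + p) * n) m"
    and "E_zeta n m p \<in> carrier_mat ((m + p) * n) p"
proof -
  let ?M = "M_mat D B L" and ?f = "input_col B L" and ?\<chi> = "char_poly X"
  let ?C = "companion ?\<chi>"
  have deg: "degree ?\<chi> = n" "coeff ?\<chi> n = 1" using degree_monic_char_poly[OF X] by auto
  have C: "?C \<in> carrier_mat n n" unfolding companion_def deg by simp
  have M: "?M \<in> carrier_mat n ((m + p) * n)" by (rule M_mat_carrier[OF B L])
  have Mi: "?M $$ (r, a * n + k) = (D k *\<^sub>v ?f a) $ r" if "r < n" "a < m + p" "k < n" for r a k
    using M_mat_index(2)[OF B L that] .
  have Dk: "D k \<in> carrier_mat n n" if "k < n" for k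
    using D X that unfolding resolvent_coeffs_def Let_def by auto
  have f: "?f a \<in> carrier_vec n" if "a < m + p" for a by (rule input_col_carrier[OF B L that])
  define e where "e k i j = (if k < n then D k $$ (i, j) else 0)" for k i j
  note rec = resolvent_recurrence[OF X D, folded e_def]
  have Df: "(D k *\<^sub>v ?f a) $ r = (\<Sum>j<n. e k r j * ?f a $ j)" if "r < n" "a < m + p" "k < n" for r a k
    using that Dk[of k] f[of a] unfolding e_def by (simp add: index_mult_vec_sum[of _ _ n] del: index_mult_mat_vec)
  have last: "(D (n - 1) *\<^sub>v ?f a) $ r = ?f a $ r" if r: "r < n" and a: "a < m + p" for r a
  proof -
    have "e (n - 1) r j = (if r = j then 1 else 0)" if "j < n" for j
      using rec[of r j n] r that n deg by (simp add: e_def)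
    then have "(\<Sum>j<n. e (n - 1) r j * ?f a $ j) = (\<Sum>j<n. if r = j then ?f a $ j else 0)"
      by (intro sum.cong) auto
    also have "\<dots> = ?f a $ r" using r by (simp add: sum.delta)
    finally show ?thesis using Df[OF r a, of "n - 1"] n by simp
  qed
  have XD: "(X *\<^sub>v (D k *\<^sub>v ?f a)) $ r = (if k = 0 then 0 else (D (k - 1) *\<^sub>v ?f a) $ r) - coeff ?\<chi> k * ?f a $ r"
    if r: "r < n" and a: "a < m + p" and k: "k < n" for r a k
  proof -
    have "(X *\<^sub>v (D k *\<^sub>v ?f a)) $ r = (\<Sum>l<n. X $$ (r, l) * (D k *\<^sub>v ?f a) $ l)"
      using X Dk[OF k] r by (intro index_mult_vec_sum) auto
    also have "\<dots> = (\<Sum>l<n. \<Sum>j<n. X $$ (r, l) * e k l j * ?f a $ j)"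
      by (intro sum.cong refl) (simp add: Df[OF _ a k] sum_distrib_left mult.assoc)
    also have "\<dots> = (\<Sum>j<n. (\<Sum>l<n. X $$ (r, l) * e k l j) * ?f a $ j)"
      by (subst sum.swap) (simp add: sum_distrib_right)
    also have "\<dots> = (\<Sum>j<n. ((if k = 0 then 0 else e (k - 1) r j) - (if r = j then coeff ?\<chi> k else 0)) * ?f a $ j)"
    proof (intro sum.cong refl)
      fix j assume "j \<in> {..<n}"
      then have "(\<Sum>l<n. X $$ (r, l) * e k l j) = (if k = 0 then 0 else e (k - 1) r j) - (if r = j then coeff ?\<chi> k else 0)"
        using rec[of r j k] r by simp
      then show "(\<Sum>l<n. X $$ (r, l) * e k l j) * ?f a $ j =
        ((if k = 0 then 0 else e (k - 1) r j) - (if r = j then coeff ?\<chi> k else 0)) * ?f a $ j" by simp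
    qed
    also have "\<dots> = (\<Sum>j<n. (if k = 0 then 0 else e (k - 1) r j) * ?f a $ j) - (\<Sum>j<n. if r = j then coeff ?\<chi> k * ?f a $ j else 0)"
      unfolding sum_subtractf[symmetric] by (intro sum.cong) (auto simp: algebra_simps)
    also have "(\<Sum>j<n. if r = j then coeff ?\<chi> k * ?f a $ j else 0) = coeff ?\<chi> k * ?f a $ r"
      using r by (simp add: sum.delta)
    also have "(\<Sum>j<n. (if k = 0 then 0 else e (k - 1) r j) * ?f a $ j) = (if k = 0 then 0 else (D (k - 1) *\<^sub>v ?f a) $ r)"
      using Df[OF r a, of "k - 1"] k by simp
    finally show ?thesis .
  qed
  note K = kron_id_carrier[OF C, of "m + p"]
  show "?M * (1\<^sub>m (m + p) \<otimes>\<^sub>k ?C) = X * ?M"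
  proof (rule eq_matI)
    fix r l assume "r < dim_row (X * ?M)" "l < dim_col (X * ?M)"
    then have r: "r < n" and lt: "l < (m + p) * n" using X M by auto
    obtain a k where ak: "a < m + p" "k < n" "l = a * n + k" using lt by (rule block_index_cases)
    have "(?M * (1\<^sub>m (m + p) \<otimes>\<^sub>k ?C)) $$ (r, l) = (\<Sum>l'<(m + p) * n. ?M $$ (r, l') * (1\<^sub>m (m + p) \<otimes>\<^sub>k ?C) $$ (l', l))"
      using M K r lt by (intro index_mult_sum) auto
    also have "\<dots> = (\<Sum>a'<m + p. \<Sum>k'<n. if a' = a then (D k' *\<^sub>v ?f a) $ r * ?C $$ (k', k) else 0)"
      unfolding sum_lessThan_mult
    proof (intro sum.cong refl)
      fix a' k' assume "a' \<in> {..<m + p}" "k' \<in> {..<n}"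
      then have a': "a' < m + p" and k': "k' < n" by auto
      show "?M $$ (r, a' * n + k') * (1\<^sub>m (m + p) \<otimes>\<^sub>k ?C) $$ (a' * n + k', l) =
        (if a' = a then (D k' *\<^sub>v ?f a) $ r * ?C $$ (k', k) else 0)"
        unfolding ak(3) Mi[OF r a' k'] index_kron_id[OF C a' ak(1) k' ak(2)] by simp
    qed
    also have "\<dots> = (\<Sum>a'<m + p. if a' = a then (\<Sum>k'<n. (D k' *\<^sub>v ?f a) $ r * ?C $$ (k', k)) else 0)"
      by (intro sum.cong refl) auto
    also have "\<dots> = (\<Sum>k'<n. (D k' *\<^sub>v ?f a) $ r * ?C $$ (k', k))" using ak(1) by (simp add: sum.delta)
    also have "\<dots> = (\<Sum>k'<n. (if k' = n - 1 then - coeff ?\<chi> k * ?f a $ r else 0) +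
        (if k' = k - 1 \<and> 0 < k then (D (k - 1) *\<^sub>v ?f a) $ r else 0))"
    proof (intro sum.cong refl)
      fix k' assume "k' \<in> {..<n}"
      then have k': "k' < n" by simp
      have "?C $$ (k', k) = (if k' = n - 1 then - coeff ?\<chi> k else if k = k' + 1 then 1 else 0)"
        unfolding companion_def deg using k' ak(2) by simp
      then show "(D k' *\<^sub>v ?f a) $ r * ?C $$ (k', k) = (if k' = n - 1 then - coeff ?\<chi> k * ?f a $ r else 0) +
        (if k' = k - 1 \<and> 0 < k then (D (k - 1) *\<^sub>v ?f a) $ r else 0)"
        using last[OF r ak(1)] ak(2) k' by (auto simp: mult.commute)
    qed
    also have "\<dots> = - coeff ?\<chi> k * ?f a $ r + (if k = 0 then 0 else (D (k - 1) *\<^sub>v ?f a) $ r)"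
      using n ak(2) by (cases "k = 0") (simp_all add: sum.distrib sum.delta)
    also have "\<dots> = (X *\<^sub>v (D k *\<^sub>v ?f a)) $ r" unfolding XD[OF r ak(1,2)] by simp
    also have "\<dots> = (X * ?M) $$ (r, l)"
    proof -
      have "col ?M l = D k *\<^sub>v ?f a"
        using M lt Mi[OF _ ak(1,2)] Dk[OF ak(2)] unfolding ak(3) by (intro eq_vecI) auto
      then show ?thesis using X M r lt by simp
    qed
    finally show "(?M * (1\<^sub>m (m + p) \<otimes>\<^sub>k ?C)) $$ (r, l) = (X * ?M) $$ (r, l)" .
  qed (use X M K in auto)
  have b: "b_col n \<in> carrier_mat n 1" unfolding b_col_def by simp
  have Kb: "1\<^sub>m k \<otimes>\<^sub>k b_col n \<in> carrier_mat (k * n) k" for k using kron_id_carrier[OF b, of k] by simp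
  have Kbi: "(1\<^sub>m k \<otimes>\<^sub>k b_col n) $$ (a * n + i, c) = (if a = c \<and> i = n - 1 then 1 else 0)"
    if "a < k" "i < n" "c < k" for k a i c
    using index_kron_id[OF b that(1,3,2), of 0] that by (auto simp: b_col_def)
  show Bz: "B_zeta n m p \<in> carrier_mat ((m + p) * n) m"
    using carrier_append_rows[OF Kb[of m], of "0\<^sub>m (n * p) m" "n * p"] unfolding B_zeta_def by (simp add: algebra_simps)
  show Ez: "E_zeta n m p \<in> carrier_mat ((m + p) * n) p"
    using carrier_append_rows[OF _ Kb[of p], of "0\<^sub>m (n * m) p" "n * m"] unfolding E_zeta_def by (simp add: algebra_simps)
  have Bzi: "B_zeta n m p $$ (a * n + i, c) = (if a = c \<and> i = n - 1 then 1 else 0)"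
    if "a < m + p" "i < n" "c < m" for a i c
  proof (cases "a < m")
    case True
    then have "a * n + i < m * n" using that by (intro mult_add_less)
    then show ?thesis using True that Kbi[of a m i c] Kb[of m] unfolding B_zeta_def append_rows_def by auto
  next
    case False
    then have "m * n \<le> a * n + i" by (simp add: trans_le_add1)
    moreover have "a * n + i < m * n + n * p" using mult_add_less[OF that(1,2)] by (simp add: algebra_simps)
    ultimately show ?thesis using False that Kb[of m] unfolding B_zeta_def append_rows_def by auto
  qed
  have Ezi: "E_zeta n m p $$ (a * n + i, c) = (if a = m + c \<and> i = n - 1 then 1 else 0)"
    if "a < m + p" "i < n" "c < p" for a i c
  proof (cases "a < m")
    case True
    then have "a * n + i < n * m" using mult_add_less[OF True that(2)] by (simp add: mult.commute)
    then show ?thesis using True that Kb[of p] unfolding E_zeta_def append_rows_def by auto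
  next
    case False
    define a' where "a' = a - m"
    have a': "a = m + a'" "a' < p" using False that unfolding a'_def by auto
    have "a' * n + i < p * n" using mult_add_less[OF a'(2) that(2)] .
    then have "E_zeta n m p $$ (a * n + i, c) = (1\<^sub>m p \<otimes>\<^sub>k b_col n) $$ (a' * n + i, c)"
      using that Kb[of p] unfolding E_zeta_def append_rows_def a'(1) by (simp add: algebra_simps)
    then show ?thesis unfolding Kbi[OF a'(2) that(2,3)] using a' by simp
  qed
  have pick: "(?M * Y) $$ (r, c) = ?f c' $ r"
    if Y: "Y \<in> carrier_mat ((m + p) * n) t" and c: "c < t" and r: "r < n" and c': "c' < m + p"
      and Yi: "\<And>a i. a < m + p \<Longrightarrow> i < n \<Longrightarrow> Y $$ (a * n + i, c) = (if a = c' \<and> i = n - 1 then 1 else 0)"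
    for Y t c c' r
  proof -
    have "(?M * Y) $$ (r, c) = (\<Sum>l<(m + p) * n. ?M $$ (r, l) * Y $$ (l, c))"
      using M Y r c by (intro index_mult_sum) auto
    also have "\<dots> = (\<Sum>a<m + p. \<Sum>i<n. if i = n - 1 then (if a = c' then (D (n - 1) *\<^sub>v ?f c') $ r else 0) else 0)"
      unfolding sum_lessThan_mult
      by (intro sum.cong refl) (auto simp: Yi Mi[OF r])
    also have "\<dots> = (D (n - 1) *\<^sub>v ?f c') $ r" using n c' by (simp add: sum.delta)
    finally show ?thesis using last[OF r c'] by simp
  qed
  show "?M * B_zeta n m p = B"
  proof (rule eq_matI)
    fix r c assume "r < dim_row B" "c < dim_col B"
    then have rc: "r < n" "c < m" using B by auto
    then show "(?M * B_zeta n m p) $$ (r, c) = B $$ (r, c)"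
      using pick[OF Bz rc(2,1), of c] Bzi B by (simp add: input_col_def nth_append)
  qed (use M Bz B in auto)
  show "?M * E_zeta n m p = L"
  proof (rule eq_matI)
    fix r c assume "r < dim_row L" "c < dim_col L"
    then have rc: "r < n" "c < p" using L by auto
    then show "(?M * E_zeta n m p) $$ (r, c) = L $$ (r, c)"
      using pick[OF Ez rc(2,1), of "m + c"] Ezi B L by (simp add: input_col_def nth_append)
  qed (use M Ez L in auto)
qed

section \<open>The plant with its internal model\<close>

lemma cmat_four_block:
  assumes "P \<in> carrier_mat a b" "Q \<in> carrier_mat a b'" "R \<in> carrier_mat a' b" "U \<in> carrier_mat a' b'"
  shows "cmat (four_block_mat P Q R U) = four_block_mat (cmat P) (cmat Q) (cmat R) (cmat U)"
  using assms by (intro eq_matI) auto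

lemma cmat_append_rows:
  assumes "X \<in> carrier_mat a c" "Y \<in> carrier_mat b c"
  shows "cmat (X @\<^sub>r Y) = cmat X @\<^sub>r cmat Y"
  using assms unfolding append_rows_def by (intro eq_matI) auto

lemma mult_mat_zero_vec:
  fixes X :: "'a::semiring_0 mat"
  assumes "X \<in> carrier_mat a b"
  shows "X *\<^sub>v 0\<^sub>v b = 0\<^sub>v a"
  using assms by (intro eq_vecI) auto

lemma zero_mat_mult_vec:
  fixes v :: "'a::semiring_0 vec"
  assumes "v \<in> carrier_vec b"
  shows "0\<^sub>m a b *\<^sub>v v = 0\<^sub>v a"
  using assms by (intro eq_vecI) auto

lemma add_minus_cancel_mat:
  fixes X Y :: "'a::ab_group_add mat"
  assumes "X \<in> carrier_mat a b" "Y \<in> carrier_mat a b"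
  shows "Y + (X - Y) = X"
  using assms by (intro eq_matI) auto

lemma add_minus_add_cancel_vec:
  fixes x y w :: "'a::ab_group_add vec"
  assumes "x \<in> carrier_vec a" "y \<in> carrier_vec a" "w \<in> carrier_vec a"
  shows "x + w - (y + w) = x - y"
  using assms by (intro eq_vecI) auto

lemma smult_append_vec: "c \<cdot>\<^sub>v (x @\<^sub>v z) = (c \<cdot>\<^sub>v x) @\<^sub>v (c \<cdot>\<^sub>v z)"
  by (intro eq_vecI) auto

lemma zero_append_vec: "0\<^sub>v a @\<^sub>v 0\<^sub>v b = 0\<^sub>v (a + b)"
  by (intro eq_vecI) auto

lemma append_vec_split:
  assumes "v \<in> carrier_vec (a + b)"
  obtains x z where "x \<in> carrier_vec a" "z \<in> carrier_vec b" "v = x @\<^sub>v z"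
  using vec_first_last_append[OF assms] by (metis vec_first_carrier vec_last_carrier)

lemma mat_eq_by_vec:
  fixes X Y :: "'a::semiring_1 mat"
  assumes X: "X \<in> carrier_mat r c" and Y: "Y \<in> carrier_mat r c"
    and eq: "\<And>v. v \<in> carrier_vec c \<Longrightarrow> X *\<^sub>v v = Y *\<^sub>v v"
  shows "X = Y"
proof (rule eq_matI)
  fix i j assume "i < dim_row Y" "j < dim_col Y"
  then have ij: "i < r" "j < c" using Y by auto
  have "(X *\<^sub>v unit_vec c j) $ i = (Y *\<^sub>v unit_vec c j) $ i" using eq by simp
  then show "X $$ (i, j) = Y $$ (i, j)" using X Y ij by simp
qed (use X Y in auto)

text \<open>Suppose \<open>w\<close> is an uncontrollable left eigenvector of \<open>(G1, T B)\<close>. Its eigenvalue is one of \<open>S\<close>, and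
transposing the Sylvester equation shows that \<open>(T\<^sup>T w, G2\<^sup>T w)\<close> is a left null vector of the matrix in the
rank condition at this eigenvalue. So \<open>G2\<^sup>T w = 0\<close>, which the internal model permits only for \<open>w = 0\<close>.\<close>

lemma augmented_pbh:
  fixes A B C G1 G2 S T K0 :: "real mat"
  assumes A: "A \<in> carrier_mat n n" and B: "B \<in> carrier_mat n m" and C: "C \<in> carrier_mat p n"
    and S: "S \<in> carrier_mat q q"
    and zeros: "\<And>\<mu>. eigenvalue (cmat S) \<mu> \<Longrightarrow>
      mat_rank (four_block_mat (cmat A - \<mu> \<cdot>\<^sub>m 1\<^sub>m n) (cmat B) (cmat C) (0\<^sub>m p m)) = n + p"
    and im: "min_internal_model S p G1 G2"
    and G1: "G1 \<in> carrier_mat r r" and G2: "G2 \<in> carrier_mat r p"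
    and K0: "K0 \<in> carrier_mat m n" and T: "T \<in> carrier_mat r n"
    and syl: "T * (A + B * K0) - G1 * T = - (G2 * C)"
    and w: "w \<in> carrier_vec r" and ev: "cmat G1\<^sup>T *\<^sub>v w = \<mu> \<cdot>\<^sub>v w" and null: "cmat (T * B)\<^sup>T *\<^sub>v w = 0\<^sub>v m"
  shows "w = 0\<^sub>v r"
proof (rule ccontr)
  assume w0: "w \<noteq> 0\<^sub>v r"
  define h where "h = cmat T\<^sup>T *\<^sub>v w"
  define g where "g = cmat G2\<^sup>T *\<^sub>v w"
  have h: "h \<in> carrier_vec n" and g: "g \<in> carrier_vec p" using T G2 w unfolding h_def g_def by auto
  have cG1: "cmat G1 \<in> carrier_mat r r" and GT: "cmat G1\<^sup>T = (cmat G1)\<^sup>T" using G1 by auto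
  have "eigenvalue (cmat G1)\<^sup>T \<mu>"
    using eigenvalue_iff[of "(cmat G1)\<^sup>T" r \<mu>] cG1 w w0 ev unfolding GT by auto
  then have evS: "eigenvalue (cmat S) \<mu>"
    using internal_model_eigenvalue[OF im S] eigenvalue_transpose[OF cG1] by simp
  have tr: "cmat (X * Y)\<^sup>T *\<^sub>v w = cmat Y\<^sup>T *\<^sub>v (cmat X\<^sup>T *\<^sub>v w)"
    if "X \<in> carrier_mat r k" "Y \<in> carrier_mat k l" for X Y k l
    using cmat_transpose_mult[OF that] assoc_mult_mat_vec[of "cmat Y\<^sup>T" l k "cmat X\<^sup>T" r w] that w by simp
  have Bh: "cmat B\<^sup>T *\<^sub>v h = 0\<^sub>v m" using null tr[OF T B] unfolding h_def by simp
  have A1: "A + B * K0 \<in> carrier_mat n n" using A B K0 by auto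
  have "T * (A + B * K0) = G1 * T - G2 * C"
    using arg_cong[OF syl, of "\<lambda>X. X + G1 * T"] T A1 G1 G2 C
    by (auto simp: mat_eq_iff algebra_simps)
  then have "cmat (T * (A + B * K0))\<^sup>T = cmat (G1 * T)\<^sup>T - cmat (G2 * C)\<^sup>T"
    using G1 T G2 C by (intro eq_matI) auto
  then have "cmat (T * (A + B * K0))\<^sup>T *\<^sub>v w = cmat (G1 * T)\<^sup>T *\<^sub>v w - cmat (G2 * C)\<^sup>T *\<^sub>v w"
    using minus_mult_distrib_mat_vec[of "cmat (G1 * T)\<^sup>T" n r "cmat (G2 * C)\<^sup>T" w] G1 T G2 C w by simp
  then have "cmat (A + B * K0)\<^sup>T *\<^sub>v h = cmat T\<^sup>T *\<^sub>v (\<mu> \<cdot>\<^sub>v w) - cmat C\<^sup>T *\<^sub>v g"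
    unfolding tr[OF T A1] tr[OF G1 T] tr[OF G2 C] ev h_def g_def .
  moreover have "cmat (A + B * K0)\<^sup>T *\<^sub>v h = cmat A\<^sup>T *\<^sub>v h + cmat K0\<^sup>T *\<^sub>v (cmat B\<^sup>T *\<^sub>v h)"
  proof -
    have "cmat (A + B * K0)\<^sup>T = cmat A\<^sup>T + cmat (B * K0)\<^sup>T" using A B K0 by (intro eq_matI) auto
    then show ?thesis
      unfolding cmat_transpose_mult[OF B K0]
      using add_mult_distrib_mat_vec[of "cmat A\<^sup>T" n n "cmat K0\<^sup>T * cmat B\<^sup>T" h] A B K0 h
        assoc_mult_mat_vec[of "cmat K0\<^sup>T" n m "cmat B\<^sup>T" n h] by simp
  qed
  ultimately have Ah: "cmat A\<^sup>T *\<^sub>v h = \<mu> \<cdot>\<^sub>v h - cmat C\<^sup>T *\<^sub>v g"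
    unfolding Bh using A K0 C T w h g mult_mat_zero_vec[of "cmat K0\<^sup>T" n m] mult_mat_vec[of "cmat T\<^sup>T" n r w \<mu>] unfolding h_def by auto
  let ?R = "four_block_mat (cmat A - \<mu> \<cdot>\<^sub>m 1\<^sub>m n) (cmat B) (cmat C) (0\<^sub>m p m)"
  have R: "?R \<in> carrier_mat (n + p) (n + m)" using A B C by auto
  have RT: "?R\<^sup>T = four_block_mat (cmat A\<^sup>T - \<mu> \<cdot>\<^sub>m 1\<^sub>m n) (cmat C\<^sup>T) (cmat B\<^sup>T) (0\<^sub>m m p)"
    using A B C by (intro eq_matI) auto
  have "?R\<^sup>T *\<^sub>v (h @\<^sub>v g) = ((cmat A\<^sup>T - \<mu> \<cdot>\<^sub>m 1\<^sub>m n) *\<^sub>v h + cmat C\<^sup>T *\<^sub>v g) @\<^sub>v (cmat B\<^sup>T *\<^sub>v h + 0\<^sub>m m p *\<^sub>v g)"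
    unfolding RT by (rule four_block_mat_mult_vec[of _ n n _ p _ m]) (use A B C h g in auto)
  also have "(cmat A\<^sup>T - \<mu> \<cdot>\<^sub>m 1\<^sub>m n) *\<^sub>v h + cmat C\<^sup>T *\<^sub>v g = 0\<^sub>v n"
    using shift_mult_vec(2)[of "cmat A\<^sup>T" n h \<mu>] A C h g unfolding Ah[symmetric]
    by (simp add: Ah) (intro eq_vecI; auto)
  also have "cmat B\<^sup>T *\<^sub>v h + 0\<^sub>m m p *\<^sub>v g = 0\<^sub>v m" unfolding Bh using g by auto
  finally have "?R\<^sup>T *\<^sub>v (h @\<^sub>v g) = 0\<^sub>v (n + m)" unfolding zero_append_vec .
  from full_row_rank_left_kernel[OF R zeros[OF evS] append_carrier_vec[OF h g] this]
  have "h @\<^sub>v g = 0\<^sub>v n @\<^sub>v 0\<^sub>v p" unfolding zero_append_vec .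
  then have "g = 0\<^sub>v p" using append_vec_eq[OF h zero_carrier_vec] by blast
  then show False using internal_model_pbh[OF im G1 w ev] w0 unfolding g_def by simp
qed

text \<open>Let \<open>K0\<close> stabilise the plant and let \<open>T\<close> solve \<open>T (A + B K0) - G1 T = - G2 C\<close>, which is possible
because \<open>A + B K0\<close> and \<open>G1\<close> have disjoint spectra. With \<open>u = K0 x + u'\<close> the combination \<open>w = z + T x\<close> obeys
\<open>w' = G1 w + T B u'\<close> and is decoupled from \<open>x\<close>. A stabilising \<open>u' = K w\<close> for this controllable pair
gives the gains \<open>K1 = K0 + K T\<close> and \<open>K2 = K\<close>. The conclusion is phrased in terms of eigenvectors
\<open>(x, z)\<close> of the stabilised system, the form in which it is used.\<close>

lemma augmented_stabilizing_gains:
  fixes A B C G1 G2 S :: "real mat"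
  assumes A: "A \<in> carrier_mat n n" and B: "B \<in> carrier_mat n m" and C: "C \<in> carrier_mat p n"
    and S: "S \<in> carrier_mat q q" and stab: "stabilizable A B"
    and exo: "\<And>\<mu>. eigenvalue (cmat S) \<mu> \<Longrightarrow> \<not> Re \<mu> < 0"
    and zeros: "\<And>\<mu>. eigenvalue (cmat S) \<mu> \<Longrightarrow>
      mat_rank (four_block_mat (cmat A - \<mu> \<cdot>\<^sub>m 1\<^sub>m n) (cmat B) (cmat C) (0\<^sub>m p m)) = n + p"
    and im: "min_internal_model S p G1 G2"
    and G1: "G1 \<in> carrier_mat r r" and G2: "G2 \<in> carrier_mat r p"
  obtains K1 K2 where "K1 \<in> carrier_mat m n" "K2 \<in> carrier_mat m r"
    "\<And>x z \<mu>. x \<in> carrier_vec n \<Longrightarrow> z \<in> carrier_vec r \<Longrightarrow> \<not> (x = 0\<^sub>v n \<and> z = 0\<^sub>v r) \<Longrightarrow>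
      cmat A *\<^sub>v x + cmat B *\<^sub>v (cmat K1 *\<^sub>v x + cmat K2 *\<^sub>v z) = \<mu> \<cdot>\<^sub>v x \<Longrightarrow>
      cmat G2 *\<^sub>v (cmat C *\<^sub>v x) + cmat G1 *\<^sub>v z = \<mu> \<cdot>\<^sub>v z \<Longrightarrow> Re \<mu> < 0"
proof -
  obtain K0 where K0: "K0 \<in> carrier_mat m n" and hur0: "hurwitz (A + B * K0)"
    using stab A B unfolding stabilizable_def by auto
  have A1: "A + B * K0 \<in> carrier_mat n n" using A B K0 by auto
  have RC: "- (G2 * C) \<in> carrier_mat r n" using G2 C by auto
  have disj: "False" if "eigenvalue (cmat G1) \<mu>" "eigenvalue (cmat (A + B * K0)) \<mu>" for \<mu>
    using that internal_model_eigenvalue[OF im S] exo hur0 unfolding hurwitz_def by blast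
  obtain T where T: "T \<in> carrier_mat r n" and syl: "T * (A + B * K0) - G1 * T = - (G2 * C)"
    by (rule sylvester_real[OF G1 A1 RC disj])
  have TB: "T * B \<in> carrier_mat r m" using T B by auto
  obtain K where K: "K \<in> carrier_mat m r" and hurK: "hurwitz (G1 + T * B * K)"
    by (rule stabilizing_feedback[OF G1 TB augmented_pbh[OF A B C S zeros im G1 G2 K0 T syl]])
  define K1 where "K1 = K0 + K * T"
  have K1: "K1 \<in> carrier_mat m n" using K0 K T unfolding K1_def by auto
  show ?thesis
  proof (rule that[OF K1 K])
    fix x z \<mu>
    assume x: "x \<in> carrier_vec n" and z: "z \<in> carrier_vec r" and nz: "\<not> (x = 0\<^sub>v n \<and> z = 0\<^sub>v r)"
      and ex: "cmat A *\<^sub>v x + cmat B *\<^sub>v (cmat K1 *\<^sub>v x + cmat K *\<^sub>v z) = \<mu> \<cdot>\<^sub>v x"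
      and ez: "cmat G2 *\<^sub>v (cmat C *\<^sub>v x) + cmat G1 *\<^sub>v z = \<mu> \<cdot>\<^sub>v z"
    define w where "w = cmat T *\<^sub>v x + z"
    have Tx: "cmat T *\<^sub>v x \<in> carrier_vec r" and w: "w \<in> carrier_vec r" using T x z unfolding w_def by auto
    define a where "a = cmat (A + B * K0) *\<^sub>v x"
    define u where "u = cmat B *\<^sub>v (cmat K *\<^sub>v w)"
    have a: "a \<in> carrier_vec n" and u: "u \<in> carrier_vec n" using A1 B K x w unfolding a_def u_def by auto
    have ua: "a + u = \<mu> \<cdot>\<^sub>v x"
    proof -
      have k: "cmat K1 *\<^sub>v x + cmat K *\<^sub>v z = cmat K0 *\<^sub>v x + cmat K *\<^sub>v w"
      proof -
        have "cmat K1 *\<^sub>v x = cmat K0 *\<^sub>v x + cmat K *\<^sub>v (cmat T *\<^sub>v x)"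
          unfolding K1_def using cmat_add_vec[of K0 m n "K * T" x] cmat_mult_vec[of K m r T n x] K0 K T x by simp
        moreover have "cmat K *\<^sub>v w = cmat K *\<^sub>v (cmat T *\<^sub>v x) + cmat K *\<^sub>v z"
          unfolding w_def using mult_add_distrib_mat_vec[of "cmat K" m r "cmat T *\<^sub>v x" z] K Tx z by simp
        ultimately show ?thesis using K0 K Tx x z assoc_add_vec[of "cmat K0 *\<^sub>v x" m] by simp
      qed
      have "cmat B *\<^sub>v (cmat K0 *\<^sub>v x + cmat K *\<^sub>v w) = cmat B *\<^sub>v (cmat K0 *\<^sub>v x) + u"
        unfolding u_def using mult_add_distrib_mat_vec[of "cmat B" n m "cmat K0 *\<^sub>v x" "cmat K *\<^sub>v w"] B K0 K x w by simp
      moreover have "a = cmat A *\<^sub>v x + cmat B *\<^sub>v (cmat K0 *\<^sub>v x)"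
        unfolding a_def using cmat_add_vec[of A n n "B * K0" x] cmat_mult_vec[of B n m K0 n x] A B K0 x by simp
      ultimately show ?thesis
        using ex assoc_add_vec[of "cmat A *\<^sub>v x" n "cmat B *\<^sub>v (cmat K0 *\<^sub>v x)" u] A B K0 x u unfolding k by simp
    qed
    have Ta: "cmat T *\<^sub>v a = cmat G1 *\<^sub>v (cmat T *\<^sub>v x) - cmat G2 *\<^sub>v (cmat C *\<^sub>v x)"
    proof -
      have "T * (A + B * K0) + G2 * C = G1 * T"
        using arg_cong[OF syl, of "\<lambda>X. X + G1 * T + G2 * C"] T A1 G1 G2 C
        by (auto simp: mat_eq_iff algebra_simps)
      then have "cmat (T * (A + B * K0) + G2 * C) *\<^sub>v x = cmat (G1 * T) *\<^sub>v x" by simp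
      then have "cmat T *\<^sub>v a + cmat G2 *\<^sub>v (cmat C *\<^sub>v x) = cmat G1 *\<^sub>v (cmat T *\<^sub>v x)"
        unfolding a_def using cmat_add_vec[of "T * (A + B * K0)" r n "G2 * C" x] cmat_mult_vec[OF T A1 x]
          cmat_mult_vec[OF G2 C x] cmat_mult_vec[OF G1 T x] T A1 G2 C x by simp
      then show ?thesis using T a G2 C G1 x by (auto simp: vec_eq_iff algebra_simps simp del: index_mult_mat_vec)
    qed
    have "cmat (G1 + T * B * K) *\<^sub>v w = \<mu> \<cdot>\<^sub>v w"
    proof -
      have "cmat (G1 + T * B * K) *\<^sub>v w = cmat G1 *\<^sub>v w + cmat T *\<^sub>v u"
        unfolding u_def using cmat_add_vec[of G1 r r "T * B * K" w] cmat_mult_vec[OF TB K w]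
          cmat_mult_vec[OF T B, of "cmat K *\<^sub>v w"] G1 TB K w by simp
      also have "cmat G1 *\<^sub>v w = cmat G1 *\<^sub>v (cmat T *\<^sub>v x) + cmat G1 *\<^sub>v z"
        unfolding w_def using mult_add_distrib_mat_vec[of "cmat G1" r r] G1 Tx z by simp
      also have "\<dots> = cmat T *\<^sub>v a + \<mu> \<cdot>\<^sub>v z"
        unfolding Ta ez[symmetric] using G1 G2 C Tx x z
        by (intro eq_vecI) (simp_all del: index_mult_mat_vec)
      also have "\<dots> + cmat T *\<^sub>v u = cmat T *\<^sub>v (a + u) + \<mu> \<cdot>\<^sub>v z"
        using mult_add_distrib_mat_vec[of "cmat T" r n a u] T a u z
        by (intro eq_vecI) (simp_all del: index_mult_mat_vec)
      also have "\<dots> = \<mu> \<cdot>\<^sub>v w"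
        unfolding ua w_def using T x z Tx mult_mat_vec[of "cmat T" r n x \<mu>]
        by (simp add: smult_add_distrib_vec[of _ r])
      finally show ?thesis .
    qed
    moreover have "G1 + T * B * K \<in> carrier_mat r r" using G1 TB K by auto
    ultimately have wcase: "w \<noteq> 0\<^sub>v r \<Longrightarrow> Re \<mu> < 0" using hurwitzD[OF hurK] w by blast
    show "Re \<mu> < 0"
    proof (cases "w = 0\<^sub>v r")
      case True
      have "u = 0\<^sub>v n" unfolding u_def True using B K mult_mat_zero_vec[of "cmat K" m r] mult_mat_zero_vec[of "cmat B" n m] by simp
      then have "a = \<mu> \<cdot>\<^sub>v x" using ua a by simp
      moreover have "x \<noteq> 0\<^sub>v n"
      proof
        assume "x = 0\<^sub>v n"
        then have "z = 0\<^sub>v r" using True T z mult_mat_zero_vec[of "cmat T" r n] unfolding w_def by simp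
        with nz \<open>x = 0\<^sub>v n\<close> show False by simp
      qed
      ultimately show ?thesis using hurwitzD[OF hur0 A1 x] unfolding a_def by blast
    qed (rule wcase)
  qed
qed

text \<open>The superdiagonal forces \<open>v\<^sub>i = \<mu>\<^sup>i v\<^sub>0\<close>, and the last row then says \<open>f(\<mu>) v\<^sub>0 = 0\<close>.\<close>

lemma companion_eigenvalue:
  fixes f :: "real poly"
  assumes n: "degree f = n" "0 < n" "lead_coeff f = 1"
    and v: "v \<in> carrier_vec n" "v \<noteq> 0\<^sub>v n" and ev: "cmat (companion f) *\<^sub>v v = \<mu> \<cdot>\<^sub>v v"
  shows "poly (map_poly complex_of_real f) \<mu> = 0"
proof -
  let ?C = "cmat (companion f)"
  have C: "?C \<in> carrier_mat n n" unfolding companion_def n by simp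
  have row: "(\<Sum>j<n. ?C $$ (i, j) * v $ j) = \<mu> * v $ i" if "i < n" for i
    using arg_cong[OF ev, of "\<lambda>x. x $ i"] that C v by (simp add: index_mult_vec_sum[of _ _ n] del: index_mult_mat_vec)
  have pow: "v $ i = \<mu> ^ i * v $ 0" if "i < n" for i
    using that
  proof (induction i)
    case (Suc i)
    have "(\<Sum>j<n. ?C $$ (i, j) * v $ j) = (\<Sum>j<n. if j = Suc i then v $ j else 0)"
      using Suc.prems by (intro sum.cong) (auto simp: companion_def n)
    also have "\<dots> = v $ Suc i" using Suc.prems by (simp add: sum.delta)
    finally show ?case using row[of i] Suc by (simp add: mult.assoc)
  qed simp
  have v0: "v $ 0 \<noteq> 0"
  proof
    assume "v $ 0 = 0"
    then have "v = 0\<^sub>v n" using pow v(1) by (intro eq_vecI) auto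
    then show False using v(2) by simp
  qed
  have "(\<Sum>j<n. ?C $$ (n - 1, j) * v $ j) = (\<Sum>j<n. - of_real (coeff f j) * (\<mu> ^ j * v $ 0))"
  proof (intro sum.cong refl)
    fix j assume "j \<in> {..<n}"
    moreover from this have "?C $$ (n - 1, j) = - of_real (coeff f j)" using n(2) by (simp add: companion_def n)
    ultimately show "?C $$ (n - 1, j) * v $ j = - of_real (coeff f j) * (\<mu> ^ j * v $ 0)" using pow[of j] by simp
  qed
  then have "\<mu> * (\<mu> ^ (n - 1) * v $ 0) = - (\<Sum>j<n. of_real (coeff f j) * (\<mu> ^ j * v $ 0))"
    using row[of "n - 1"] pow[of "n - 1"] n(2) by (simp add: sum_negf)
  moreover have power: "\<mu> * (\<mu> ^ (n - 1) * v $ 0) = \<mu> ^ n * v $ 0" using n(2) by (cases n) auto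
  ultimately have "\<mu> ^ n * v $ 0 + (\<Sum>j<n. of_real (coeff f j) * (\<mu> ^ j * v $ 0)) = 0"
    unfolding power by simp
  then have "(\<mu> ^ n + (\<Sum>j<n. of_real (coeff f j) * \<mu> ^ j)) * v $ 0 = 0"
    by (simp add: distrib_right sum_distrib_right mult.assoc)
  then have "\<mu> ^ n + (\<Sum>j<n. of_real (coeff f j) * \<mu> ^ j) = 0" using v0 by simp
  moreover have "poly (map_poly complex_of_real f) \<mu> = (\<Sum>j<n. of_real (coeff f j) * \<mu> ^ j) + \<mu> ^ n"
    using n by (simp add: poly_altdef degree_map_poly coeff_map_poly lessThan_Suc_atMost[symmetric])
  ultimately show ?thesis by (simp add: add.commute)
qed

lemma comp_zeta_stable:
  assumes X: "X \<in> carrier_mat n n" and n: "0 < n" and hur: "hurwitz X"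
    and v: "v \<in> carrier_vec (k * n)" "v \<noteq> 0\<^sub>v (k * n)"
    and ev: "cmat (1\<^sub>m k \<otimes>\<^sub>k companion (char_poly X)) *\<^sub>v v = \<mu> \<cdot>\<^sub>v v"
  shows "Re \<mu> < 0"
proof -
  let ?C = "companion (char_poly X)"
  have deg: "degree (char_poly X) = n" "lead_coeff (char_poly X) = 1" using degree_monic_char_poly[OF X] by auto
  have C: "?C \<in> carrier_mat n n" unfolding companion_def deg by simp
  have cC: "cmat ?C \<in> carrier_mat n n" using C by simp
  obtain a where a: "a < k" "block n a v \<noteq> 0\<^sub>v n" using block_zeroI[OF v(1)] v(2) by blast
  have "cmat ?C *\<^sub>v block n a v = \<mu> \<cdot>\<^sub>v block n a v"
    using block_kron_id[OF cC v(1) a(1)] ev block_smult[OF a(1) v(1)] unfolding cmat_kron_id_transpose(2)[OF C] by simp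
  then have "poly (map_poly of_real (char_poly X)) \<mu> = 0"
    by (intro companion_eigenvalue[OF deg(1) n deg(2) block_carrier a(2)])
  moreover have "cmat X \<in> carrier_mat n n" using X by simp
  ultimately have "eigenvalue (cmat X) \<mu>"
    using eigenvalue_root_char_poly[of "cmat X" n] of_real_hom.char_poly_hom[OF X, where 'a = complex] by simp
  then show ?thesis using hur unfolding hurwitz_def by blast
qed

section \<open>The closed-loop matrix\<close>

text \<open>The system matrix for the stacked state \<open>(x, \<zeta>, z)\<close> when \<open>v = 0\<close>.\<close>

definition closed_loop_mat ::
    "'a::comm_ring_1 mat \<Rightarrow> 'a mat \<Rightarrow> 'a mat \<Rightarrow> 'a mat \<Rightarrow> 'a mat \<Rightarrow> 'a mat \<Rightarrow> 'a mat \<Rightarrow> 'a mat \<Rightarrow> 'a mat \<Rightarrow> 'a mat" where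
  "closed_loop_mat A B C Ac Bc Ec G1 G2 K =
     four_block_mat A (B * K) ((Ec * C) @\<^sub>r (G2 * C))
       (four_block_mat Ac (0\<^sub>m (dim_row Ac) (dim_col G1)) (0\<^sub>m (dim_row G1) (dim_col Ac)) G1
        + (Bc @\<^sub>r 0\<^sub>m (dim_row G1) (dim_col Bc)) * K)"

lemma closed_loop_mat:
  fixes A :: "'a::comm_ring_1 mat"
  assumes A: "A \<in> carrier_mat n n" and B: "B \<in> carrier_mat n m" and C: "C \<in> carrier_mat p n"
    and Ac: "Ac \<in> carrier_mat N N" and Bc: "Bc \<in> carrier_mat N m" and Ec: "Ec \<in> carrier_mat N p"
    and G1: "G1 \<in> carrier_mat r r" and G2: "G2 \<in> carrier_mat r p" and K: "K \<in> carrier_mat m (N + r)"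
  shows closed_loop_mat_carrier: "closed_loop_mat A B C Ac Bc Ec G1 G2 K \<in> carrier_mat (n + (N + r)) (n + (N + r))"
    and "x \<in> carrier_vec n \<Longrightarrow> \<zeta> \<in> carrier_vec N \<Longrightarrow> z \<in> carrier_vec r \<Longrightarrow>
      closed_loop_mat A B C Ac Bc Ec G1 G2 K *\<^sub>v (x @\<^sub>v (\<zeta> @\<^sub>v z)) =
      (A *\<^sub>v x + B *\<^sub>v (K *\<^sub>v (\<zeta> @\<^sub>v z))) @\<^sub>v
      ((Ac *\<^sub>v \<zeta> + Bc *\<^sub>v (K *\<^sub>v (\<zeta> @\<^sub>v z)) + Ec *\<^sub>v (C *\<^sub>v x)) @\<^sub>v (G1 *\<^sub>v z + G2 *\<^sub>v (C *\<^sub>v x)))"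
proof -
  let ?R = "(Ec * C) @\<^sub>r (G2 * C)" and ?B = "Bc @\<^sub>r 0\<^sub>m r m"
  let ?G = "four_block_mat Ac (0\<^sub>m N r) (0\<^sub>m r N) G1"
  have EC: "Ec * C \<in> carrier_mat N n" and GC: "G2 * C \<in> carrier_mat r n" using Ec G2 C by auto
  have R: "?R \<in> carrier_mat (N + r) n" using carrier_append_rows[OF EC GC] .
  have Bc': "?B \<in> carrier_mat (N + r) m" using carrier_append_rows[OF Bc] by simp
  have G: "?G \<in> carrier_mat (N + r) (N + r)" using Ac G1 by simp
  have BK: "B * K \<in> carrier_mat n (N + r)" and BcK: "?B * K \<in> carrier_mat (N + r) (N + r)"
    using B K Bc' by auto
  have GB: "?G + ?B * K \<in> carrier_mat (N + r) (N + r)" using G BcK by auto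
  have eq: "closed_loop_mat A B C Ac Bc Ec G1 G2 K = four_block_mat A (B * K) ?R (?G + ?B * K)"
    using Ac G1 Bc unfolding closed_loop_mat_def by simp
  show "closed_loop_mat A B C Ac Bc Ec G1 G2 K \<in> carrier_mat (n + (N + r)) (n + (N + r))"
    unfolding eq using four_block_carrier_mat[OF A GB] .
  assume x: "x \<in> carrier_vec n" and \<zeta>: "\<zeta> \<in> carrier_vec N" and z: "z \<in> carrier_vec r"
  let ?\<rho> = "\<zeta> @\<^sub>v z"
  have \<rho>: "?\<rho> \<in> carrier_vec (N + r)" using \<zeta> z by auto
  have u: "K *\<^sub>v ?\<rho> \<in> carrier_vec m" using K \<rho> by auto
  have Rx: "?R *\<^sub>v x = (Ec *\<^sub>v (C *\<^sub>v x)) @\<^sub>v (G2 *\<^sub>v (C *\<^sub>v x))"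
    using mat_mult_append[OF EC GC x] assoc_mult_mat_vec[OF Ec C x] assoc_mult_mat_vec[OF G2 C x] by simp
  have G\<rho>: "?G *\<^sub>v ?\<rho> = (Ac *\<^sub>v \<zeta>) @\<^sub>v (G1 *\<^sub>v z)"
    using four_block_mat_mult_vec[OF Ac _ _ G1 \<zeta> z, of "0\<^sub>m N r" "0\<^sub>m r N"] Ac G1 \<zeta> z
      zero_mat_mult_vec[OF z, of N] zero_mat_mult_vec[OF \<zeta>, of r] by simp
  have B\<rho>: "(?B * K) *\<^sub>v ?\<rho> = (Bc *\<^sub>v (K *\<^sub>v ?\<rho>)) @\<^sub>v 0\<^sub>v r"
    using assoc_mult_mat_vec[OF Bc' K \<rho>] mat_mult_append[OF Bc _ u, of "0\<^sub>m r m" r] zero_mat_mult_vec[OF u, of r] by simp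
  have "(?G + ?B * K) *\<^sub>v ?\<rho> = (Ac *\<^sub>v \<zeta> + Bc *\<^sub>v (K *\<^sub>v ?\<rho>)) @\<^sub>v (G1 *\<^sub>v z)"
    using add_mult_distrib_mat_vec[OF G BcK \<rho>] append_vec_add[of "Ac *\<^sub>v \<zeta>" N "Bc *\<^sub>v (K *\<^sub>v ?\<rho>)" "G1 *\<^sub>v z" r "0\<^sub>v r"]
      Ac Bc G1 \<zeta> z u unfolding G\<rho> B\<rho> by simp
  then have low: "?R *\<^sub>v x + (?G + ?B * K) *\<^sub>v ?\<rho> =
      (Ec *\<^sub>v (C *\<^sub>v x) + (Ac *\<^sub>v \<zeta> + Bc *\<^sub>v (K *\<^sub>v ?\<rho>))) @\<^sub>v (G2 *\<^sub>v (C *\<^sub>v x) + G1 *\<^sub>v z)"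
    using append_vec_add[of "Ec *\<^sub>v (C *\<^sub>v x)" N "Ac *\<^sub>v \<zeta> + Bc *\<^sub>v (K *\<^sub>v ?\<rho>)" "G2 *\<^sub>v (C *\<^sub>v x)" r "G1 *\<^sub>v z"]
      Ec C G2 Ac Bc G1 x \<zeta> z u unfolding Rx by simp
  have "closed_loop_mat A B C Ac Bc Ec G1 G2 K *\<^sub>v (x @\<^sub>v ?\<rho>) =
      (A *\<^sub>v x + (B * K) *\<^sub>v ?\<rho>) @\<^sub>v (?R *\<^sub>v x + (?G + ?B * K) *\<^sub>v ?\<rho>)"
    unfolding eq by (rule four_block_mat_mult_vec[OF A BK R GB x \<rho>])
  also have "(B * K) *\<^sub>v ?\<rho> = B *\<^sub>v (K *\<^sub>v ?\<rho>)" by (rule assoc_mult_mat_vec[OF B K \<rho>])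
  also note low
  also have "Ec *\<^sub>v (C *\<^sub>v x) + (Ac *\<^sub>v \<zeta> + Bc *\<^sub>v (K *\<^sub>v ?\<rho>)) = Ac *\<^sub>v \<zeta> + Bc *\<^sub>v (K *\<^sub>v ?\<rho>) + Ec *\<^sub>v (C *\<^sub>v x)"
    using Ec C Ac Bc x \<zeta> u by (intro comm_add_vec[of _ N]) auto
  also have "G2 *\<^sub>v (C *\<^sub>v x) + G1 *\<^sub>v z = G1 *\<^sub>v z + G2 *\<^sub>v (C *\<^sub>v x)"
    using G2 C G1 x z by (intro comm_add_vec[of _ r]) auto
  finally show "closed_loop_mat A B C Ac Bc Ec G1 G2 K *\<^sub>v (x @\<^sub>v ?\<rho>) =
      (A *\<^sub>v x + B *\<^sub>v (K *\<^sub>v ?\<rho>)) @\<^sub>v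
      ((Ac *\<^sub>v \<zeta> + Bc *\<^sub>v (K *\<^sub>v ?\<rho>) + Ec *\<^sub>v (C *\<^sub>v x)) @\<^sub>v (G1 *\<^sub>v z + G2 *\<^sub>v (C *\<^sub>v x)))" .
qed

lemma cmat_closed_loop_mat:
  assumes A: "A \<in> carrier_mat n n" and B: "B \<in> carrier_mat n m" and C: "C \<in> carrier_mat p n"
    and Ac: "Ac \<in> carrier_mat N N" and Bc: "Bc \<in> carrier_mat N m" and Ec: "Ec \<in> carrier_mat N p"
    and G1: "G1 \<in> carrier_mat r r" and G2: "G2 \<in> carrier_mat r p" and K: "K \<in> carrier_mat m (N + r)"
  shows "cmat (closed_loop_mat A B C Ac Bc Ec G1 G2 K) =
    closed_loop_mat (cmat A) (cmat B) (cmat C) (cmat Ac) (cmat Bc) (cmat Ec) (cmat G1) (cmat G2) (cmat K)"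
proof -
  have EC: "Ec * C \<in> carrier_mat N n" and GC: "G2 * C \<in> carrier_mat r n" using Ec G2 C by auto
  have R: "(Ec * C) @\<^sub>r (G2 * C) \<in> carrier_mat (N + r) n" using carrier_append_rows[OF EC GC] .
  have Bc': "Bc @\<^sub>r 0\<^sub>m r m \<in> carrier_mat (N + r) m" using carrier_append_rows[OF Bc] by simp
  have G: "four_block_mat Ac (0\<^sub>m N r) (0\<^sub>m r N) G1 \<in> carrier_mat (N + r) (N + r)" using Ac G1 by simp
  have BK: "B * K \<in> carrier_mat n (N + r)" and BcK: "(Bc @\<^sub>r 0\<^sub>m r m) * K \<in> carrier_mat (N + r) (N + r)"
    using B K Bc' by auto
  have dims: "dim_row Ac = N" "dim_col Ac = N" "dim_row G1 = r" "dim_col G1 = r" "dim_col Bc = m" using Ac G1 Bc by auto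
  have z: "cmat (0\<^sub>m a b) = 0\<^sub>m a b" for a b by (intro eq_matI) auto
  show ?thesis
    unfolding closed_loop_mat_def index_map_mat dims
    unfolding cmat_four_block[OF A BK R add_carrier_mat[OF BcK]] cmat_add[OF G BcK]
      cmat_append_rows[OF EC GC] of_real_hom.mat_hom_mult[OF B K] of_real_hom.mat_hom_mult[OF Bc' K]
      of_real_hom.mat_hom_mult[OF Ec C] of_real_hom.mat_hom_mult[OF G2 C]
      cmat_four_block[OF Ac zero_carrier_mat zero_carrier_mat G1] cmat_append_rows[OF Bc zero_carrier_mat] z ..
qed

lemma rho_action:
  assumes C: "C \<in> carrier_mat p n" and M: "M \<in> carrier_mat n N"
    and Ac: "Ac \<in> carrier_mat N N" and Bc: "Bc \<in> carrier_mat N m" and Ec: "Ec \<in> carrier_mat N p"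
    and G1: "G1 \<in> carrier_mat r r" and G2: "G2 \<in> carrier_mat r p" and K: "K \<in> carrier_mat m (N + r)"
    and \<zeta>: "\<zeta> \<in> carrier_vec N" and z: "z \<in> carrier_vec r"
  shows "cmat (four_block_mat (Ac + Ec * C * M) (0\<^sub>m N r) (G2 * C * M) G1 + (Bc @\<^sub>r 0\<^sub>m r m) * K) *\<^sub>v (\<zeta> @\<^sub>v z) =
    (cmat Ac *\<^sub>v \<zeta> + cmat Ec *\<^sub>v (cmat C *\<^sub>v (cmat M *\<^sub>v \<zeta>)) + cmat Bc *\<^sub>v (cmat K *\<^sub>v (\<zeta> @\<^sub>v z))) @\<^sub>v
    (cmat G2 *\<^sub>v (cmat C *\<^sub>v (cmat M *\<^sub>v \<zeta>)) + cmat G1 *\<^sub>v z)"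
proof -
  let ?\<rho> = "\<zeta> @\<^sub>v z"
  have \<rho>: "?\<rho> \<in> carrier_vec (N + r)" using \<zeta> z by auto
  have u: "cmat K *\<^sub>v ?\<rho> \<in> carrier_vec m" using K \<rho> by auto
  have EC: "Ec * C \<in> carrier_mat N n" and GC: "G2 * C \<in> carrier_mat r n" using Ec G2 C by auto
  have ECM: "Ec * C * M \<in> carrier_mat N N" and GCM: "G2 * C * M \<in> carrier_mat r N" using EC GC M by auto
  have Az: "Ac + Ec * C * M \<in> carrier_mat N N" using Ac ECM by auto
  have R: "four_block_mat (Ac + Ec * C * M) (0\<^sub>m N r) (G2 * C * M) G1 \<in> carrier_mat (N + r) (N + r)"
    using four_block_carrier_mat[OF Az G1] .
  have Bc': "Bc @\<^sub>r 0\<^sub>m r m \<in> carrier_mat (N + r) m" using carrier_append_rows[OF Bc] by simp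
  have z0: "cmat (0\<^sub>m a b) = 0\<^sub>m a b" for a b by (intro eq_matI) auto
  have M\<zeta>: "cmat M *\<^sub>v \<zeta> \<in> carrier_vec n" using M \<zeta> by auto
  have BcK: "cmat ((Bc @\<^sub>r 0\<^sub>m r m) * K) *\<^sub>v ?\<rho> = (cmat Bc *\<^sub>v (cmat K *\<^sub>v ?\<rho>)) @\<^sub>v 0\<^sub>v r"
    using cmat_mult_vec[OF Bc' K \<rho>] mat_mult_append[of "cmat Bc" N m "0\<^sub>m r m" r "cmat K *\<^sub>v ?\<rho>"] Bc u
      zero_mat_mult_vec[OF u, of r]
    by (simp add: cmat_append_rows[OF Bc zero_carrier_mat] z0)
  have "cmat (four_block_mat (Ac + Ec * C * M) (0\<^sub>m N r) (G2 * C * M) G1) *\<^sub>v ?\<rho> =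
      (cmat (Ac + Ec * C * M) *\<^sub>v \<zeta> + 0\<^sub>v N) @\<^sub>v (cmat (G2 * C * M) *\<^sub>v \<zeta> + cmat G1 *\<^sub>v z)"
    unfolding cmat_four_block[OF Az zero_carrier_mat GCM G1] z0
    using four_block_mat_mult_vec[of "cmat (Ac + Ec * C * M)" N N "0\<^sub>m N r" r "cmat (G2 * C * M)" r "cmat G1" \<zeta> z]
      Az GCM G1 \<zeta> z zero_mat_mult_vec[OF z, of N] by simp
  also have "cmat (Ac + Ec * C * M) *\<^sub>v \<zeta> + 0\<^sub>v N = cmat Ac *\<^sub>v \<zeta> + cmat Ec *\<^sub>v (cmat C *\<^sub>v (cmat M *\<^sub>v \<zeta>))"
    unfolding cmat_add_vec[OF Ac ECM \<zeta>] cmat_mult_vec[OF EC M \<zeta>] cmat_mult_vec[OF Ec C M\<zeta>]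
    using Ac Ec C M\<zeta> \<zeta> by simp
  also have "cmat (G2 * C * M) *\<^sub>v \<zeta> = cmat G2 *\<^sub>v (cmat C *\<^sub>v (cmat M *\<^sub>v \<zeta>))"
    unfolding cmat_mult_vec[OF GC M \<zeta>] cmat_mult_vec[OF G2 C M\<zeta>] ..
  finally have R\<rho>: "cmat (four_block_mat (Ac + Ec * C * M) (0\<^sub>m N r) (G2 * C * M) G1) *\<^sub>v ?\<rho> =
      (cmat Ac *\<^sub>v \<zeta> + cmat Ec *\<^sub>v (cmat C *\<^sub>v (cmat M *\<^sub>v \<zeta>))) @\<^sub>v
      (cmat G2 *\<^sub>v (cmat C *\<^sub>v (cmat M *\<^sub>v \<zeta>)) + cmat G1 *\<^sub>v z)" .
  show ?thesis
    unfolding cmat_add_vec[OF R mult_carrier_mat[OF Bc' K] \<rho>] R\<rho> BcK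
    using append_vec_add[of "cmat Ac *\<^sub>v \<zeta> + cmat Ec *\<^sub>v (cmat C *\<^sub>v (cmat M *\<^sub>v \<zeta>))" N "cmat Bc *\<^sub>v (cmat K *\<^sub>v ?\<rho>)"
        "cmat G2 *\<^sub>v (cmat C *\<^sub>v (cmat M *\<^sub>v \<zeta>)) + cmat G1 *\<^sub>v z" r "0\<^sub>v r"] Ac Ec C G2 G1 Bc M\<zeta> \<zeta> z u by simp
qed

lemma observer_vec:
  assumes A: "A \<in> carrier_mat n n" and B: "B \<in> carrier_mat n m" and C: "C \<in> carrier_mat p n"
    and L: "L \<in> carrier_mat n p" and M: "M \<in> carrier_mat n N"
    and Ac: "Ac \<in> carrier_mat N N" and Bc: "Bc \<in> carrier_mat N m" and Ec: "Ec \<in> carrier_mat N p"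
    and MA: "M * Ac = (A - L * C) * M" and MB: "M * Bc = B" and ME: "M * Ec = L"
  shows observer_state: "\<zeta> \<in> carrier_vec N \<Longrightarrow>
      cmat M *\<^sub>v (cmat Ac *\<^sub>v \<zeta>) = cmat A *\<^sub>v (cmat M *\<^sub>v \<zeta>) - cmat L *\<^sub>v (cmat C *\<^sub>v (cmat M *\<^sub>v \<zeta>))"
    and observer_input: "u \<in> carrier_vec m \<Longrightarrow> cmat M *\<^sub>v (cmat Bc *\<^sub>v u) = cmat B *\<^sub>v u"
    and observer_output: "y \<in> carrier_vec p \<Longrightarrow> cmat M *\<^sub>v (cmat Ec *\<^sub>v y) = cmat L *\<^sub>v y"
    and error_dynamics: "x \<in> carrier_vec n \<Longrightarrow>
      cmat (A - L * C) *\<^sub>v x = cmat A *\<^sub>v x - cmat L *\<^sub>v (cmat C *\<^sub>v x)"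
proof -
  have LC: "L * C \<in> carrier_mat n n" using L C by auto
  have ALC: "A - L * C \<in> carrier_mat n n" using LC by (rule minus_carrier_mat)
  show err: "cmat (A - L * C) *\<^sub>v x = cmat A *\<^sub>v x - cmat L *\<^sub>v (cmat C *\<^sub>v x)" if x: "x \<in> carrier_vec n" for x
  proof -
    have "cmat (A - L * C) = cmat A - cmat (L * C)" using A L C by (intro eq_matI) auto
    then show ?thesis
      using minus_mult_distrib_mat_vec[of "cmat A" n n "cmat (L * C)" x] cmat_mult_vec[OF L C x] A LC x by simp
  qed
  show "cmat M *\<^sub>v (cmat Ac *\<^sub>v \<zeta>) = cmat A *\<^sub>v (cmat M *\<^sub>v \<zeta>) - cmat L *\<^sub>v (cmat C *\<^sub>v (cmat M *\<^sub>v \<zeta>))"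
    if \<zeta>: "\<zeta> \<in> carrier_vec N"
    using cmat_mult_vec[OF M Ac \<zeta>] cmat_mult_vec[OF ALC M \<zeta>] err[of "cmat M *\<^sub>v \<zeta>"] M \<zeta> unfolding MA by simp
  show "u \<in> carrier_vec m \<Longrightarrow> cmat M *\<^sub>v (cmat Bc *\<^sub>v u) = cmat B *\<^sub>v u"
    using cmat_mult_vec[OF M Bc, of u] unfolding MB by simp
  show "y \<in> carrier_vec p \<Longrightarrow> cmat M *\<^sub>v (cmat Ec *\<^sub>v y) = cmat L *\<^sub>v y"
    using cmat_mult_vec[OF M Ec, of y] unfolding ME by simp
qed

text \<open>The gain is \<open>K = [K1 M, K2]\<close>. If \<open>(\<zeta>, z)\<close> is an eigenvector, then \<open>(M \<zeta>, z)\<close> is one of the stabilised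
plant with internal model, unless it vanishes; in that case input and output vanish as well and
\<open>\<zeta>\<close> is an eigenvector of the stable filter matrix \<open>Ac\<close>.\<close>

lemma rho_stabilizing_gain:
  fixes A B C L M Ac Bc Ec G1 G2 K1 K2 :: "real mat"
  assumes A: "A \<in> carrier_mat n n" and B: "B \<in> carrier_mat n m" and C: "C \<in> carrier_mat p n"
    and L: "L \<in> carrier_mat n p" and M: "M \<in> carrier_mat n N"
    and Ac: "Ac \<in> carrier_mat N N" and Bc: "Bc \<in> carrier_mat N m" and Ec: "Ec \<in> carrier_mat N p"
    and MA: "M * Ac = (A - L * C) * M" and MB: "M * Bc = B" and ME: "M * Ec = L"
    and G1: "G1 \<in> carrier_mat r r" and G2: "G2 \<in> carrier_mat r p"
    and stable: "\<And>v \<mu>. v \<in> carrier_vec N \<Longrightarrow> v \<noteq> 0\<^sub>v N \<Longrightarrow> cmat Ac *\<^sub>v v = \<mu> \<cdot>\<^sub>v v \<Longrightarrow> Re \<mu> < 0"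
    and K1: "K1 \<in> carrier_mat m n" and K2: "K2 \<in> carrier_mat m r"
    and gains: "\<And>x z \<mu>. x \<in> carrier_vec n \<Longrightarrow> z \<in> carrier_vec r \<Longrightarrow> \<not> (x = 0\<^sub>v n \<and> z = 0\<^sub>v r) \<Longrightarrow>
      cmat A *\<^sub>v x + cmat B *\<^sub>v (cmat K1 *\<^sub>v x + cmat K2 *\<^sub>v z) = \<mu> \<cdot>\<^sub>v x \<Longrightarrow>
      cmat G2 *\<^sub>v (cmat C *\<^sub>v x) + cmat G1 *\<^sub>v z = \<mu> \<cdot>\<^sub>v z \<Longrightarrow> Re \<mu> < 0"
  shows "\<exists>K \<in> carrier_mat m (N + r).
    hurwitz (four_block_mat (Ac + Ec * C * M) (0\<^sub>m N r) (G2 * C * M) G1 + (Bc @\<^sub>r 0\<^sub>m r m) * K)"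
proof
  \<comment> \<open>The lower blocks have no rows; this is the row of blocks \<open>[K1 M, K2]\<close>.\<close>
  define K where "K = four_block_mat (K1 * M) K2 (0\<^sub>m 0 N) (0\<^sub>m 0 r)"
  have K1M: "K1 * M \<in> carrier_mat m N" using K1 M by auto
  show K: "K \<in> carrier_mat m (N + r)"
    using four_block_carrier_mat[OF K1M, of "0\<^sub>m 0 r" 0 r] unfolding K_def by simp
  have K\<rho>: "cmat K *\<^sub>v (\<zeta> @\<^sub>v z) = cmat K1 *\<^sub>v (cmat M *\<^sub>v \<zeta>) + cmat K2 *\<^sub>v z"
    if \<zeta>: "\<zeta> \<in> carrier_vec N" and z: "z \<in> carrier_vec r" for \<zeta> z
  proof -
    have "cmat K *\<^sub>v (\<zeta> @\<^sub>v z) = (cmat (K1 * M) *\<^sub>v \<zeta> + cmat K2 *\<^sub>v z) @\<^sub>v (cmat (0\<^sub>m 0 N) *\<^sub>v \<zeta> + cmat (0\<^sub>m 0 r) *\<^sub>v z)"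
      unfolding K_def cmat_four_block[OF K1M K2 zero_carrier_mat zero_carrier_mat]
      by (rule four_block_mat_mult_vec[of _ m N _ r _ 0]) (use K1M K2 \<zeta> z in auto)
    also have "\<dots> = cmat (K1 * M) *\<^sub>v \<zeta> + cmat K2 *\<^sub>v z"
      using K1M K2 by (intro eq_vecI) auto
    finally show ?thesis unfolding cmat_mult_vec[OF K1 M \<zeta>] .
  qed
  note obs = observer_vec[OF A B C L M Ac Bc Ec MA MB ME]
  have cM: "cmat M \<in> carrier_mat n N" using M by simp
  have EC: "Ec * C \<in> carrier_mat N n" and GC: "G2 * C \<in> carrier_mat r n" using Ec G2 C by auto
  have ECM: "Ec * C * M \<in> carrier_mat N N" using EC M by auto
  have Bc': "Bc @\<^sub>r 0\<^sub>m r m \<in> carrier_mat (N + r) m" using carrier_append_rows[OF Bc] by simp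
  show "hurwitz (four_block_mat (Ac + Ec * C * M) (0\<^sub>m N r) (G2 * C * M) G1 + (Bc @\<^sub>r 0\<^sub>m r m) * K)"
  proof (rule hurwitzI)
    show "four_block_mat (Ac + Ec * C * M) (0\<^sub>m N r) (G2 * C * M) G1 + (Bc @\<^sub>r 0\<^sub>m r m) * K \<in> carrier_mat (N + r) (N + r)"
      by (rule add_carrier_mat[OF mult_carrier_mat[OF Bc' K]])
    fix v \<mu> assume v: "v \<in> carrier_vec (N + r)" "v \<noteq> 0\<^sub>v (N + r)"
      and ev: "cmat (four_block_mat (Ac + Ec * C * M) (0\<^sub>m N r) (G2 * C * M) G1 + (Bc @\<^sub>r 0\<^sub>m r m) * K) *\<^sub>v v = \<mu> \<cdot>\<^sub>v v"
    obtain \<zeta> z where \<zeta>: "\<zeta> \<in> carrier_vec N" and z: "z \<in> carrier_vec r" and vz: "v = \<zeta> @\<^sub>v z"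
      using append_vec_split[OF v(1)] by blast
    define x where "x = cmat M *\<^sub>v \<zeta>"
    have x: "x \<in> carrier_vec n" using M \<zeta> unfolding x_def by auto
    define u where "u = cmat K1 *\<^sub>v x + cmat K2 *\<^sub>v z"
    have u: "u \<in> carrier_vec m" using K1 K2 x z unfolding u_def by auto
    have cv: "cmat Ac *\<^sub>v \<zeta> \<in> carrier_vec N" "cmat Ec *\<^sub>v (cmat C *\<^sub>v x) \<in> carrier_vec N" "cmat Bc *\<^sub>v u \<in> carrier_vec N"
      "cmat C *\<^sub>v x \<in> carrier_vec p" "cmat A *\<^sub>v x \<in> carrier_vec n" "cmat B *\<^sub>v u \<in> carrier_vec n"
      using A B C Ac Ec Bc \<zeta> x u by auto
    have "(cmat Ac *\<^sub>v \<zeta> + cmat Ec *\<^sub>v (cmat C *\<^sub>v x) + cmat Bc *\<^sub>v u) @\<^sub>v (cmat G2 *\<^sub>v (cmat C *\<^sub>v x) + cmat G1 *\<^sub>v z)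
        = (\<mu> \<cdot>\<^sub>v \<zeta>) @\<^sub>v (\<mu> \<cdot>\<^sub>v z)"
      using ev rho_action[OF C M Ac Bc Ec G1 G2 K \<zeta> z] K\<rho>[OF \<zeta> z]
      unfolding vz x_def[symmetric] u_def[symmetric] smult_append_vec by simp
    then have e1: "cmat Ac *\<^sub>v \<zeta> + cmat Ec *\<^sub>v (cmat C *\<^sub>v x) + cmat Bc *\<^sub>v u = \<mu> \<cdot>\<^sub>v \<zeta>"
      and e2: "cmat G2 *\<^sub>v (cmat C *\<^sub>v x) + cmat G1 *\<^sub>v z = \<mu> \<cdot>\<^sub>v z"
      using append_vec_eq[of "cmat Ac *\<^sub>v \<zeta> + cmat Ec *\<^sub>v (cmat C *\<^sub>v x) + cmat Bc *\<^sub>v u" N "\<mu> \<cdot>\<^sub>v \<zeta>"] cv \<zeta> by auto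
    have "cmat M *\<^sub>v (\<mu> \<cdot>\<^sub>v \<zeta>) = cmat M *\<^sub>v (cmat Ac *\<^sub>v \<zeta>) + cmat M *\<^sub>v (cmat Ec *\<^sub>v (cmat C *\<^sub>v x)) + cmat M *\<^sub>v (cmat Bc *\<^sub>v u)"
      unfolding e1[symmetric] mult_add_distrib_mat_vec[OF cM add_carrier_vec[OF cv(1,2)] cv(3)]
        mult_add_distrib_mat_vec[OF cM cv(1,2)] ..
    also have "\<dots> = cmat A *\<^sub>v x - cmat L *\<^sub>v (cmat C *\<^sub>v x) + cmat L *\<^sub>v (cmat C *\<^sub>v x) + cmat B *\<^sub>v u"
      unfolding obs(1)[OF \<zeta>] obs(2)[OF u] obs(3)[OF cv(4)] x_def[symmetric] ..
    also have "\<dots> = cmat A *\<^sub>v x + cmat B *\<^sub>v u"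
      using A B C L x u by (intro eq_vecI) (simp_all del: index_mult_mat_vec)
    finally have ex: "cmat A *\<^sub>v x + cmat B *\<^sub>v u = \<mu> \<cdot>\<^sub>v x"
      using mult_mat_vec[of "cmat M" n N \<zeta> \<mu>] M \<zeta> unfolding x_def by simp
    show "Re \<mu> < 0"
    proof (cases "x = 0\<^sub>v n \<and> z = 0\<^sub>v r")
      case False
      then show ?thesis using gains[OF x z False ex[unfolded u_def] e2] by simp
    next
      case True
      have u0: "u = 0\<^sub>v m"
        using True K1 K2 mult_mat_zero_vec[of "cmat K1" m n] mult_mat_zero_vec[of "cmat K2" m r] unfolding u_def by simp
      have "cmat C *\<^sub>v x = 0\<^sub>v p" using True C mult_mat_zero_vec[of "cmat C" p n] by simp
      then have "cmat Ac *\<^sub>v \<zeta> = \<mu> \<cdot>\<^sub>v \<zeta>"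
        using e1 u0 Ec Bc cv(1) mult_mat_zero_vec[of "cmat Ec" N p] mult_mat_zero_vec[of "cmat Bc" N m] by simp
      moreover have "\<zeta> \<noteq> 0\<^sub>v N" using v(2) True unfolding vz by (auto simp: zero_append_vec)
      ultimately show ?thesis using stable \<zeta> by blast
    qed
  qed
qed

text \<open>Separation of observation and control. For an eigenvector \<open>(x, \<zeta>, z)\<close> the observer error
\<open>\<epsilon> = M \<zeta> - x\<close> satisfies \<open>(A - L C) \<epsilon> = \<mu> \<epsilon>\<close>. If \<open>\<epsilon> = 0\<close>, the measured output is \<open>C M \<zeta>\<close> and
\<open>(\<zeta>, z)\<close> is an eigenvector of the controlled system in \<open>\<rho>\<close>.\<close>

lemma closed_loop_hurwitz:
  fixes A B C L M Ac Bc Ec G1 G2 K :: "real mat"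
  assumes A: "A \<in> carrier_mat n n" and B: "B \<in> carrier_mat n m" and C: "C \<in> carrier_mat p n"
    and L: "L \<in> carrier_mat n p" and M: "M \<in> carrier_mat n N"
    and Ac: "Ac \<in> carrier_mat N N" and Bc: "Bc \<in> carrier_mat N m" and Ec: "Ec \<in> carrier_mat N p"
    and MA: "M * Ac = (A - L * C) * M" and MB: "M * Bc = B" and ME: "M * Ec = L"
    and G1: "G1 \<in> carrier_mat r r" and G2: "G2 \<in> carrier_mat r p" and K: "K \<in> carrier_mat m (N + r)"
    and hurL: "hurwitz (A - L * C)"
    and hurK: "hurwitz (four_block_mat (Ac + Ec * C * M) (0\<^sub>m N r) (G2 * C * M) G1 + (Bc @\<^sub>r 0\<^sub>m r m) * K)"
  shows "hurwitz (closed_loop_mat A B C Ac Bc Ec G1 G2 K)"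
proof (rule hurwitzI[OF closed_loop_mat_carrier[OF A B C Ac Bc Ec G1 G2 K]])
  note obs = observer_vec[OF A B C L M Ac Bc Ec MA MB ME]
  have cM: "cmat M \<in> carrier_mat n N" using M by simp
  have cc: "cmat A \<in> carrier_mat n n" "cmat B \<in> carrier_mat n m" "cmat C \<in> carrier_mat p n" "cmat Ac \<in> carrier_mat N N"
    "cmat Bc \<in> carrier_mat N m" "cmat Ec \<in> carrier_mat N p" "cmat G1 \<in> carrier_mat r r" "cmat G2 \<in> carrier_mat r p"
    "cmat K \<in> carrier_mat m (N + r)" using A B C Ac Bc Ec G1 G2 K by auto
  have Bc': "Bc @\<^sub>r 0\<^sub>m r m \<in> carrier_mat (N + r) m" using carrier_append_rows[OF Bc] by simp
  have Rc: "four_block_mat (Ac + Ec * C * M) (0\<^sub>m N r) (G2 * C * M) G1 + (Bc @\<^sub>r 0\<^sub>m r m) * K \<in> carrier_mat (N + r) (N + r)"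
    by (rule add_carrier_mat[OF mult_carrier_mat[OF Bc' K]])
  have LC: "A - L * C \<in> carrier_mat n n" using mult_carrier_mat[OF L C] by (rule minus_carrier_mat)
  fix v \<mu> assume v: "v \<in> carrier_vec (n + (N + r))" "v \<noteq> 0\<^sub>v (n + (N + r))"
    and ev: "cmat (closed_loop_mat A B C Ac Bc Ec G1 G2 K) *\<^sub>v v = \<mu> \<cdot>\<^sub>v v"
  obtain x \<rho> where x: "x \<in> carrier_vec n" and \<rho>: "\<rho> \<in> carrier_vec (N + r)" and vx: "v = x @\<^sub>v \<rho>"
    using append_vec_split[OF v(1)] by blast
  obtain \<zeta> z where \<zeta>: "\<zeta> \<in> carrier_vec N" and z: "z \<in> carrier_vec r" and \<rho>z: "\<rho> = \<zeta> @\<^sub>v z"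
    using append_vec_split[OF \<rho>] by blast
  define u where "u = cmat K *\<^sub>v (\<zeta> @\<^sub>v z)"
  define y where "y = cmat C *\<^sub>v x"
  define xh where "xh = cmat M *\<^sub>v \<zeta>"
  have u: "u \<in> carrier_vec m" using cc(9) \<rho> unfolding u_def \<rho>z by auto
  have y: "y \<in> carrier_vec p" and xh: "xh \<in> carrier_vec n" using cc M x \<zeta> unfolding y_def xh_def by auto
  have cv: "cmat Ac *\<^sub>v \<zeta> \<in> carrier_vec N" "cmat Ec *\<^sub>v y \<in> carrier_vec N" "cmat Bc *\<^sub>v u \<in> carrier_vec N"
      "cmat A *\<^sub>v x \<in> carrier_vec n" "cmat B *\<^sub>v u \<in> carrier_vec n" "cmat L *\<^sub>v y \<in> carrier_vec n"
      "cmat A *\<^sub>v xh \<in> carrier_vec n" "cmat L *\<^sub>v (cmat C *\<^sub>v xh) \<in> carrier_vec n"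
      using A B C L Ac Ec Bc \<zeta> x u y xh by auto
  have "(cmat A *\<^sub>v x + cmat B *\<^sub>v u) @\<^sub>v ((cmat Ac *\<^sub>v \<zeta> + cmat Bc *\<^sub>v u + cmat Ec *\<^sub>v y) @\<^sub>v (cmat G1 *\<^sub>v z + cmat G2 *\<^sub>v y))
      = (\<mu> \<cdot>\<^sub>v x) @\<^sub>v ((\<mu> \<cdot>\<^sub>v \<zeta>) @\<^sub>v (\<mu> \<cdot>\<^sub>v z))"
    using ev closed_loop_mat(2)[OF cc x \<zeta> z]
    unfolding cmat_closed_loop_mat[OF A B C Ac Bc Ec G1 G2 K] vx \<rho>z u_def y_def smult_append_vec by simp
  then have e1: "cmat A *\<^sub>v x + cmat B *\<^sub>v u = \<mu> \<cdot>\<^sub>v x"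
    and e2: "cmat Ac *\<^sub>v \<zeta> + cmat Bc *\<^sub>v u + cmat Ec *\<^sub>v y = \<mu> \<cdot>\<^sub>v \<zeta>"
    and e3: "cmat G1 *\<^sub>v z + cmat G2 *\<^sub>v y = \<mu> \<cdot>\<^sub>v z"
    using append_vec_eq[of "cmat A *\<^sub>v x + cmat B *\<^sub>v u" n "\<mu> \<cdot>\<^sub>v x"]
      append_vec_eq[of "cmat Ac *\<^sub>v \<zeta> + cmat Bc *\<^sub>v u + cmat Ec *\<^sub>v y" N "\<mu> \<cdot>\<^sub>v \<zeta>"] cv x \<zeta> by auto
  define \<epsilon> where "\<epsilon> = xh - x"
  have \<epsilon>: "\<epsilon> \<in> carrier_vec n" using xh x unfolding \<epsilon>_def by auto
  have exh: "\<mu> \<cdot>\<^sub>v xh = cmat A *\<^sub>v xh - cmat L *\<^sub>v (cmat C *\<^sub>v xh) + cmat B *\<^sub>v u + cmat L *\<^sub>v y"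
  proof -
    have "\<mu> \<cdot>\<^sub>v xh = cmat M *\<^sub>v (\<mu> \<cdot>\<^sub>v \<zeta>)" using mult_mat_vec[of "cmat M" n N \<zeta> \<mu>] M \<zeta> unfolding xh_def by simp
    also have "\<dots> = cmat M *\<^sub>v (cmat Ac *\<^sub>v \<zeta>) + cmat M *\<^sub>v (cmat Bc *\<^sub>v u) + cmat M *\<^sub>v (cmat Ec *\<^sub>v y)"
      unfolding e2[symmetric] mult_add_distrib_mat_vec[OF cM add_carrier_vec[OF cv(1,3)] cv(2)]
        mult_add_distrib_mat_vec[OF cM cv(1,3)] ..
    also have "\<dots> = cmat A *\<^sub>v xh - cmat L *\<^sub>v (cmat C *\<^sub>v xh) + cmat B *\<^sub>v u + cmat L *\<^sub>v y"
      unfolding obs(1)[OF \<zeta>] obs(2)[OF u] obs(3)[OF y] xh_def[symmetric] ..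
    finally show ?thesis .
  qed
  have "cmat (A - L * C) *\<^sub>v \<epsilon> = \<mu> \<cdot>\<^sub>v \<epsilon>"
  proof -
    have "cmat (A - L * C) *\<^sub>v \<epsilon> = cmat (A - L * C) *\<^sub>v xh - cmat (A - L * C) *\<^sub>v x"
      unfolding \<epsilon>_def using mult_minus_distrib_mat_vec[of "cmat (A - L * C)" n n xh x] LC xh x by simp
    also have "\<dots> = (cmat A *\<^sub>v xh - cmat L *\<^sub>v (cmat C *\<^sub>v xh)) - (cmat A *\<^sub>v x - cmat L *\<^sub>v y)"
      unfolding obs(4)[OF xh] obs(4)[OF x] y_def ..
    also have "\<dots> = \<mu> \<cdot>\<^sub>v xh - \<mu> \<cdot>\<^sub>v x"
      unfolding exh e1[symmetric] using A B C L x xh u y by (intro eq_vecI) (simp_all del: index_mult_mat_vec)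
    also have "\<dots> = \<mu> \<cdot>\<^sub>v \<epsilon>" unfolding \<epsilon>_def using xh x by (intro eq_vecI) (simp_all add: right_diff_distrib)
    finally show ?thesis .
  qed
  then have ecase: "\<epsilon> \<noteq> 0\<^sub>v n \<Longrightarrow> Re \<mu> < 0" using hurwitzD[OF hurL LC \<epsilon>] by blast
  show "Re \<mu> < 0"
  proof (cases "\<epsilon> = 0\<^sub>v n")
    case True
    have xx: "xh = x"
    proof (rule eq_vecI)
      fix i assume "i < dim_vec x"
      then show "xh $ i = x $ i" using arg_cong[OF True, of "\<lambda>v. v $ i"] x xh unfolding \<epsilon>_def by simp
    qed (use x xh in simp)
    have sum1: "cmat Ac *\<^sub>v \<zeta> + cmat Ec *\<^sub>v y + cmat Bc *\<^sub>v u = \<mu> \<cdot>\<^sub>v \<zeta>"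
      unfolding e2[symmetric] using Ac Bc Ec by (intro eq_vecI) (simp_all del: index_mult_mat_vec)
    have sum2: "cmat G2 *\<^sub>v y + cmat G1 *\<^sub>v z = \<mu> \<cdot>\<^sub>v z"
      unfolding e3[symmetric] using G1 G2 y z by (intro comm_add_vec[of _ r]) auto
    have yx: "cmat C *\<^sub>v (cmat M *\<^sub>v \<zeta>) = y" unfolding xh_def[symmetric] xx y_def ..
    have "cmat (four_block_mat (Ac + Ec * C * M) (0\<^sub>m N r) (G2 * C * M) G1 + (Bc @\<^sub>r 0\<^sub>m r m) * K) *\<^sub>v (\<zeta> @\<^sub>v z) = \<mu> \<cdot>\<^sub>v (\<zeta> @\<^sub>v z)"
      unfolding rho_action[OF C M Ac Bc Ec G1 G2 K \<zeta> z] yx u_def[symmetric] sum1 sum2 smult_append_vec ..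
    moreover have "\<zeta> @\<^sub>v z \<noteq> 0\<^sub>v (N + r)"
    proof
      assume z0: "\<zeta> @\<^sub>v z = 0\<^sub>v (N + r)"
      then have "\<zeta> @\<^sub>v z = 0\<^sub>v N @\<^sub>v 0\<^sub>v r" unfolding zero_append_vec .
      then have "\<zeta> = 0\<^sub>v N" using append_vec_eq[OF \<zeta> zero_carrier_vec] by blast
      then have "x = 0\<^sub>v n" using xx M mult_mat_zero_vec[of "cmat M" n N] unfolding xh_def by simp
      then show False using v(2) z0 unfolding vx \<rho>z by (simp add: zero_append_vec)
    qed
    ultimately show ?thesis using hurwitzD[OF hurK Rc] \<rho> unfolding \<rho>z by blast
  qed (rule ecase)
qed

section \<open>Trajectories and output regulation\<close>

lemma has_vec_deriv_append:
  assumes x: "\<And>\<tau>. 0 \<le> \<tau> \<Longrightarrow> x \<tau> \<in> carrier_vec a" "x' \<in> carrier_vec a" "has_vec_deriv x x' t"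
    and z: "\<And>\<tau>. 0 \<le> \<tau> \<Longrightarrow> z \<tau> \<in> carrier_vec b" "z' \<in> carrier_vec b" "has_vec_deriv z z' t"
    and t: "0 \<le> t"
  shows "has_vec_deriv (\<lambda>\<tau>. x \<tau> @\<^sub>v z \<tau>) (x' @\<^sub>v z') t"
  unfolding has_vec_deriv_def
proof (intro allI impI)
  fix i assume "i < dim_vec (x' @\<^sub>v z')"
  then have i: "i < a + b" using x(2) z(2) by simp
  show "((\<lambda>\<tau>. (x \<tau> @\<^sub>v z \<tau>) $ i) has_real_derivative (x' @\<^sub>v z') $ i) (at t within {0..})"
  proof (cases "i < a")
    case True
    have "((\<lambda>\<tau>. x \<tau> $ i) has_real_derivative x' $ i) (at t within {0..})"
      using x(2,3) True unfolding has_vec_deriv_def by auto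
    then have "((\<lambda>\<tau>. (x \<tau> @\<^sub>v z \<tau>) $ i) has_real_derivative x' $ i) (at t within {0..})"
      by (rule has_field_derivative_transform_within[of _ _ _ _ 1])
        (use t i True carrier_vecD[OF x(1)] carrier_vecD[OF z(1)] in auto)
    then show ?thesis using True i x(2) z(2) by simp
  next
    case False
    have "((\<lambda>\<tau>. z \<tau> $ (i - a)) has_real_derivative z' $ (i - a)) (at t within {0..})"
      using z(2,3) False i unfolding has_vec_deriv_def by auto
    then have "((\<lambda>\<tau>. (x \<tau> @\<^sub>v z \<tau>) $ i) has_real_derivative z' $ (i - a)) (at t within {0..})"
      by (rule has_field_derivative_transform_within[of _ _ _ _ 1])
        (use t i False carrier_vecD[OF x(1)] carrier_vecD[OF z(1)] in auto)
    then show ?thesis using False i x(2) z(2) by simp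
  qed
qed

lemma has_vec_deriv_minus_mult:
  assumes \<xi>: "\<And>\<tau>. 0 \<le> \<tau> \<Longrightarrow> \<xi> \<tau> \<in> carrier_vec a" "\<xi>' \<in> carrier_vec a" "has_vec_deriv \<xi> \<xi>' t"
    and v: "\<And>\<tau>. 0 \<le> \<tau> \<Longrightarrow> v \<tau> \<in> carrier_vec q" "v' \<in> carrier_vec q" "has_vec_deriv v v' t"
    and Q: "Q \<in> carrier_mat a q" and t: "0 \<le> t"
  shows "has_vec_deriv (\<lambda>\<tau>. \<xi> \<tau> - Q *\<^sub>v v \<tau>) (\<xi>' - Q *\<^sub>v v') t"
  unfolding has_vec_deriv_def
proof (intro allI impI)
  fix i assume "i < dim_vec (\<xi>' - Q *\<^sub>v v')"
  then have i: "i < a" using Q by simp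
  have Qv: "(\<xi> - Q *\<^sub>v w) $ i = \<xi> $ i - (\<Sum>j<q. Q $$ (i, j) * w $ j)" if "w \<in> carrier_vec q" for \<xi> w
    using i Q that by (simp add: index_mult_vec_sum[of _ _ q] del: index_mult_mat_vec)
  have d1: "((\<lambda>\<tau>. \<xi> \<tau> $ i) has_real_derivative \<xi>' $ i) (at t within {0..})"
    using \<xi>(2,3) i unfolding has_vec_deriv_def by auto
  have d2: "((\<lambda>\<tau>. v \<tau> $ j) has_real_derivative v' $ j) (at t within {0..})" if "j < q" for j
    using v(2,3) that unfolding has_vec_deriv_def by auto
  have "((\<lambda>\<tau>. \<xi> \<tau> $ i - (\<Sum>j<q. Q $$ (i, j) * v \<tau> $ j)) has_real_derivative
      \<xi>' $ i - (\<Sum>j<q. Q $$ (i, j) * v' $ j)) (at t within {0..})"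
    by (intro DERIV_diff d1 DERIV_sum DERIV_cmult) (use d2 in auto)
  then have "((\<lambda>\<tau>. (\<xi> \<tau> - Q *\<^sub>v v \<tau>) $ i) has_real_derivative
      \<xi>' $ i - (\<Sum>j<q. Q $$ (i, j) * v' $ j)) (at t within {0..})"
    by (rule has_field_derivative_transform_within[of _ _ _ _ 1]) (use t Qv[OF v(1)] in auto)
  then show "((\<lambda>\<tau>. (\<xi> \<tau> - Q *\<^sub>v v \<tau>) $ i) has_real_derivative (\<xi>' - Q *\<^sub>v v') $ i) (at t within {0..})"
    unfolding Qv[OF v(2)] .
qed

text \<open>Let \<open>H\<close> be the closed-loop matrix and \<open>W\<close> the matrix through which \<open>v\<close> enters. Since \<open>H\<close> is Hurwitz
and \<open>S\<close> has no stable eigenvalue, \<open>Q S = H Q + W\<close> has a solution, and \<open>\<eta> = \<xi> - Q v\<close> obeys \<open>\<eta>' = H \<eta>\<close> and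
decays exponentially. On the graph of \<open>Q\<close> the regulated output is \<open>Gam v\<close> with \<open>Gam = C Q\<^sub>x + F\<close>; the rows of
the Sylvester identity that belong to \<open>z\<close> read \<open>Q\<^sub>z S = G1 Q\<^sub>z + G2 Gam\<close>, and the internal model forces
\<open>Gam = 0\<close>. Hence \<open>e\<close> is a linear function of \<open>\<eta>\<close>.\<close>

lemma hurwitz_imp_output_regulation:
  fixes A B C E F S Ac Bc Ec G1 G2 K :: "real mat"
  assumes A: "A \<in> carrier_mat n n" and B: "B \<in> carrier_mat n m" and C: "C \<in> carrier_mat p n"
    and E: "E \<in> carrier_mat n q" and F: "F \<in> carrier_mat p q" and S: "S \<in> carrier_mat q q" and q: "0 < q"
    and Ac: "Ac \<in> carrier_mat N N" and Bc: "Bc \<in> carrier_mat N m" and Ec: "Ec \<in> carrier_mat N p"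
    and G1: "G1 \<in> carrier_mat r r" and G2: "G2 \<in> carrier_mat r p" and K: "K \<in> carrier_mat m (N + r)"
    and exo: "\<And>\<mu>. eigenvalue (cmat S) \<mu> \<Longrightarrow> \<not> Re \<mu> < 0"
    and im: "min_internal_model S p G1 G2"
    and hur: "hurwitz (closed_loop_mat A B C Ac Bc Ec G1 G2 K)"
  shows "solves_output_regulation A B C E F S Ac Bc Ec G1 G2 K"
proof -
  let ?H = "closed_loop_mat A B C Ac Bc Ec G1 G2 K" and ?N = "n + (N + r)"
  note H = closed_loop_mat_carrier[OF A B C Ac Bc Ec G1 G2 K]
  note H_act = closed_loop_mat(2)[OF A B C Ac Bc Ec G1 G2 K]
  define W where "W = E @\<^sub>r (0\<^sub>m N q @\<^sub>r (G2 * F))"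
  have GF: "G2 * F \<in> carrier_mat r q" using G2 F by auto
  have W0: "0\<^sub>m N q @\<^sub>r (G2 * F) \<in> carrier_mat (N + r) q" using carrier_append_rows[OF zero_carrier_mat GF] .
  have W: "W \<in> carrier_mat ?N q" unfolding W_def using carrier_append_rows[OF E W0] .
  have W_act: "W *\<^sub>v w = (E *\<^sub>v w) @\<^sub>v (0\<^sub>v N @\<^sub>v (G2 *\<^sub>v (F *\<^sub>v w)))" if w: "w \<in> carrier_vec q" for w
    unfolding W_def mat_mult_append[OF E W0 w] mat_mult_append[OF zero_carrier_mat GF w] assoc_mult_mat_vec[OF G2 F w]
    zero_mat_mult_vec[OF w] ..
  obtain c \<gamma> where c: "0 < c" "0 < \<gamma>"
    and decay: "\<And>w t. (\<And>t. 0 \<le> t \<Longrightarrow> w t \<in> carrier_vec ?N \<and> has_vec_deriv w (?H *\<^sub>v w t) t) \<Longrightarrow> 0 \<le> t \<Longrightarrow>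
      vec_norm (w t) \<le> c * exp (- \<gamma> * t) * vec_norm (w 0)"
    using hurwitz_decay[OF H hur] by blast
  have sol: "x t @\<^sub>v (\<zeta> t @\<^sub>v z t) \<in> carrier_vec ?N \<and> x t \<in> carrier_vec n \<and> \<zeta> t \<in> carrier_vec N \<and> z t \<in> carrier_vec r \<and> v t \<in> carrier_vec q \<and>
      has_vec_deriv v (S *\<^sub>v v t) t \<and>
      has_vec_deriv (\<lambda>t. x t @\<^sub>v (\<zeta> t @\<^sub>v z t)) (?H *\<^sub>v (x t @\<^sub>v (\<zeta> t @\<^sub>v z t)) + W *\<^sub>v v t) t"
    if cl: "closed_loop_solution A B C E F S Ac Bc Ec G1 G2 K x \<zeta> z v" and t: "0 \<le> t" for x \<zeta> z v t
  proof -
    have cx: "x t \<in> carrier_vec n" and c\<zeta>: "\<zeta> t \<in> carrier_vec N" and cz: "z t \<in> carrier_vec r" and cv: "v t \<in> carrier_vec q"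
      if "0 \<le> t" for t using cl that A Ac G1 S unfolding closed_loop_solution_def by auto
    let ?u = "K *\<^sub>v (\<zeta> t @\<^sub>v z t)" and ?y = "C *\<^sub>v x t" and ?e = "C *\<^sub>v x t + F *\<^sub>v v t"
    have dx: "has_vec_deriv x (A *\<^sub>v x t + B *\<^sub>v ?u + E *\<^sub>v v t) t"
      and d\<zeta>: "has_vec_deriv \<zeta> (Ac *\<^sub>v \<zeta> t + Bc *\<^sub>v ?u + Ec *\<^sub>v ?y) t"
      and dz: "has_vec_deriv z (G1 *\<^sub>v z t + G2 *\<^sub>v ?e) t" and dv: "has_vec_deriv v (S *\<^sub>v v t) t"
      using cl t unfolding closed_loop_solution_def Let_def by auto
    have u: "?u \<in> carrier_vec m" using K c\<zeta>[OF t] cz[OF t] by auto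
    have cc: "A *\<^sub>v x t + B *\<^sub>v ?u \<in> carrier_vec n" "E *\<^sub>v v t \<in> carrier_vec n"
      "Ac *\<^sub>v \<zeta> t + Bc *\<^sub>v ?u + Ec *\<^sub>v ?y \<in> carrier_vec N" "G1 *\<^sub>v z t \<in> carrier_vec r" "G2 *\<^sub>v ?y \<in> carrier_vec r"
      "G2 *\<^sub>v (F *\<^sub>v v t) \<in> carrier_vec r" "G1 *\<^sub>v z t + G2 *\<^sub>v ?e \<in> carrier_vec r"
      using A B E Ac Bc Ec C G1 G2 F cx[OF t] c\<zeta>[OF t] cz[OF t] cv[OF t] u by auto
    have "G2 *\<^sub>v ?e = G2 *\<^sub>v ?y + G2 *\<^sub>v (F *\<^sub>v v t)"
      using mult_add_distrib_mat_vec[OF G2, of ?y "F *\<^sub>v v t"] C F cx[OF t] cv[OF t] by simp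
    then have "G1 *\<^sub>v z t + G2 *\<^sub>v ?e = (G1 *\<^sub>v z t + G2 *\<^sub>v ?y) + G2 *\<^sub>v (F *\<^sub>v v t)"
      using cc by (simp add: assoc_add_vec[of _ r])
    then have "(A *\<^sub>v x t + B *\<^sub>v ?u + E *\<^sub>v v t) @\<^sub>v ((Ac *\<^sub>v \<zeta> t + Bc *\<^sub>v ?u + Ec *\<^sub>v ?y) @\<^sub>v (G1 *\<^sub>v z t + G2 *\<^sub>v ?e)) =
        ?H *\<^sub>v (x t @\<^sub>v (\<zeta> t @\<^sub>v z t)) + W *\<^sub>v v t"
      unfolding H_act[OF cx[OF t] c\<zeta>[OF t] cz[OF t]] W_act[OF cv[OF t]]
      using cc append_vec_add[of "A *\<^sub>v x t + B *\<^sub>v ?u" n "E *\<^sub>v v t"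
          "(Ac *\<^sub>v \<zeta> t + Bc *\<^sub>v ?u + Ec *\<^sub>v ?y) @\<^sub>v (G1 *\<^sub>v z t + G2 *\<^sub>v ?y)" "N + r" "0\<^sub>v N @\<^sub>v (G2 *\<^sub>v (F *\<^sub>v v t))"]
        append_vec_add[of "Ac *\<^sub>v \<zeta> t + Bc *\<^sub>v ?u + Ec *\<^sub>v ?y" N "0\<^sub>v N" "G1 *\<^sub>v z t + G2 *\<^sub>v ?y" r "G2 *\<^sub>v (F *\<^sub>v v t)"]
      by simp
    moreover have "has_vec_deriv (\<lambda>t. x t @\<^sub>v (\<zeta> t @\<^sub>v z t))
        ((A *\<^sub>v x t + B *\<^sub>v ?u + E *\<^sub>v v t) @\<^sub>v ((Ac *\<^sub>v \<zeta> t + Bc *\<^sub>v ?u + Ec *\<^sub>v ?y) @\<^sub>v (G1 *\<^sub>v z t + G2 *\<^sub>v ?e))) t"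
      using cc dx d\<zeta> dz t cx c\<zeta> cz by (intro has_vec_deriv_append[of _ n _ _ _ "N + r"] has_vec_deriv_append[of _ N _ _ _ r]) auto
    ultimately show ?thesis using cx[OF t] c\<zeta>[OF t] cz[OF t] cv[OF t] dv by auto
  qed
  have stable: "vec_norm (x t @\<^sub>v \<zeta> t @\<^sub>v z t) \<le> c * exp (- \<gamma> * t) * vec_norm (x 0 @\<^sub>v \<zeta> 0 @\<^sub>v z 0)"
    if cl: "closed_loop_solution A B C E F S Ac Bc Ec G1 G2 K x \<zeta> z (\<lambda>_. 0\<^sub>v (dim_row S))" and t: "0 \<le> t" for x \<zeta> z t
  proof (rule decay[OF _ t])
    fix t :: real assume t: "0 \<le> t"
    have "W *\<^sub>v 0\<^sub>v (dim_row S) = 0\<^sub>v ?N" using mult_mat_zero_vec[OF W] S by simp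
    then show "x t @\<^sub>v \<zeta> t @\<^sub>v z t \<in> carrier_vec ?N \<and> has_vec_deriv (\<lambda>t. x t @\<^sub>v \<zeta> t @\<^sub>v z t) (?H *\<^sub>v (x t @\<^sub>v \<zeta> t @\<^sub>v z t)) t"
      using sol[OF cl t] mult_mat_vec_carrier[OF H, of "x t @\<^sub>v \<zeta> t @\<^sub>v z t"] by simp
  qed
  have disj: "False" if "eigenvalue (cmat ?H) \<mu>" "eigenvalue (cmat S) \<mu>" for \<mu>
    using that exo hur unfolding hurwitz_def by blast
  obtain Q where Q: "Q \<in> carrier_mat ?N q" and syl: "Q * S - ?H * Q = W"
    by (rule sylvester_real[OF H S W disj])
  define Qx where "Qx = mat n q (\<lambda>(i, j). Q $$ (i, j))"
  define Q\<zeta> where "Q\<zeta> = mat N q (\<lambda>(i, j). Q $$ (n + i, j))"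
  define Qz where "Qz = mat r q (\<lambda>(i, j). Q $$ (n + (N + i), j))"
  have Qs: "Qx \<in> carrier_mat n q" "Q\<zeta> \<in> carrier_mat N q" "Qz \<in> carrier_mat r q"
    unfolding Qx_def Q\<zeta>_def Qz_def by auto
  have Q_act: "Q *\<^sub>v w = (Qx *\<^sub>v w) @\<^sub>v ((Q\<zeta> *\<^sub>v w) @\<^sub>v (Qz *\<^sub>v w))" if w: "w \<in> carrier_vec q" for w
  proof (rule eq_vecI)
    fix i assume "i < dim_vec ((Qx *\<^sub>v w) @\<^sub>v ((Q\<zeta> *\<^sub>v w) @\<^sub>v (Qz *\<^sub>v w)))"
    then have i: "i < n + (N + r)" using Qs by simp
    show "(Q *\<^sub>v w) $ i = ((Qx *\<^sub>v w) @\<^sub>v ((Q\<zeta> *\<^sub>v w) @\<^sub>v (Qz *\<^sub>v w))) $ i"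
    proof -
      consider "i < n" | "n \<le> i" "i < n + N" | "n + N \<le> i" by linarith
      then show ?thesis
        using i Q w unfolding Qx_def Q\<zeta>_def Qz_def
        by cases (simp_all add: index_mult_vec_sum[of _ _ q] del: index_mult_mat_vec)
    qed
  qed (use Q Qs in simp)
  define Gam where "Gam = C * Qx + F"
  have Gam: "Gam \<in> carrier_mat p q" unfolding Gam_def using C Qs F by auto
  have QS: "Q *\<^sub>v (S *\<^sub>v w) = ?H *\<^sub>v (Q *\<^sub>v w) + W *\<^sub>v w" if w: "w \<in> carrier_vec q" for w
  proof -
    have HQ: "?H * Q \<in> carrier_mat ?N q" using H Q by auto
    have "Q * S = ?H * Q + W"
      unfolding syl[symmetric] by (rule add_minus_cancel_mat[OF mult_carrier_mat[OF Q S] HQ, symmetric])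
    then show ?thesis
      using assoc_mult_mat_vec[OF Q S w] add_mult_distrib_mat_vec[OF HQ W w] assoc_mult_mat_vec[OF H Q w] by simp
  qed
  have "Qz * S = G1 * Qz + G2 * Gam"
  proof (rule mat_eq_by_vec[of _ r q])
    fix w :: "real vec" assume w: "w \<in> carrier_vec q"
    let ?a = "Qx *\<^sub>v w" and ?b = "Q\<zeta> *\<^sub>v w" and ?c = "Qz *\<^sub>v w"
    have abc: "?a \<in> carrier_vec n" "?b \<in> carrier_vec N" "?c \<in> carrier_vec r" using Qs w by auto
    have Sw: "S *\<^sub>v w \<in> carrier_vec q" using S w by auto
    let ?u = "K *\<^sub>v (?b @\<^sub>v ?c)"
    have u: "?u \<in> carrier_vec m" using K abc by auto
    have cc: "A *\<^sub>v ?a + B *\<^sub>v ?u \<in> carrier_vec n" "E *\<^sub>v w \<in> carrier_vec n"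
      "Ac *\<^sub>v ?b + Bc *\<^sub>v ?u + Ec *\<^sub>v (C *\<^sub>v ?a) \<in> carrier_vec N" "G1 *\<^sub>v ?c \<in> carrier_vec r" "G2 *\<^sub>v (C *\<^sub>v ?a) \<in> carrier_vec r"
      "G2 *\<^sub>v (F *\<^sub>v w) \<in> carrier_vec r" "Qx *\<^sub>v (S *\<^sub>v w) \<in> carrier_vec n" "Q\<zeta> *\<^sub>v (S *\<^sub>v w) \<in> carrier_vec N"
      using A B E Ac Bc Ec C G1 G2 F abc w u Qs Sw by auto
    have "(Qx *\<^sub>v (S *\<^sub>v w)) @\<^sub>v ((Q\<zeta> *\<^sub>v (S *\<^sub>v w)) @\<^sub>v (Qz *\<^sub>v (S *\<^sub>v w))) =
        (A *\<^sub>v ?a + B *\<^sub>v ?u + E *\<^sub>v w) @\<^sub>v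
        ((Ac *\<^sub>v ?b + Bc *\<^sub>v ?u + Ec *\<^sub>v (C *\<^sub>v ?a) + 0\<^sub>v N) @\<^sub>v (G1 *\<^sub>v ?c + G2 *\<^sub>v (C *\<^sub>v ?a) + G2 *\<^sub>v (F *\<^sub>v w)))"
      using QS[OF w] cc append_vec_add[of "A *\<^sub>v ?a + B *\<^sub>v ?u" n "E *\<^sub>v w"
          "(Ac *\<^sub>v ?b + Bc *\<^sub>v ?u + Ec *\<^sub>v (C *\<^sub>v ?a)) @\<^sub>v (G1 *\<^sub>v ?c + G2 *\<^sub>v (C *\<^sub>v ?a))" "N + r" "0\<^sub>v N @\<^sub>v (G2 *\<^sub>v (F *\<^sub>v w))"]
        append_vec_add[of "Ac *\<^sub>v ?b + Bc *\<^sub>v ?u + Ec *\<^sub>v (C *\<^sub>v ?a)" N "0\<^sub>v N" "G1 *\<^sub>v ?c + G2 *\<^sub>v (C *\<^sub>v ?a)" r "G2 *\<^sub>v (F *\<^sub>v w)"]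
      unfolding Q_act[OF Sw] Q_act[OF w] H_act[OF abc] W_act[OF w] by simp
    then have "(Q\<zeta> *\<^sub>v (S *\<^sub>v w)) @\<^sub>v (Qz *\<^sub>v (S *\<^sub>v w)) =
        (Ac *\<^sub>v ?b + Bc *\<^sub>v ?u + Ec *\<^sub>v (C *\<^sub>v ?a) + 0\<^sub>v N) @\<^sub>v (G1 *\<^sub>v ?c + G2 *\<^sub>v (C *\<^sub>v ?a) + G2 *\<^sub>v (F *\<^sub>v w))"
      using append_vec_eq[OF cc(7) add_carrier_vec[OF cc(1,2)]] by blast
    then have Qz: "Qz *\<^sub>v (S *\<^sub>v w) = G1 *\<^sub>v ?c + G2 *\<^sub>v (C *\<^sub>v ?a) + G2 *\<^sub>v (F *\<^sub>v w)"
      using append_vec_eq[OF cc(8) add_carrier_vec[OF cc(3) zero_carrier_vec]] by blast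
    have Gw: "Gam *\<^sub>v w = C *\<^sub>v ?a + F *\<^sub>v w"
      unfolding Gam_def using add_mult_distrib_mat_vec[OF mult_carrier_mat[OF C Qs(1)] F w] assoc_mult_mat_vec[OF C Qs(1) w] by simp
    have "(G1 * Qz + G2 * Gam) *\<^sub>v w = G1 *\<^sub>v ?c + G2 *\<^sub>v (C *\<^sub>v ?a + F *\<^sub>v w)"
      using add_mult_distrib_mat_vec[OF mult_carrier_mat[OF G1 Qs(3)] mult_carrier_mat[OF G2 Gam] w]
        assoc_mult_mat_vec[OF G1 Qs(3) w] assoc_mult_mat_vec[OF G2 Gam w] Gw by simp
    also have "\<dots> = G1 *\<^sub>v ?c + (G2 *\<^sub>v (C *\<^sub>v ?a) + G2 *\<^sub>v (F *\<^sub>v w))"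
      using mult_add_distrib_mat_vec[OF G2, of "C *\<^sub>v ?a" "F *\<^sub>v w"] C F abc w by simp
    also have "\<dots> = Qz *\<^sub>v (S *\<^sub>v w)" unfolding Qz using cc by (simp add: assoc_add_vec[of _ r])
    finally show "(Qz * S) *\<^sub>v w = (G1 * Qz + G2 * Gam) *\<^sub>v w"
      using assoc_mult_mat_vec[OF Qs(3) S w] by simp
  qed (use Qs S G1 G2 Gam in auto)
  then have Gam0: "Gam = 0\<^sub>m p q" by (rule internal_model_regulates[OF im S q G1 Qs(3) Gam])
  have regulated: "((\<lambda>t. vec_norm (C *\<^sub>v x t + F *\<^sub>v v t)) \<longlongrightarrow> 0) at_top"
    if cl: "closed_loop_solution A B C E F S Ac Bc Ec G1 G2 K x \<zeta> z v" for x \<zeta> z v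
  proof -
    define \<eta> where "\<eta> t = (x t @\<^sub>v (\<zeta> t @\<^sub>v z t)) - Q *\<^sub>v v t" for t
    have \<eta>c: "\<eta> t \<in> carrier_vec ?N" if "0 \<le> t" for t
      using sol[OF cl that] Q unfolding \<eta>_def by auto
    have \<eta>d: "has_vec_deriv \<eta> (?H *\<^sub>v \<eta> t) t" if t: "0 \<le> t" for t
    proof -
      let ?\<xi> = "x t @\<^sub>v (\<zeta> t @\<^sub>v z t)"
      note st = sol[OF cl t]
      have cc: "?H *\<^sub>v ?\<xi> \<in> carrier_vec ?N" "W *\<^sub>v v t \<in> carrier_vec ?N" "?H *\<^sub>v (Q *\<^sub>v v t) \<in> carrier_vec ?N"
        using st W H Q by auto
      have "has_vec_deriv \<eta> (?H *\<^sub>v ?\<xi> + W *\<^sub>v v t - Q *\<^sub>v (S *\<^sub>v v t)) t"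
        unfolding \<eta>_def using st sol[OF cl] cc Q S t by (intro has_vec_deriv_minus_mult[of _ ?N _ _ _ q]) auto
      also have "?H *\<^sub>v ?\<xi> + W *\<^sub>v v t - Q *\<^sub>v (S *\<^sub>v v t) = ?H *\<^sub>v ?\<xi> - ?H *\<^sub>v (Q *\<^sub>v v t)"
      proof -
        have "v t \<in> carrier_vec q" using st by blast
        from QS[OF this] show ?thesis using add_minus_add_cancel_vec[OF cc(1,3,2)] by simp
      qed
      also have "\<dots> = ?H *\<^sub>v \<eta> t"
        unfolding \<eta>_def using mult_minus_distrib_mat_vec[OF H, of ?\<xi> "Q *\<^sub>v v t"] st Q by simp
      finally show ?thesis .
    qed
    have \<eta>: "vec_norm (\<eta> t) \<le> c * exp (- \<gamma> * t) * vec_norm (\<eta> 0)" if "0 \<le> t" for t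
      by (rule decay) (use \<eta>c \<eta>d that in auto)
    have err: "(C *\<^sub>v x t + F *\<^sub>v v t) $ i = (\<Sum>j<n. C $$ (i, j) * \<eta> t $ j)" if t: "0 \<le> t" and i: "i < p" for t i
    proof -
      note st = sol[OF cl t]
      have xt: "x t \<in> carrier_vec n" and vt: "v t \<in> carrier_vec q" using st by auto
      have Qv: "Qx *\<^sub>v v t \<in> carrier_vec n" using Qs vt by auto
      have "C *\<^sub>v (Qx *\<^sub>v v t) + F *\<^sub>v v t = Gam *\<^sub>v v t"
        unfolding Gam_def using add_mult_distrib_mat_vec[OF mult_carrier_mat[OF C Qs(1)] F vt] assoc_mult_mat_vec[OF C Qs(1) vt] by simp
      then have "(C *\<^sub>v (Qx *\<^sub>v v t) + F *\<^sub>v v t) $ i = 0" unfolding Gam0 using vt i by simp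
      then have "(F *\<^sub>v v t) $ i = - (C *\<^sub>v (Qx *\<^sub>v v t)) $ i"
        using C F i by (simp del: index_mult_mat_vec)
      then have "(C *\<^sub>v x t + F *\<^sub>v v t) $ i = (C *\<^sub>v x t) $ i - (C *\<^sub>v (Qx *\<^sub>v v t)) $ i"
        using C F i by (simp del: index_mult_mat_vec)
      also have "\<dots> = (\<Sum>j<n. C $$ (i, j) * x t $ j) - (\<Sum>j<n. C $$ (i, j) * (Qx *\<^sub>v v t) $ j)"
        using C i xt Qs by (simp add: index_mult_vec_sum[of _ C n] del: index_mult_mat_vec)
      also have "\<dots> = (\<Sum>j<n. C $$ (i, j) * (x t $ j - (Qx *\<^sub>v v t) $ j))"
        by (simp add: sum_subtractf right_diff_distrib)
      also have "\<dots> = (\<Sum>j<n. C $$ (i, j) * \<eta> t $ j)"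
      proof (intro sum.cong refl)
        fix j assume "j \<in> {..<n}"
        then have j: "j < n" by simp
        have "\<eta> t $ j = (x t @\<^sub>v (\<zeta> t @\<^sub>v z t)) $ j - (Q *\<^sub>v v t) $ j"
          unfolding \<eta>_def using j Q by (simp del: index_mult_mat_vec)
        then show "C $$ (i, j) * (x t $ j - (Qx *\<^sub>v v t) $ j) = C $$ (i, j) * \<eta> t $ j"
          unfolding Q_act[OF vt] using j xt Qv Qs by (simp del: index_mult_mat_vec)
      qed
      finally show ?thesis .
    qed
    define c' where "c' = (\<Sum>i<p. \<Sum>j<n. \<bar>C $$ (i, j)\<bar>) * (c * vec_norm (\<eta> 0))"
    have bound: "vec_norm (C *\<^sub>v x t + F *\<^sub>v v t) \<le> c' * exp (- \<gamma> * t)" if t: "0 \<le> t" for t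
    proof -
      have "vec_norm (C *\<^sub>v x t + F *\<^sub>v v t) \<le> (\<Sum>i<p. \<bar>(C *\<^sub>v x t + F *\<^sub>v v t) $ i\<bar>)"
        using vec_norm_le_sum[of "C *\<^sub>v x t + F *\<^sub>v v t"] F by simp
      also have "\<dots> \<le> (\<Sum>i<p. \<Sum>j<n. \<bar>C $$ (i, j)\<bar> * vec_norm (\<eta> t))"
      proof (rule sum_mono)
        fix i assume "i \<in> {..<p}"
        then have "\<bar>(C *\<^sub>v x t + F *\<^sub>v v t) $ i\<bar> = \<bar>\<Sum>j<n. C $$ (i, j) * \<eta> t $ j\<bar>" using err[OF t] by simp
        also have "\<dots> \<le> (\<Sum>j<n. \<bar>C $$ (i, j) * \<eta> t $ j\<bar>)" by (rule sum_abs)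
        also have "\<dots> \<le> (\<Sum>j<n. \<bar>C $$ (i, j)\<bar> * vec_norm (\<eta> t))"
          unfolding abs_mult using carrier_vecD[OF \<eta>c[OF t]]
          by (intro sum_mono mult_left_mono component_le_vec_norm) auto
        finally show "\<bar>(C *\<^sub>v x t + F *\<^sub>v v t) $ i\<bar> \<le> (\<Sum>j<n. \<bar>C $$ (i, j)\<bar> * vec_norm (\<eta> t))" .
      qed
      also have "\<dots> = (\<Sum>i<p. \<Sum>j<n. \<bar>C $$ (i, j)\<bar>) * vec_norm (\<eta> t)" by (simp add: sum_distrib_right)
      also have "\<dots> \<le> (\<Sum>i<p. \<Sum>j<n. \<bar>C $$ (i, j)\<bar>) * (c * exp (- \<gamma> * t) * vec_norm (\<eta> 0))"
        using \<eta>[OF t] by (intro mult_left_mono sum_nonneg) auto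
      finally show ?thesis unfolding c'_def by (simp add: ac_simps)
    qed
    have "((\<lambda>t. c' * exp (- \<gamma> * t)) \<longlongrightarrow> c' * 0) at_top"
    proof (intro tendsto_mult tendsto_const)
      have "filterlim (\<lambda>t. - \<gamma> * t) at_bot at_top"
        using c(2) by (intro filterlim_tendsto_neg_mult_at_bot[OF tendsto_const] filterlim_ident) auto
      then show "((\<lambda>t. exp (- \<gamma> * t)) \<longlongrightarrow> 0) at_top" by (rule filterlim_compose[OF exp_at_bot])
    qed
    then have lim: "((\<lambda>t. c' * exp (- \<gamma> * t)) \<longlongrightarrow> 0) at_top" by simp
    show ?thesis
    proof (rule tendsto_sandwich[OF _ _ tendsto_const lim])
      show "\<forall>\<^sub>F t in at_top. 0 \<le> vec_norm (C *\<^sub>v x t + F *\<^sub>v v t)" by (simp add: vec_norm_nonneg)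
      show "\<forall>\<^sub>F t in at_top. vec_norm (C *\<^sub>v x t + F *\<^sub>v v t) \<le> c' * exp (- \<gamma> * t)"
        using eventually_ge_at_top[of 0] by eventually_elim (rule bound)
    qed
  qed
  show ?thesis
    unfolding solves_output_regulation_def using c stable regulated by blast
qed

theorem theorem3:
  fixes A B C E F S L G1 G2 :: "real mat"
    and D :: "nat \<Rightarrow> real mat"
    and n m p q :: nat
  assumes pos: "0 < n" "0 < m" "0 < p" "0 < q"
    and dims: "A \<in> carrier_mat n n" "B \<in> carrier_mat n m" "C \<in> carrier_mat p n"
      "E \<in> carrier_mat n q" "F \<in> carrier_mat p q" "S \<in> carrier_mat q q"
    and stab: "stabilizable A B"
    and obs: "observable A C"
    and exo: "\<And>\<mu>. eigenvalue (cmat S) \<mu> \<Longrightarrow> \<not> Re \<mu> < 0"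
    and zeros: "\<And>\<mu>. eigenvalue (cmat S) \<mu> \<Longrightarrow>
      mat_rank (four_block_mat (cmat A - \<mu> \<cdot>\<^sub>m 1\<^sub>m n) (cmat B) (cmat C) (0\<^sub>m p m)) = n + p"
    and im: "min_internal_model S p G1 G2"
    and L: "L \<in> carrier_mat n p" "hurwitz (A - L * C)"
    and D: "resolvent_coeffs (A - L * C) D"
  shows "stabilizable (A_rho D A B C L G1 G2) (B_rho A B C G1) \<and>
    (\<forall>K \<in> carrier_mat m (n * (m + p) + dim_row G1).
       hurwitz (A_rho D A B C L G1 G2 + B_rho A B C G1 * K) \<longrightarrow>
       solves_output_regulation A B C E F S
         (comp_zeta A B C L) (B_zeta n m p) (E_zeta n m p) G1 G2 K)"
proof -
  obtain d where "G1 \<in> carrier_mat (p * d) (p * d)" "G2 \<in> carrier_mat (p * d) p"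
    using internal_model_dims[OF im] .
  moreover define r where "r = p * d"
  ultimately have G1: "G1 \<in> carrier_mat r r" and G2: "G2 \<in> carrier_mat r p" by simp_all
  define N where "N = n * (m + p)"
  have Nc: "(m + p) * n = N" unfolding N_def by (rule mult.commute)
  define M where "M = M_mat D B L"
  let ?X = "A - L * C"
  have X: "?X \<in> carrier_mat n n" using mult_carrier_mat[OF L(1) dims(3)] by (rule minus_carrier_mat)
  note id = observer_identities[OF pos(1) X D dims(2) L(1), folded M_def, unfolded Nc]
  have Ac_eq: "comp_zeta A B C L = 1\<^sub>m (m + p) \<otimes>\<^sub>k companion (char_poly ?X)"
    using dims unfolding comp_zeta_def by simp
  have comp: "companion (char_poly ?X) \<in> carrier_mat n n"
    using degree_monic_char_poly[OF X] unfolding companion_def by simp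
  have Ac: "comp_zeta A B C L \<in> carrier_mat N N"
    using kron_id_carrier[OF comp, of "m + p"] unfolding Ac_eq Nc .
  have M: "M \<in> carrier_mat n N" using M_mat_carrier[OF dims(2) L(1)] unfolding M_def Nc .
  have MA: "M * comp_zeta A B C L = ?X * M" unfolding Ac_eq by (rule id(1))
  have dimr: "dim_row A = n" "dim_col B = m" "dim_row C = p" "dim_row G1 = r" "dim_col G1 = r"
    using dims G1 by auto
  have Ar: "A_rho D A B C L G1 G2 = four_block_mat (comp_zeta A B C L + E_zeta n m p * C * M) (0\<^sub>m N r) (G2 * C * M) G1"
    unfolding A_rho_def A_zeta_def dimr M_def N_def ..
  have Br: "B_rho A B C G1 = B_zeta n m p @\<^sub>r 0\<^sub>m r m" unfolding B_rho_def dimr ..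
  have stable: "Re \<mu> < 0" if "v \<in> carrier_vec N" "v \<noteq> 0\<^sub>v N" "cmat (comp_zeta A B C L) *\<^sub>v v = \<mu> \<cdot>\<^sub>v v" for v \<mu>
    using comp_zeta_stable[OF X pos(1) L(2), of v "m + p" \<mu>] that unfolding Ac_eq Nc by blast
  obtain K1 K2 where K: "K1 \<in> carrier_mat m n" "K2 \<in> carrier_mat m r"
    and gains: "\<And>x z \<mu>. x \<in> carrier_vec n \<Longrightarrow> z \<in> carrier_vec r \<Longrightarrow> \<not> (x = 0\<^sub>v n \<and> z = 0\<^sub>v r) \<Longrightarrow>
      cmat A *\<^sub>v x + cmat B *\<^sub>v (cmat K1 *\<^sub>v x + cmat K2 *\<^sub>v z) = \<mu> \<cdot>\<^sub>v x \<Longrightarrow>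
      cmat G2 *\<^sub>v (cmat C *\<^sub>v x) + cmat G1 *\<^sub>v z = \<mu> \<cdot>\<^sub>v z \<Longrightarrow> Re \<mu> < 0"
    using augmented_stabilizing_gains[OF dims(1-3,6) stab exo zeros im G1 G2] by blast
  have "\<exists>K \<in> carrier_mat m (N + r). hurwitz (A_rho D A B C L G1 G2 + B_rho A B C G1 * K)"
    unfolding Ar Br
    by (rule rho_stabilizing_gain[OF dims(1-3) L(1) M Ac id(4,5) MA id(2,3) G1 G2 stable K gains])
  moreover have "dim_row (A_rho D A B C L G1 G2) = N + r" "dim_col (B_rho A B C G1) = m"
    unfolding Ar Br using Ac id(4,5) M dims G1 by (auto simp: append_rows_def)
  ultimately have "stabilizable (A_rho D A B C L G1 G2) (B_rho A B C G1)"
    unfolding stabilizable_def by simp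
  moreover have "solves_output_regulation A B C E F S (comp_zeta A B C L) (B_zeta n m p) (E_zeta n m p) G1 G2 K"
    if K: "K \<in> carrier_mat m (n * (m + p) + dim_row G1)"
      and hur: "hurwitz (A_rho D A B C L G1 G2 + B_rho A B C G1 * K)" for K
  proof -
    have K': "K \<in> carrier_mat m (N + r)" using K unfolding N_def dimr .
    have "hurwitz (closed_loop_mat A B C (comp_zeta A B C L) (B_zeta n m p) (E_zeta n m p) G1 G2 K)"
      by (rule closed_loop_hurwitz[OF dims(1-3) L(1) M Ac id(4,5) MA id(2,3) G1 G2 K' L(2) hur[unfolded Ar Br]])
    note closed = this
    show ?thesis
      by (rule hurwitz_imp_output_regulation[OF dims pos(4) Ac id(4,5) G1 G2 K']) (fact exo im closed)+
  qed
  ultimately show ?thesis by blast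
qed

end
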